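(* Let $b\in\mathbb R^d$ and $\mu,\nu\in\mathcal P_2^b(\mathbb R^d)$. Then $$\Pi_{\succeq_c\mu}(\nu)=\Pi_{\succeq_c\nu}(\mu)=\mu\curlyvee\nu.$$ In dimension $d=1$ this set consists of exactly one element, namely $\mu\vee\nu$. In dimension $d>1$ it is a non-empty convex set which may contain more than one element. Moreover, for any $\overline\rho\in\mu\curlyvee\nu$, $$\min_{\rho\succeq_c\mu}Z_2(\nu,\rho)=\frac{m_2(\overline\rho)-m_2(\nu)}{2}=\frac{Z_2(\mu,\nu)-\frac12(m_2(\nu)-m_2(\mu))}{2},$$ $$\min_{\rho\succeq_c\nu}Z_2(\mu,\rho)=\frac{m_2(\overline\rho)-m_2(\mu)}{2}=\frac{Z_2(\mu,\nu)-\frac12(m_2(\mu)-m_2(\nu))}{2}.$$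
   Context: $\mathcal P_2^b(\mathbb R^d)$: probability measures with finite second moment and barycentre $b$; $m_2(\rho)=\int|z|^2\rho(dz)$. Convex order: $\mu\preceq_c\rho$ (also $\rho\succeq_c\mu$) iff $\int\varphi d\mu\le\int\varphi d\rho$ for all convex $\varphi$. $Z_2(\mu,\nu)=\max\{\int u\,d(\mu-\nu):u\in C^{1,1}(\mathbb R^d),\ \mathrm{lip}(\nabla u)\le1\}$. The Zolotarev projection is the set $\Pi_{\succeq_c\mu}(\nu)=\operatorname{arg\,min}\{Z_2(\nu,\rho):\rho\in\mathcal P_2(\mathbb R^d),\ \rho\succeq_c\mu\}$ (minima over $\rho\succeq_c\mu$ are over $\rho\in\mathcal P_2(\mathbb R^d)$). $\mu\curlyvee\nu=\operatorname{arg\,min}\{m_2(\rho):\rho\in\mathcal P_2(\mathbb R^d),\ \rho\succeq_c\mu,\ \rho\succeq_c\nu\}$. In $d=1$, with $G_\alpha(x)=\int(x-\xi)_+\alpha(d\xi)$, $\mu\vee\nu:=(\max\{G_\mu,G_\nu\})''$ (second distributional derivative). *)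

theory Defs
  imports "HOL-Probability.Probability"
begin

definition P2 :: "'a::euclidean_space measure \<Rightarrow> bool" where
  "P2 M \<longleftrightarrow> prob_space M \<and> sets M = sets borel \<and> integrable M (\<lambda>x. norm x ^ 2)"

definition P2b :: "'a::euclidean_space \<Rightarrow> 'a measure \<Rightarrow> bool" where
  "P2b b M \<longleftrightarrow> P2 M \<and> integral\<^sup>L M (\<lambda>x. x) = b"

definition m2 :: "'a::euclidean_space measure \<Rightarrow> real" where
  "m2 M = integral\<^sup>L M (\<lambda>x. norm x ^ 2)"

text \<open>Extended-real integral (positive part minus negative part); this is the
  usual value in (-inf, +inf] of the integral of a convex function.\<close>
definition ext_integral :: "'a measure \<Rightarrow> ('a \<Rightarrow> real) \<Rightarrow> ereal" where
  "ext_integral M f =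
     enn2ereal (\<integral>\<^sup>+x. ennreal (f x) \<partial>M) - enn2ereal (\<integral>\<^sup>+x. ennreal (- f x) \<partial>M)"

definition cx_le :: "'a::euclidean_space measure \<Rightarrow> 'a measure \<Rightarrow> bool" where
  "cx_le \<mu> \<rho> \<longleftrightarrow> (\<forall>\<phi>. convex_on UNIV \<phi> \<longrightarrow> ext_integral \<mu> \<phi> \<le> ext_integral \<rho> \<phi>)"

definition C11_1 :: "('a::euclidean_space \<Rightarrow> real) \<Rightarrow> bool" where
  "C11_1 u \<longleftrightarrow> (\<exists>g :: 'a \<Rightarrow> 'a. (\<forall>x. (u has_derivative (\<lambda>h. g x \<bullet> h)) (at x))
                     \<and> (\<forall>x y. norm (g x - g y) \<le> norm (x - y)))"

definition Z2 :: "'a::euclidean_space measure \<Rightarrow> 'a measure \<Rightarrow> real" where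
  "Z2 \<mu> \<nu> = Sup {integral\<^sup>L \<mu> u - integral\<^sup>L \<nu> u | u. C11_1 u}"

definition zproj :: "'a::euclidean_space measure \<Rightarrow> 'a measure \<Rightarrow> 'a measure set" where
  "zproj \<mu> \<nu> = {\<rho>. is_arg_min (Z2 \<nu>) (\<lambda>\<rho>. P2 \<rho> \<and> cx_le \<mu> \<rho>) \<rho>}"

definition cx_join :: "'a::euclidean_space measure \<Rightarrow> 'a measure \<Rightarrow> 'a measure set" where
  "cx_join \<mu> \<nu> = {\<rho>. is_arg_min m2 (\<lambda>\<rho>. P2 \<rho> \<and> cx_le \<mu> \<rho> \<and> cx_le \<nu> \<rho>) \<rho>}"

definition mix :: "real \<Rightarrow> 'a::euclidean_space measure \<Rightarrow> 'a measure \<Rightarrow> 'a measure" where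
  "mix t \<rho>1 \<rho>2 = measure_of UNIV (sets borel)
      (\<lambda>A. ennreal t * emeasure \<rho>1 A + ennreal (1 - t) * emeasure \<rho>2 A)"

definition mix_convex :: "'a::euclidean_space measure set \<Rightarrow> bool" where
  "mix_convex S \<longleftrightarrow> (\<forall>\<rho>1\<in>S. \<forall>\<rho>2\<in>S. \<forall>t\<in>{0..1}. mix t \<rho>1 \<rho>2 \<in> S)"

definition G :: "real measure \<Rightarrow> real \<Rightarrow> real" where
  "G \<alpha> x = integral\<^sup>L \<alpha> (\<lambda>\<xi>. max (x - \<xi>) 0)"

definition test_fun :: "(real \<Rightarrow> real) \<Rightarrow> bool" where
  "test_fun \<phi> \<longleftrightarrow> (\<forall>k x. ((deriv ^^ k) \<phi>) differentiable (at x))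
                    \<and> (\<exists>R. \<forall>x. R < \<bar>x\<bar> \<longrightarrow> \<phi> x = 0)"

definition is_dist_2nd_deriv :: "(real \<Rightarrow> real) \<Rightarrow> real measure \<Rightarrow> bool" where
  "is_dist_2nd_deriv f \<rho> \<longleftrightarrow> sets \<rho> = sets borel \<and>
     (\<forall>\<phi>. test_fun \<phi> \<longrightarrow> (LBINT x. f x * deriv (deriv \<phi>) x) = integral\<^sup>L \<rho> \<phi>)"

definition cx_max1 :: "real measure \<Rightarrow> real measure \<Rightarrow> real measure \<Rightarrow> bool" where
  "cx_max1 \<mu> \<nu> \<rho> \<longleftrightarrow> is_dist_2nd_deriv (\<lambda>x. max (G \<mu> x) (G \<nu> x)) \<rho>"

end

theory Submission
  imports Defs
begin

text \<open>
  A function \<open>u\<close> is admissible for \<open>Z2\<close> iff \<open>|x|\<^sup>2/2 + u\<close> and \<open>|x|\<^sup>2/2 - u\<close> are both convex. Testing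
  the convex order with these two functions gives weak duality: for every common upper bound \<open>\<rho>\<close>,
  \<open>Z2 \<mu> \<nu> + (m2 \<mu> + m2 \<nu>) / 2 \<le> m2 \<rho>\<close>.

  Equality is attained. For finitely many test functions this is Lagrange duality: a violated
  inequality yields convex \<open>w\<close>, \<open>v\<close> with \<open>w + v \<le> |z|\<^sup>2\<close> and too large a value of
  \<open>\<integral> w d\<mu> + \<integral> v d\<nu>\<close>, and the convex envelope of \<open>|z|\<^sup>2 - v\<close> turns them into an admissible \<open>u\<close>. The
  passage to all convex functions is by weak compactness. Hence \<open>cx_join \<mu> \<nu>\<close> consists of the common
  upper bounds with second moment \<open>D = Z2 \<mu> \<nu> + (m2 \<mu> + m2 \<nu>) / 2\<close>.

  If \<open>\<mu> \<preceq> \<rho>\<close>, the admissible function \<open>-(|x|\<^sup>2/2 + u)/2\<close> shows \<open>Z2 \<nu> \<rho> \<ge> (D - m2 \<nu>) / 2\<close>, with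
  equality on the join. Conversely let \<open>\<rho>\<close> attain the minimum. Duality for \<open>\<nu>\<close> and \<open>\<rho>\<close> gives a common
  upper bound \<open>\<sigma>\<close> of \<open>\<nu>\<close> and \<open>\<rho>\<close> with \<open>m2 \<sigma> \<le> D/2 + m2 \<rho>/2\<close>; as \<open>m2 \<sigma>\<close> is at least \<open>D\<close> and \<open>m2 \<rho>\<close>,
  all three coincide, so \<open>\<rho>\<close> and \<open>\<sigma>\<close> integrate convex functions equally and \<open>\<nu> \<preceq> \<rho>\<close>.

  On the line the convex order of measures with equal barycentres is the pointwise order of \<open>G\<close>, and
  the maximum of two functions \<open>G\<close> is again one, so the join is the least upper bound.
\<close>

section \<open>Convex functions and the admissible class\<close>

text \<open>Two obstacles shape the proof: \<open>m2\<close> can drop under weak limits, and the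
  real-valued \<open>Sup\<close> in \<open>Z2\<close> is meaningful only for a bounded set. A common
  upper bound, which exists because the barycentres agree, gives the boundedness and is also the
  strictly feasible point of the Lagrange duality. A loss of second moment in the limit is harmless:
  only an upper bound on \<open>m2\<close> has to survive, and weak duality supplies the lower one.
  The convex order is tested on finite maxima of affine functions. They have linear growth and
  parameters in a separable space, and an arbitrarily small multiple of \<open>|x|^2\<close> plus a
  constant dominates them, so one-sided limit statements suffice. The factor 1/2 in the projection
  values comes from the shift by \<open>|x|^2/2\<close>: in terms of Hessians, an admissible
  \<open>u\<close> lies between -1 and 1, so \<open>|x|^2/2 + u\<close> lies between 0 and 2, and
  only half of it is admissible again.\<close>

text \<open>A hyperplane separates the point \<open>(x, f x)\<close> from the strict epigraph. It is
  not vertical because \<open>f\<close> is finite on the whole space, so it is the graph of an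
  affine minorant touching at \<open>x\<close>.\<close>

lemma convex_subgradient:
  fixes f :: "'a::euclidean_space \<Rightarrow> real"
  assumes f: "convex_on UNIV f"
  shows "\<exists>p. \<forall>y. f y \<ge> f x + p \<bullet> (y - x)"
proof -
  define S where "S = {(y, t). f y < t}"
  have "convex S"
  proof (rule convexI)
    fix a b :: "'a \<times> real" and u v :: real
    assume ab: "a \<in> S" "b \<in> S" and uv: "0 \<le> u" "0 \<le> v" "u + v = 1"
    obtain y t z s where [simp]: "a = (y, t)" "b = (z, s)" by (cases a, cases b)
    have "f (u *\<^sub>R y + v *\<^sub>R z) \<le> u * f y + v * f z"
      using convex_onD[OF f, of v y z] uv by (simp add: eq_diff_eq[symmetric])
    also have "\<dots> < u * t + v * s"
    proof (cases "u = 0")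
      case True then show ?thesis using ab uv by (auto simp: S_def)
    next
      case False
      then have "u * f y < u * t" "v * f z \<le> v * s"
        using ab uv by (auto simp: S_def intro: mult_left_mono)
      then show ?thesis by linarith
    qed
    finally show "u *\<^sub>R a + v *\<^sub>R b \<in> S" by (simp add: S_def)
  qed
  moreover have "S \<noteq> {}" by (auto simp: S_def intro!: exI[of _ "f x + 1"] exI[of _ x])
  moreover have "{(x, f x)} \<inter> S = {}" by (auto simp: S_def)
  ultimately obtain a b where ab: "a \<noteq> 0" "a \<bullet> (x, f x) \<le> b" "\<And>z. z \<in> S \<Longrightarrow> a \<bullet> z \<ge> b"
    using separating_hyperplane_sets[of "{(x, f x)}" S] by (metis convex_singleton insert_not_empty singletonI)
  obtain q s where a: "a = (q, s)" by (cases a)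
  have ineq: "q \<bullet> x + s * f x \<le> q \<bullet> y + s * t" if "f y < t" for y t
    using ab(2) ab(3)[of "(y, t)"] that by (simp add: a S_def)
  have "s \<ge> 0" using ineq[of x "f x + 1"] by (simp add: algebra_simps)
  \<comment> \<open>If the hyperplane were vertical, moving from \<open>x\<close> in the direction
    \<open>- q\<close> would force \<open>q = 0\<close>.\<close>
  moreover have "s \<noteq> 0"
  proof
    assume "s = 0"
    then have "q \<bullet> x \<le> q \<bullet> (x - q)" using ineq[of "x - q" "f (x - q) + 1"] by simp
    then have "q \<bullet> q \<le> 0" by (simp add: inner_diff_right)
    then have "q = 0" using inner_gt_zero_iff[of q] by (meson not_less)
    with \<open>s = 0\<close> a ab(1) show False by (simp add: zero_prod_def)
  qed
  ultimately have "s > 0" by simp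
  have "f y \<ge> f x + (- (1/s) *\<^sub>R q) \<bullet> (y - x)" for y
  proof (rule field_le_epsilon)
    fix e :: real assume "e > 0"
    then have "q \<bullet> x + s * f x \<le> q \<bullet> y + s * (f y + e)" using ineq[of y "f y + e"] by simp
    then show "f x + (- (1/s) *\<^sub>R q) \<bullet> (y - x) \<le> f y + e"
      using \<open>s > 0\<close> by (simp add: inner_diff_right field_simps)
  qed
  then show ?thesis by blast
qed

lemma convex_on_if_subgradients:
  fixes f :: "'a::euclidean_space \<Rightarrow> real"
  assumes "\<And>x. \<exists>p. \<forall>y. f y \<ge> f x + p \<bullet> (y - x)"
  shows "convex_on UNIV f"
proof (rule convex_onI)
  fix t :: real and x y :: 'a
  assume t: "0 < t" "t < 1"
  let ?z = "(1 - t) *\<^sub>R x + t *\<^sub>R y"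
  obtain p where p: "\<And>y. f y \<ge> f ?z + p \<bullet> (y - ?z)" using assms by blast
  have xz: "x - ?z = t *\<^sub>R (x - y)" and yz: "y - ?z = (1 - t) *\<^sub>R (y - x)"
    by (simp_all add: algebra_simps)
  have "(1 - t) * (f ?z + p \<bullet> (x - ?z)) + t * (f ?z + p \<bullet> (y - ?z)) \<le> (1 - t) * f x + t * f y"
    using p[of x] p[of y] t by (intro add_mono mult_left_mono) auto
  moreover have "(1 - t) * (f ?z + p \<bullet> (x - ?z)) + t * (f ?z + p \<bullet> (y - ?z)) = f ?z"
    unfolding xz yz by (simp add: inner_diff_right algebra_simps)
  ultimately show "f ?z \<le> (1 - t) * f x + t * f y" by simp
qed simp

lemma convex_on_cSUP:
  fixes f :: "'i \<Rightarrow> 'a::real_vector \<Rightarrow> real"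
  assumes "I \<noteq> {}" "\<And>i. i \<in> I \<Longrightarrow> convex_on UNIV (f i)" "\<And>x. bdd_above ((\<lambda>i. f i x) ` I)"
  shows "convex_on UNIV (\<lambda>x. SUP i\<in>I. f i x)"
proof (rule convex_onI)
  fix t :: real and x y :: 'a
  assume t: "0 < t" "t < 1"
  show "(SUP i\<in>I. f i ((1 - t) *\<^sub>R x + t *\<^sub>R y)) \<le> (1 - t) * (SUP i\<in>I. f i x) + t * (SUP i\<in>I. f i y)"
  proof (rule cSUP_least)
    fix i assume i: "i \<in> I"
    have "f i ((1 - t) *\<^sub>R x + t *\<^sub>R y) \<le> (1 - t) * f i x + t * f i y"
      using convex_onD[OF assms(2)[OF i]] t by simp
    also have "\<dots> \<le> (1 - t) * (SUP i\<in>I. f i x) + t * (SUP i\<in>I. f i y)"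
      using t i assms(3) by (intro add_mono mult_left_mono cSUP_upper) auto
    finally show "f i ((1 - t) *\<^sub>R x + t *\<^sub>R y) \<le> \<dots>" .
  qed fact
qed simp

lemma convex_on_compose_affine:
  fixes f :: "'b::real_vector \<Rightarrow> real" and g :: "'a::real_vector \<Rightarrow> 'b"
  assumes "convex_on UNIV f" "\<And>t x y. g ((1 - t) *\<^sub>R x + t *\<^sub>R y) = (1 - t) *\<^sub>R g x + t *\<^sub>R g y"
  shows "convex_on UNIV (\<lambda>x. f (g x))"
  using convex_onD[OF assms(1)] by (intro convex_onI) (auto simp: assms(2))

lemma C11_1_uminus: "C11_1 u \<Longrightarrow> C11_1 (\<lambda>x. - u x)"
  unfolding C11_1_def
proof (elim exE conjE)
  fix g :: "'a \<Rightarrow> 'a"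
  assume g: "\<forall>x. (u has_derivative (\<lambda>h. g x \<bullet> h)) (at x)" "\<forall>x y. norm (g x - g y) \<le> norm (x - y)"
  show "\<exists>g. (\<forall>x. ((\<lambda>x. - u x) has_derivative (\<lambda>h. g x \<bullet> h)) (at x)) \<and> (\<forall>x y. norm (g x - g y) \<le> norm (x - y))"
  proof (intro exI[of _ "\<lambda>x. - g x"] conjI allI)
    show "((\<lambda>x. - u x) has_derivative (\<lambda>h. (- g x) \<bullet> h)) (at x)" for x
      using has_derivative_minus[OF g(1)[rule_format, of x]] by simp
    show "norm (- g x - - g y) \<le> norm (x - y)" for x y
      using g(2) by (metis minus_diff_minus norm_minus_cancel)
  qed
qed

text \<open>The 1-Lipschitz bound and Cauchy-Schwarz make the gradient \<open>x + g x\<close>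
  monotone; the mean value theorem along segments turns this into the subgradient inequality.
  Applied to \<open>- u\<close> it gives the convexity of the other function.\<close>

lemma C11_1_convex:
  fixes u :: "'a::euclidean_space \<Rightarrow> real"
  assumes "C11_1 u"
  shows "convex_on UNIV (\<lambda>x. (norm x)\<^sup>2 / 2 + u x)"
proof -
  obtain g where g: "\<And>x. (u has_derivative (\<lambda>h. g x \<bullet> h)) (at x)" "\<And>x y. norm (g x - g y) \<le> norm (x - y)"
    using assms unfolding C11_1_def by blast
  define f where "f = (\<lambda>x. (norm x)\<^sup>2 / 2 + u x)"
  have der: "(f has_derivative (\<lambda>h. (x + g x) \<bullet> h)) (at x)" for x
  proof -
    have "((\<lambda>x. x \<bullet> x / 2 + u x) has_derivative (\<lambda>h. (x \<bullet> h + h \<bullet> x) / 2 + g x \<bullet> h)) (at x)"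
      by (intro has_derivative_add bounded_linear.has_derivative[OF bounded_linear_divide] has_derivative_inner has_derivative_ident g)
    moreover have "(x \<bullet> h + h \<bullet> x) / 2 + g x \<bullet> h = (x + g x) \<bullet> h" for h
      by (simp add: inner_add_left inner_commute[of h x])
    ultimately show ?thesis unfolding f_def power2_norm_eq_inner by simp
  qed
  have mono: "(x + g x - (y + g y)) \<bullet> (x - y) \<ge> 0" for x y
  proof -
    have "- ((g x - g y) \<bullet> (x - y)) \<le> norm (g x - g y) * norm (x - y)"
      using Cauchy_Schwarz_ineq2[of "g x - g y" "x - y"] by linarith
    also have "\<dots> \<le> norm (x - y) * norm (x - y)" using g(2) by (simp add: mult_right_mono)
    also have "\<dots> = (x - y) \<bullet> (x - y)" by (simp add: power2_norm_eq_inner[symmetric] power2_eq_square)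
    finally show ?thesis by (simp add: inner_diff_left inner_diff_right inner_add_left)
  qed
  have "f y \<ge> f x + (x + g x) \<bullet> (y - x)" for x y
  proof -
    define \<phi> where "\<phi> = (\<lambda>t::real. f (x + t *\<^sub>R (y - x)))"
    have d: "(\<phi> has_real_derivative ((x + t *\<^sub>R (y - x)) + g (x + t *\<^sub>R (y - x))) \<bullet> (y - x)) (at t)" for t
    proof -
      have "((\<lambda>t. x + t *\<^sub>R (y - x)) has_derivative (\<lambda>h. h *\<^sub>R (y - x))) (at t)"
        by (auto intro!: derivative_eq_intros)
      from has_derivative_compose[OF this der] show ?thesis
        unfolding has_field_derivative_def \<phi>_def by (simp add: mult.commute[of _ "_ \<bullet> _"])
    qed
    obtain t where t: "0 < t" "t < 1"
      "\<phi> 1 - \<phi> 0 = (1 - 0) * (((x + t *\<^sub>R (y - x)) + g (x + t *\<^sub>R (y - x))) \<bullet> (y - x))"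
      using MVT2[of 0 1 \<phi>, OF zero_less_one d] by blast
    define z where "z = x + t *\<^sub>R (y - x)"
    have "(z + g z - (x + g x)) \<bullet> (z - x) \<ge> 0" by (rule mono)
    then have "t * ((z + g z - (x + g x)) \<bullet> (y - x)) \<ge> 0" by (simp add: z_def)
    then have "(z + g z - (x + g x)) \<bullet> (y - x) \<ge> 0" using t(1) by (simp add: zero_le_mult_iff)
    moreover have "f y - f x = (z + g z) \<bullet> (y - x)" using t(3) by (simp add: \<phi>_def z_def)
    ultimately show ?thesis by (simp add: inner_diff_left)
  qed
  then show ?thesis using convex_on_if_subgradients[of f] unfolding f_def by blast
qed

lemma C11_1_zero: "C11_1 (\<lambda>_. 0)"
  unfolding C11_1_def
proof (intro exI[of _ "\<lambda>_. 0"] conjI allI)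
  have "(\<lambda>h. 0 \<bullet> h) = (\<lambda>h. 0 :: real)" for h :: 'a by auto
  then show "((\<lambda>_. 0 :: real) has_derivative (\<lambda>h. 0 \<bullet> h)) (at x)" for x :: 'a by simp
qed auto

lemma convex_on_norm_sq: "convex_on UNIV (\<lambda>x :: 'a::euclidean_space. (norm x)\<^sup>2)"
proof -
  have "convex_on UNIV (\<lambda>x :: 'a. 2 * ((norm x)\<^sup>2 / 2 + 0))"
    by (intro convex_on_cmul C11_1_convex C11_1_zero) simp
  then show ?thesis by simp
qed

text \<open>Subgradients of the two functions at \<open>x\<close> add up to a subgradient of
  \<open>|x|^2\<close>, hence to \<open>2 x\<close>. This pins \<open>u\<close> between two
  parabolas with the same tangent at \<open>x\<close>, which yields differentiability. The Lipschitz
  bound with the exact constant 1 needs a comparison of the parabolas at two different base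
  points.\<close>

lemma C11_1I:
  fixes u :: "'a::euclidean_space \<Rightarrow> real"
  assumes p: "convex_on UNIV (\<lambda>x. (norm x)\<^sup>2 / 2 + u x)" and m: "convex_on UNIV (\<lambda>x. (norm x)\<^sup>2 / 2 - u x)"
  shows "C11_1 u"
proof -
  have "\<exists>g. \<forall>y. \<bar>u y - u x - g \<bullet> (y - x)\<bar> \<le> (norm (y - x))\<^sup>2 / 2" for x
  proof -
    obtain a where a: "\<And>y. (norm y)\<^sup>2 / 2 + u y \<ge> ((norm x)\<^sup>2 / 2 + u x) + a \<bullet> (y - x)"
      using convex_subgradient[OF p, of x] by blast
    obtain b where b: "\<And>y. (norm y)\<^sup>2 / 2 - u y \<ge> ((norm x)\<^sup>2 / 2 - u x) + b \<bullet> (y - x)"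
      using convex_subgradient[OF m, of x] by blast
    have s: "(norm y)\<^sup>2 \<ge> (norm x)\<^sup>2 + (a + b) \<bullet> (y - x)" for y
      using a[of y] b[of y] by (simp add: inner_add_left)
    have q: "(norm (x + h))\<^sup>2 = (norm x)\<^sup>2 + 2 * (x \<bullet> h) + (norm h)\<^sup>2" for h
      by (simp add: power2_norm_eq_inner inner_simps inner_commute)
    define k where "k = a + b - 2 *\<^sub>R x"
    have "k \<bullet> h \<le> (norm h)\<^sup>2" for h
      using s[of "x + h"] by (simp add: q k_def inner_diff_left)
    \<comment> \<open>The vector \<open>k / 2\<close> maximises \<open>k \<bullet> h - |h|^2\<close>
      over \<open>h\<close>.\<close>
    from this[of "(1/2) *\<^sub>R k"] have "(norm k)\<^sup>2 / 2 \<le> (norm k)\<^sup>2 / 4"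
      by (simp add: power2_norm_eq_inner[symmetric] power_divide)
    then have "(norm k)\<^sup>2 \<le> 0" by simp
    then have "k = 0" by simp
    then have bk: "b = 2 *\<^sub>R x - a" by (simp add: k_def algebra_simps)
    have "\<bar>u y - u x - (a - x) \<bullet> (y - x)\<bar> \<le> (norm (y - x))\<^sup>2 / 2" for y
    proof -
      have "(norm y)\<^sup>2 = (norm x)\<^sup>2 + 2 * (x \<bullet> (y - x)) + (norm (y - x))\<^sup>2" using q[of "y - x"] by simp
      then show ?thesis using a[of y] b[of y] 
        unfolding bk inner_diff_left inner_scaleR_left abs_le_iff by argo
    qed
    then show ?thesis by blast
  qed
  then obtain g where g: "\<And>x y. \<bar>u y - u x - g x \<bullet> (y - x)\<bar> \<le> (norm (y - x))\<^sup>2 / 2" by metis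
  have "(u has_derivative (\<lambda>h. g x \<bullet> h)) (at x)" for x
    unfolding has_derivative_at_alt
  proof (intro conjI allI impI)
    show "bounded_linear ((\<bullet>) (g x))" by (rule bounded_linear_inner_right)
    fix e :: real assume "e > 0"
    show "\<exists>d>0. \<forall>y. norm (y - x) < d \<longrightarrow> norm (u y - u x - g x \<bullet> (y - x)) \<le> e * norm (y - x)"
    proof (intro exI[of _ e] conjI allI impI)
      fix y assume "norm (y - x) < e"
      then have "norm (y - x) * norm (y - x) \<le> 2 * e * norm (y - x)"
        using \<open>e > 0\<close> by (intro mult_right_mono) auto
      then show "norm (u y - u x - g x \<bullet> (y - x)) \<le> e * norm (y - x)"
        using g[where x=x and y=y] by (simp add: power2_eq_square)
    qed fact
  qed
  moreover have "norm (g x - g y) \<le> norm (x - y)" for x y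
  proof -
    \<comment> \<open>comparing the two parabolic bounds at \<open>x + d \<plusminus> k / 2\<close>, the optimal points\<close>
    define d k where "d = (1/2) *\<^sub>R (y - x)" and "k = g x - g y"
    have y: "y = x + 2 *\<^sub>R d" by (simp add: d_def)
    define z z' where "z = x + d + (1/2) *\<^sub>R k" and "z' = x + d - (1/2) *\<^sub>R k"
    have 1: "u x + g x \<bullet> (z - x) - (norm (z - x))\<^sup>2 / 2 \<le> u z" "u z \<le> u y + g y \<bullet> (z - y) + (norm (z - y))\<^sup>2 / 2"
      using g[of z x] g[of z y] unfolding abs_le_iff by argo+
    have 2: "u y + g y \<bullet> (z' - y) - (norm (z' - y))\<^sup>2 / 2 \<le> u z'" "u z' \<le> u x + g x \<bullet> (z' - x) + (norm (z' - x))\<^sup>2 / 2"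
      using g[of z' x] g[of z' y] unfolding abs_le_iff by argo+
    have 3: "g x \<bullet> (z - x) - g y \<bullet> (z - y) + (g y \<bullet> (z' - y) - g x \<bullet> (z' - x))
        \<le> ((norm (z - x))\<^sup>2 + (norm (z - y))\<^sup>2 + (norm (z' - y))\<^sup>2 + (norm (z' - x))\<^sup>2) / 2"
      using 1 2 by argo
    have "g x \<bullet> (z - x) - g y \<bullet> (z - y) + (g y \<bullet> (z' - y) - g x \<bullet> (z' - x)) = (g x - g y) \<bullet> (z - z')"
      by (simp add: inner_diff_left inner_diff_right)
    also have "z - z' = k" by (simp add: z_def z'_def scaleR_add_left[symmetric])
    also have "(g x - g y) \<bullet> k = k \<bullet> k" by (simp add: k_def)
    finally have 4: "g x \<bullet> (z - x) - g y \<bullet> (z - y) + (g y \<bullet> (z' - y) - g x \<bullet> (z' - x)) = k \<bullet> k" .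
    have 5: "(norm (z - x))\<^sup>2 + (norm (z - y))\<^sup>2 + (norm (z' - y))\<^sup>2 + (norm (z' - x))\<^sup>2 = 4 * (d \<bullet> d) + k \<bullet> k"
      unfolding z_def z'_def y power2_norm_eq_inner
      by (simp add: inner_simps inner_commute algebra_simps scaleR_2)
    have "k \<bullet> k \<le> 4 * (d \<bullet> d)" using 3[unfolded 4 5] by simp
    also have "\<dots> = (norm (x - y))\<^sup>2" by (simp add: d_def power2_norm_eq_inner inner_simps inner_commute)
    finally have "(norm k)\<^sup>2 \<le> (norm (x - y))\<^sup>2" by (simp add: power2_norm_eq_inner)
    then show ?thesis unfolding k_def by (rule power2_le_imp_le) simp
  qed
  ultimately show ?thesis unfolding C11_1_def by blast
qed

text \<open>The defect \<open>t (1 - t) |e|^2\<close> is independent of \<open>z\<close>; so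
  averaging two translates of a function and subtracting a constant is compatible with a bound by
  \<open>c |z|^2\<close>.\<close>

lemma norm_affine_combination_sq:
  fixes z e :: "'a::real_inner"
  shows "t * (norm (z + (1 - t) *\<^sub>R e))\<^sup>2 + (1 - t) * (norm (z - t *\<^sub>R e))\<^sup>2 = (norm z)\<^sup>2 + t * (1 - t) * (norm e)\<^sup>2"
  unfolding power2_norm_eq_inner
  by (simp add: inner_simps inner_commute power2_eq_square algebra_simps)

text \<open>\<open>W\<close> is the convex envelope of \<open>h z = c |z|\<^sup>2 - v z\<close>. For every \<open>t\<close> and \<open>e\<close> the function
  \<open>t W (z + (1 - t) e) + (1 - t) W (z - t e) - c t (1 - t) |e|\<^sup>2\<close> of \<open>z\<close> is again a convex minorant of \<open>h\<close>,
  hence lies below \<open>W z\<close>, and this is the convexity of \<open>c |z|\<^sup>2 - W z\<close>.\<close>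

lemma convex_envelope_semiconcave:
  fixes w v :: "'a::euclidean_space \<Rightarrow> real"
  assumes w: "convex_on UNIV w" and v: "convex_on UNIV v" and c: "\<And>z. w z + v z \<le> c * (norm z)\<^sup>2"
  obtains W where "convex_on UNIV W" "convex_on UNIV (\<lambda>z. c * (norm z)\<^sup>2 - W z)"
    "\<And>z. w z \<le> W z" "\<And>z. W z \<le> c * (norm z)\<^sup>2 - v z"
proof -
  define h where "h z = c * (norm z)\<^sup>2 - v z" for z
  define \<Phi> where "\<Phi> = {\<phi>. convex_on UNIV \<phi> \<and> (\<forall>z. \<phi> z \<le> h z)}"
  define W where "W z = (SUP \<phi>\<in>\<Phi>. \<phi> z)" for z
  have w\<Phi>: "w \<in> \<Phi>" using w c by (auto simp: \<Phi>_def h_def algebra_simps)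
  have bdd: "bdd_above ((\<lambda>\<phi>. \<phi> z) ` \<Phi>)" for z
    by (rule bdd_aboveI[of _ "h z"]) (auto simp: \<Phi>_def)
  have up: "\<phi> z \<le> W z" if "\<phi> \<in> \<Phi>" for \<phi> z
    unfolding W_def by (rule cSUP_upper[OF that bdd])
  have Wh: "W z \<le> h z" for z
    unfolding W_def using w\<Phi> by (intro cSUP_least) (auto simp: \<Phi>_def)
  have Wc: "convex_on UNIV W"
    unfolding W_def using w\<Phi> bdd by (intro convex_on_cSUP) (auto simp: \<Phi>_def)
  have key: "t * W (z + (1 - t) *\<^sub>R e) + (1 - t) * W (z - t *\<^sub>R e) - c * (t * (1 - t) * (norm e)\<^sup>2) \<le> W z"
    if t: "0 < t" "t < 1" for t z e
  proof -
    define \<phi> where "\<phi> = (\<lambda>z. t * W (z + (1 - t) *\<^sub>R e) + (1 - t) * W (z - t *\<^sub>R e) + - (c * (t * (1 - t) * (norm e)\<^sup>2)))"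
    have "convex_on UNIV \<phi>"
      unfolding \<phi>_def using t
      by (intro convex_on_add convex_on_cmul convex_on_compose_affine[OF Wc])
        (auto simp: algebra_simps convex_on_const)
    moreover have "\<phi> z \<le> h z" for z
    proof -
      have "v ((1 - (1-t)) *\<^sub>R (z + (1 - t) *\<^sub>R e) + (1-t) *\<^sub>R (z - t *\<^sub>R e)) \<le> (1-(1-t)) * v (z + (1 - t) *\<^sub>R e) + (1 - t) * v (z - t *\<^sub>R e)"
        using convex_onD[OF v, of "1-t" "z + (1 - t) *\<^sub>R e" "z - t *\<^sub>R e"] t by simp
      also have "(1 - (1-t)) *\<^sub>R (z + (1 - t) *\<^sub>R e) + (1-t) *\<^sub>R (z - t *\<^sub>R e) = z" by (simp add: algebra_simps)
      finally have 1: "v z \<le> t * v (z + (1 - t) *\<^sub>R e) + (1 - t) * v (z - t *\<^sub>R e)" by simp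
      have "\<phi> z \<le> t * h (z + (1 - t) *\<^sub>R e) + (1 - t) * h (z - t *\<^sub>R e) - c * (t * (1 - t) * (norm e)\<^sup>2)"
        unfolding \<phi>_def using Wh t by (auto intro!: add_mono mult_left_mono)
      also have "\<dots> = c * (t * (norm (z + (1 - t) *\<^sub>R e))\<^sup>2 + (1 - t) * (norm (z - t *\<^sub>R e))\<^sup>2)
          - (t * v (z + (1 - t) *\<^sub>R e) + (1 - t) * v (z - t *\<^sub>R e)) - c * (t * (1 - t) * (norm e)\<^sup>2)"
        by (simp add: h_def algebra_simps)
      also have "\<dots> \<le> h z" using 1 unfolding norm_affine_combination_sq h_def by (simp add: distrib_left)
      finally show ?thesis .
    qed
    ultimately have "\<phi> \<in> \<Phi>" by (simp add: \<Phi>_def)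
    from up[OF this, of z] show ?thesis by (simp add: \<phi>_def)
  qed
  have "convex_on UNIV (\<lambda>z. c * (norm z)\<^sup>2 - W z)"
  proof (rule convex_onI)
    fix t :: real and x y :: 'a assume t: "0 < t" "t < 1"
    let ?z = "(1 - t) *\<^sub>R x + t *\<^sub>R y"
    have "t * W (?z + (1 - t) *\<^sub>R (y - x)) + (1 - t) * W (?z - t *\<^sub>R (y - x)) - c * (t * (1 - t) * (norm (y - x))\<^sup>2) \<le> W ?z"
      by (rule key[OF t])
    \<comment> \<open>With \<open>e = y - x\<close> the two translates of the intermediate point are
      exactly the endpoints.\<close>
    moreover have 1: "?z + (1 - t) *\<^sub>R (y - x) = y" "?z - t *\<^sub>R (y - x) = x" by (simp_all add: algebra_simps)
    moreover have "t * (norm y)\<^sup>2 + (1 - t) * (norm x)\<^sup>2 = (norm ?z)\<^sup>2 + t * (1 - t) * (norm (y - x))\<^sup>2"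
      using norm_affine_combination_sq[of t ?z "y - x"] unfolding 1 .
    then have "c * (t * (norm y)\<^sup>2 + (1 - t) * (norm x)\<^sup>2) = c * ((norm ?z)\<^sup>2 + t * (1 - t) * (norm (y - x))\<^sup>2)" by simp
    ultimately show "c * (norm ?z)\<^sup>2 - W ?z \<le> (1 - t) * (c * (norm x)\<^sup>2 - W x) + t * (c * (norm y)\<^sup>2 - W y)"
      by (simp add: algebra_simps)
  qed simp
  then show ?thesis using that[of W] Wc up[OF w\<Phi>] Wh by (auto simp: h_def)
qed

text \<open>\<open>c |z|\<^sup>2 - v z\<close> below is the Moreau envelope of \<open>\<phi>\<close>.\<close>

lemma Lipschitz_convex_approx:
  fixes \<phi> :: "'a::euclidean_space \<Rightarrow> real"
  assumes \<phi>: "convex_on UNIV \<phi>" and L: "\<And>x y. \<phi> x - \<phi> y \<le> L * norm (x - y)" and c: "c > 0"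
  obtains W where "convex_on UNIV W" "convex_on UNIV (\<lambda>z. c * (norm z)\<^sup>2 - W z)"
    "\<And>z. \<phi> z - L\<^sup>2 / (4 * c) \<le> W z" "\<And>z. W z \<le> \<phi> z"
proof -
  \<comment> \<open>This is the maximum of \<open>L s - c s^2\<close> over \<open>s\<close>, the
    largest gap between \<open>\<phi>\<close> and its Moreau envelope.\<close>
  define k where "k = L\<^sup>2 / (4 * c)"
  \<comment> \<open>Written as an affine function of \<open>z\<close>, so that the supremum
    \<open>v\<close> is convex; \<open>a_eq\<close> completes the square and shows the
    envelope.\<close>
  define a where "a y z = 2 * c * (y \<bullet> z) + (- c * (norm y)\<^sup>2 - \<phi> y)" for y z
  have a_eq: "a y z = c * (norm z)\<^sup>2 - \<phi> y - c * (norm (z - y))\<^sup>2" for y z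
    unfolding a_def power2_norm_eq_inner by (simp add: inner_simps inner_commute algebra_simps)
  have a_le: "a y z \<le> c * (norm z)\<^sup>2 - (\<phi> z - k)" for y z
  proof -
    have "0 \<le> c * (norm (z - y) - L / (2 * c))\<^sup>2" using c by simp
    also have "\<dots> = c * (norm (z - y))\<^sup>2 - L * norm (z - y) + k"
      using c unfolding k_def by (simp add: power2_eq_square field_simps)
    finally show ?thesis using L[of z y] by (simp add: a_eq)
  qed
  define v where "v z = (SUP y. a y z)" for z
  have bdd: "bdd_above (range (\<lambda>y. a y z))" for z
    using a_le by (intro bdd_aboveI[of _ "c * (norm z)\<^sup>2 - (\<phi> z - k)"]) auto
  have vc: "convex_on UNIV v" unfolding v_def
  proof (rule convex_on_cSUP)
    show "convex_on UNIV (a y)" for y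
      unfolding a_def by (intro convex_onI) (auto simp: inner_simps algebra_simps)
  qed (use bdd in auto)
  have wc: "convex_on UNIV (\<lambda>z. \<phi> z + - k)" by (intro convex_on_add \<phi>) (simp add: convex_on_const)
  have sum: "(\<phi> z + - k) + v z \<le> c * (norm z)\<^sup>2" for z
  proof -
    have "v z \<le> c * (norm z)\<^sup>2 - (\<phi> z - k)" unfolding v_def using a_le by (intro cSUP_least) auto
    then show ?thesis by simp
  qed
  have low: "c * (norm z)\<^sup>2 - v z \<le> \<phi> z" for z
    using cSUP_upper[OF UNIV_I bdd, of z z] by (simp add: v_def a_eq)
  show ?thesis
    by (rule convex_envelope_semiconcave[OF wc vc sum], rule that)
      (use low in \<open>auto simp: k_def intro: order_trans\<close>)
qed

section \<open>Integrals of convex functions and the convex order\<close>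

lemma P2D:
  assumes "P2 M"
  shows "prob_space M" "sets M = sets borel" "space M = UNIV" "integrable M (\<lambda>x. (norm x)\<^sup>2)"
  using assms sets_eq_imp_space_eq[of M borel] by (auto simp: P2_def)

lemma P2_measurable:
  assumes "P2 M" "f \<in> measurable borel N"
  shows "f \<in> measurable M N"
  using assms measurable_cong_sets[OF P2D(2)[OF assms(1)] refl, of N] by blast

lemma convex_on_borel_measurable:
  fixes f :: "'a::euclidean_space \<Rightarrow> real"
  assumes "convex_on UNIV f"
  shows "f \<in> borel_measurable borel"
  using convex_on_continuous[OF open_UNIV assms] by (rule borel_measurable_continuous_onI)

lemma P2_integrable_quadratic:
  fixes f :: "'a::euclidean_space \<Rightarrow> 'b::{banach, second_countable_topology}"
  assumes M: "P2 M" and "f \<in> borel_measurable borel" and le: "\<And>x. norm (f x) \<le> A + B * (norm x)\<^sup>2"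
  shows "integrable M f"
proof (rule Bochner_Integration.integrable_bound)
  interpret prob_space M using P2D(1)[OF M] .
  show "integrable M (\<lambda>x. A + B * (norm x)\<^sup>2)" using P2D(4)[OF M] by simp
  show "f \<in> borel_measurable M" using P2_measurable assms by blast
  show "AE x in M. norm (f x) \<le> norm (A + B * (norm x)\<^sup>2)"
    using order_trans[OF le abs_ge_self] by (intro AE_I2) simp
qed

lemma norm_le_one_plus_sq: "norm x \<le> 1 + (norm x)\<^sup>2"
proof -
  have "0 \<le> (norm x - 1/2)\<^sup>2" by simp
  then show ?thesis by (simp add: power2_eq_square algebra_simps)
qed

lemma P2_integrable_ident: "P2 M \<Longrightarrow> integrable M (\<lambda>x. x)"
  by (rule P2_integrable_quadratic[where A=1 and B=1]) (auto simp: norm_le_one_plus_sq)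

lemma abs_affine_le_quadratic: "\<bar>c + p \<bullet> x\<bar> \<le> (\<bar>c\<bar> + norm p) + norm p * (norm x)\<^sup>2"
proof -
  have "\<bar>p \<bullet> x\<bar> \<le> norm p * norm x" by (rule Cauchy_Schwarz_ineq2)
  also have "\<dots> \<le> norm p * (1 + (norm x)\<^sup>2)" by (intro mult_left_mono norm_le_one_plus_sq) auto
  finally show ?thesis by (simp add: distrib_left)
qed

text \<open>A convex function has an affine minorant, so only its growth from above is in
  question.\<close>

lemma P2_integrable_convex:
  fixes f :: "'a::euclidean_space \<Rightarrow> real"
  assumes M: "P2 M" and f: "convex_on UNIV f" and le: "\<And>x. f x \<le> A + B * (norm x)\<^sup>2"
  shows "integrable M f"
proof -
  obtain p where p: "\<And>y. f y \<ge> f 0 + p \<bullet> (y - 0)" using convex_subgradient[OF f] by blast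
  show ?thesis
  proof (rule P2_integrable_quadratic[OF M convex_on_borel_measurable[OF f]])
    fix x
    have "\<bar>f x\<bar> \<le> \<bar>A + B * (norm x)\<^sup>2\<bar> + \<bar>f 0 + p \<bullet> x\<bar>" using p[of x] le[of x] by simp
    also have "\<dots> \<le> (\<bar>A\<bar> + \<bar>B\<bar> * (norm x)\<^sup>2) + ((\<bar>f 0\<bar> + norm p) + norm p * (norm x)\<^sup>2)"
      using abs_triangle_ineq[of A "B * (norm x)\<^sup>2"]
      by (intro add_mono abs_affine_le_quadratic) (simp add: abs_mult)
    also have "\<dots> = (\<bar>A\<bar> + \<bar>f 0\<bar> + norm p) + (\<bar>B\<bar> + norm p) * (norm x)\<^sup>2" by (simp add: algebra_simps)
    finally show "norm (f x) \<le> (\<bar>A\<bar> + \<bar>f 0\<bar> + norm p) + (\<bar>B\<bar> + norm p) * (norm x)\<^sup>2" by simp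
  qed
qed

text \<open>The affine minorant of \<open>c |x|^2 - f\<close> is a quadratic majorant of
  \<open>f\<close>.\<close>

lemma P2_integrable_semiconcave:
  fixes f :: "'a::euclidean_space \<Rightarrow> real"
  assumes M: "P2 M" and f: "convex_on UNIV f" and g: "convex_on UNIV (\<lambda>x. c * (norm x)\<^sup>2 - f x)"
  shows "integrable M f"
proof -
  obtain p where p: "\<And>y. c * (norm y)\<^sup>2 - f y \<ge> (c * (norm (0::'a))\<^sup>2 - f 0) + p \<bullet> (y - 0)"
    using convex_subgradient[OF g, of 0] by blast
  show ?thesis
  proof (rule P2_integrable_convex[OF M f])
    fix x
    show "f x \<le> (\<bar>f 0\<bar> + norm p) + (c + norm p) * (norm x)\<^sup>2"
      using p[of x] abs_affine_le_quadratic[of "f 0" "- p" x] by (simp add: algebra_simps)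
  qed
qed

lemma P2_integrable_C11_1:
  assumes M: "P2 M" and u: "C11_1 u"
  shows "integrable M u"
proof -
  have "convex_on UNIV (\<lambda>x. (norm x)\<^sup>2 / 2 + u x)" by (rule C11_1_convex[OF u])
  moreover have "convex_on UNIV (\<lambda>x. 1 * (norm x)\<^sup>2 - ((norm x)\<^sup>2 / 2 + u x))"
    using C11_1_convex[OF C11_1_uminus[OF u]] by (simp add: field_simps)
  ultimately have "integrable M (\<lambda>x. (norm x)\<^sup>2 / 2 + u x)" by (rule P2_integrable_semiconcave[OF M])
  then have "integrable M (\<lambda>x. ((norm x)\<^sup>2 / 2 + u x) - (norm x)\<^sup>2 / 2)"
    using P2D(4)[OF M] by (intro Bochner_Integration.integrable_diff) auto
  then show ?thesis by simp
qed

lemma integral_half_sq_plus_C11_1: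
  assumes M: "P2 M" and u: "C11_1 u"
  shows "integrable M (\<lambda>x. (norm x)\<^sup>2 / 2 + u x)"
    and "integral\<^sup>L M (\<lambda>x. (norm x)\<^sup>2 / 2 + u x) = m2 M / 2 + integral\<^sup>L M u"
  using P2_integrable_C11_1[OF assms] P2D(4)[OF M] by (simp_all add: m2_def)

text \<open>The measure constructed on the line from \<open>G\<close> comes at first only with a
  first moment; its second moment follows from a comparison in convex order. The order is therefore
  developed for this larger class.\<close>

definition P1 :: "'a::euclidean_space measure \<Rightarrow> bool" where
  "P1 M \<longleftrightarrow> prob_space M \<and> sets M = sets borel \<and> integrable M (\<lambda>x. x)"

lemma P2_imp_P1: "P2 M \<Longrightarrow> P1 M"
  using P2_integrable_ident by (auto simp: P1_def P2_def)

lemma P1D: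
  assumes "P1 M"
  shows "prob_space M" "sets M = sets borel" "space M = UNIV" "integrable M (\<lambda>x. x)"
  using assms sets_eq_imp_space_eq[of M borel] by (auto simp: P1_def)

lemma P1_measurable:
  assumes "P1 M" "f \<in> measurable borel N"
  shows "f \<in> measurable M N"
  using assms measurable_cong_sets[OF P1D(2)[OF assms(1)] refl, of N] by blast

lemma P1_integrable_Lipschitz:
  fixes f :: "'a::euclidean_space \<Rightarrow> real"
  assumes M: "P1 M" and L: "\<And>x y. f x - f y \<le> L * norm (x - y)"
  shows "integrable M f"
proof (rule Bochner_Integration.integrable_bound)
  interpret prob_space M using P1D(1)[OF M] .
  show "integrable M (\<lambda>x. \<bar>f 0\<bar> + \<bar>L\<bar> * norm x)" using P1D(4)[OF M] by simp
  have Lb: "L * norm z \<le> \<bar>L\<bar> * norm z" for z :: 'a by (intro mult_right_mono) auto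
  have Lf: "f x - f y \<le> \<bar>L\<bar> * norm (x - y)" for x y using order_trans[OF L Lb] .
  have "\<bar>f x - f y\<bar> \<le> \<bar>L\<bar> * norm (x - y)" for x y
    using Lf[of x y] Lf[of y x] by (simp add: abs_le_iff norm_minus_commute)
  then have "\<bar>L\<bar>-lipschitz_on UNIV f" by (intro lipschitz_onI) (auto simp: dist_norm)
  then have "continuous_on UNIV f" by (rule lipschitz_on_continuous_on)
  then show "f \<in> borel_measurable M" by (intro P1_measurable[OF M] borel_measurable_continuous_onI)
  show "AE x in M. norm (f x) \<le> norm (\<bar>f 0\<bar> + \<bar>L\<bar> * norm x)"
  proof (rule AE_I2)
    fix x
    show "norm (f x) \<le> norm (\<bar>f 0\<bar> + \<bar>L\<bar> * norm x)"
      using Lf[of x 0] Lf[of 0 x] unfolding real_norm_def by (simp only: norm_minus_cancel diff_0 diff_0_right)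
  qed
qed

lemma ext_integral_integrable:
  assumes f: "integrable M f"
  shows "ext_integral M f = ereal (integral\<^sup>L M f)"
proof -
  have 1: "(\<integral>\<^sup>+x. ennreal (f x) \<partial>M) < \<infinity>" "(\<integral>\<^sup>+x. ennreal (- f x) \<partial>M) < \<infinity>"
    using f by (auto simp: real_integrable_def top.not_eq_extremum)
  then have "enn2ereal (\<integral>\<^sup>+x. ennreal (f x) \<partial>M) = ereal (enn2real (\<integral>\<^sup>+x. ennreal (f x) \<partial>M))"
    "enn2ereal (\<integral>\<^sup>+x. ennreal (- f x) \<partial>M) = ereal (enn2real (\<integral>\<^sup>+x. ennreal (- f x) \<partial>M))"
    by (simp_all add: enn2ereal_ennreal[symmetric])
  then show ?thesis unfolding ext_integral_def real_lebesgue_integral_def[OF f] by simp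
qed

text \<open>In the infinite case \<open>\<psi>\<close> is at most the positive part of
  \<open>\<psi> + l\<close> plus \<open>|l|\<close>, while the negative part of
  \<open>\<psi> + l\<close> is at most \<open>|l|\<close>; so no indeterminate difference
  arises.\<close>

lemma ext_integral_nonneg_plus:
  assumes \<psi>: "\<psi> \<in> borel_measurable M" "\<And>x. \<psi> x \<ge> 0" and l: "integrable M l"
  shows "ext_integral M (\<lambda>x. \<psi> x + l x) = enn2ereal (\<integral>\<^sup>+x. ennreal (\<psi> x) \<partial>M) + ereal (integral\<^sup>L M l)"
proof (cases "(\<integral>\<^sup>+x. ennreal (\<psi> x) \<partial>M) = \<infinity>")
  case False
  then have i: "integrable M \<psi>" using \<psi> by (intro integrableI_nonneg) (auto simp: top.not_eq_extremum)
  have "enn2ereal (\<integral>\<^sup>+x. ennreal (\<psi> x) \<partial>M) = ereal (integral\<^sup>L M \<psi>)"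
    using \<psi> by (subst nn_integral_eq_integral[OF i]) (auto simp: enn2ereal_ennreal)
  then show ?thesis
    using l i by (subst ext_integral_integrable) auto
next
  case True
  have [measurable]: "\<psi> \<in> borel_measurable M" "l \<in> borel_measurable M" using \<psi> l by auto
  have fin: "(\<integral>\<^sup>+x. ennreal \<bar>l x\<bar> \<partial>M) < \<infinity>" using l by (simp add: integrable_iff_bounded)
  have "(\<integral>\<^sup>+x. ennreal (\<psi> x) \<partial>M) \<le> (\<integral>\<^sup>+x. ennreal (\<psi> x + l x) + ennreal \<bar>l x\<bar> \<partial>M)"
  proof (rule nn_integral_mono)
    fix x
    have "ennreal (\<psi> x) \<le> ennreal (max 0 (\<psi> x + l x) + \<bar>l x\<bar>)" by (rule ennreal_leI) auto
    also have "\<dots> = ennreal (\<psi> x + l x) + ennreal \<bar>l x\<bar>" by (simp add: ennreal_plus max_def ennreal_neg)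
    finally show "ennreal (\<psi> x) \<le> ennreal (\<psi> x + l x) + ennreal \<bar>l x\<bar>" .
  qed
  also have "\<dots> = (\<integral>\<^sup>+x. ennreal (\<psi> x + l x) \<partial>M) + (\<integral>\<^sup>+x. ennreal \<bar>l x\<bar> \<partial>M)"
    by (rule nn_integral_add) auto
  finally have "(\<integral>\<^sup>+x. ennreal (\<psi> x + l x) \<partial>M) = \<infinity>"
    using fin True by (auto simp: top_unique)
  moreover have "(\<integral>\<^sup>+x. ennreal (- (\<psi> x + l x)) \<partial>M) \<le> (\<integral>\<^sup>+x. ennreal \<bar>l x\<bar> \<partial>M)"
    using \<psi>(2) by (intro nn_integral_mono ennreal_leI) (smt (verit, best))
  then have "(\<integral>\<^sup>+x. ennreal (- (\<psi> x + l x)) \<partial>M) < \<infinity>" using fin by simp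
  then obtain r where "(\<integral>\<^sup>+x. ennreal (- (\<psi> x + l x)) \<partial>M) = ennreal r" "r \<ge> 0"
    by (metis ennreal_cases infinity_ennreal_def less_irrefl)
  ultimately show ?thesis using True unfolding ext_integral_def by (simp add: enn2ereal_ennreal)
qed

lemma cx_leD:
  assumes "cx_le \<mu> \<rho>" "convex_on UNIV \<phi>" "integrable \<mu> \<phi>" "integrable \<rho> \<phi>"
  shows "integral\<^sup>L \<mu> \<phi> \<le> integral\<^sup>L \<rho> \<phi>"
  using assms by (auto simp: cx_le_def ext_integral_integrable)

lemma cx_le_trans: "cx_le \<mu> \<nu> \<Longrightarrow> cx_le \<nu> \<rho> \<Longrightarrow> cx_le \<mu> \<rho>"
  unfolding cx_le_def using order_trans by blast

section \<open>Finite maxima of affine functions as a test class for the convex order\<close>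

definition aff :: "'a::euclidean_space \<times> real \<Rightarrow> 'a \<Rightarrow> real" where
  "aff p x = fst p \<bullet> x + snd p"

text \<open>The separate first argument keeps the maximum nonempty. Coding affine functions by slope
  and offset places them in a Euclidean space, where a countable dense set is available.\<close>

primrec maxaff :: "'a::euclidean_space \<times> real \<Rightarrow> ('a \<times> real) list \<Rightarrow> 'a \<Rightarrow> real" where
  "maxaff p [] x = aff p x"
| "maxaff p (q # qs) x = max (aff q x) (maxaff p qs x)"

lemma convex_on_aff: "convex_on UNIV (aff p)"
  unfolding aff_def by (intro convex_onI) (auto simp: inner_simps algebra_simps)

lemma convex_on_max:
  fixes f g :: "'a::real_vector \<Rightarrow> real"
  assumes "convex_on UNIV f" "convex_on UNIV g"
  shows "convex_on UNIV (\<lambda>x. max (f x) (g x))"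
proof (rule convex_onI)
  fix t :: real and x y :: 'a assume t: "0 < t" "t < 1"
  have "(1 - t) * f x + t * f y \<le> (1 - t) * max (f x) (g x) + t * max (f y) (g y)"
    "(1 - t) * g x + t * g y \<le> (1 - t) * max (f x) (g x) + t * max (f y) (g y)"
    using t by (auto intro!: add_mono mult_left_mono)
  with convex_onD[OF assms(1), of t x y] convex_onD[OF assms(2), of t x y] t
  show "max (f ((1 - t) *\<^sub>R x + t *\<^sub>R y)) (g ((1 - t) *\<^sub>R x + t *\<^sub>R y))
    \<le> (1 - t) * max (f x) (g x) + t * max (f y) (g y)" by auto
qed simp

lemma convex_on_maxaff: "convex_on UNIV (maxaff p qs)"
proof (induction qs)
  case Nil
  have "maxaff p [] = aff p" by auto
  then show ?case using convex_on_aff[of p] by simp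
next
  case (Cons q qs)
  have "maxaff p (q # qs) = (\<lambda>x. max (aff q x) (maxaff p qs x))" by auto
  then show ?case using convex_on_max[OF convex_on_aff Cons] by simp
qed

lemma maxaff_Lipschitz: "\<exists>L\<ge>0. \<forall>x y. maxaff p qs x - maxaff p qs y \<le> L * norm (x - y)"
proof (induction qs)
  case Nil
  have "aff p x - aff p y \<le> norm (fst p) * norm (x - y)" for x y
    using norm_cauchy_schwarz[of "fst p" "x - y"] by (simp add: aff_def inner_diff_right)
  then show ?case by (intro exI[of _ "norm (fst p)"]) simp
next
  case (Cons q qs)
  then obtain L where L: "L \<ge> 0" "\<And>x y. maxaff p qs x - maxaff p qs y \<le> L * norm (x - y)" by blast
  define K where "K = max L (norm (fst q))"
  have 1: "maxaff p qs x - maxaff p qs y \<le> K * norm (x - y)" for x y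
    using L(2)[of x y] mult_right_mono[of L K "norm (x - y)"] by (simp add: K_def)
  have 2: "aff q x - aff q y \<le> K * norm (x - y)" for x y
    using norm_cauchy_schwarz[of "fst q" "x - y"] mult_right_mono[of "norm (fst q)" K "norm (x - y)"]
    by (simp add: aff_def inner_diff_right K_def)
  have "maxaff p (q # qs) x - maxaff p (q # qs) y \<le> K * norm (x - y)" for x y
    using 1[of x y] 2[of x y] by (simp add: max_def)
  moreover have "K \<ge> 0" using L(1) by (simp add: K_def)
  ultimately show ?case by blast
qed

lemma P1_integrable_maxaff: "P1 M \<Longrightarrow> integrable M (maxaff p qs)"
  using P1_integrable_Lipschitz maxaff_Lipschitz[of p qs] by blast

lemma P2_integrable_maxaff: "P2 M \<Longrightarrow> integrable M (maxaff p qs)"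
  by (rule P1_integrable_maxaff[OF P2_imp_P1])

lemma maxaff_le: "aff p x \<le> c \<Longrightarrow> (\<And>q. q \<in> set qs \<Longrightarrow> aff q x \<le> c) \<Longrightarrow> maxaff p qs x \<le> c"
  by (induction qs) auto

lemma base_le_maxaff: "aff p x \<le> maxaff p qs x"
  by (induction qs) auto

text \<open>Tangents are taken at a countable dense set. The subgradient inequality at
  \<open>d\<close>, evaluated at the reflected point \<open>2 d - x\<close>, bounds the tangent
  value at \<open>x\<close> below by \<open>2 \<phi> d - \<phi> (2 d - x)\<close>. This is
  continuous in \<open>d\<close> and equals \<open>\<phi> x\<close> at \<open>d = x\<close>, so no
  bound on the subgradients is required.\<close>

lemma convex_tangents_dense:
  fixes \<phi> :: "'a::euclidean_space \<Rightarrow> real"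
  assumes \<phi>: "convex_on UNIV \<phi>"
  obtains l :: "nat \<Rightarrow> 'a \<times> real" where "\<And>n x. aff (l n) x \<le> \<phi> x"
    "\<And>x e. e > 0 \<Longrightarrow> \<exists>n. \<phi> x - e < aff (l n) x"
proof -
  obtain s where s: "\<And>x y. \<phi> y \<ge> \<phi> x + s x \<bullet> (y - x)" using convex_subgradient[OF \<phi>] by metis
  obtain D :: "'a set" where D: "countable D" "\<And>X. open X \<Longrightarrow> X \<noteq> {} \<Longrightarrow> \<exists>d\<in>D. d \<in> X"
    using countable_dense_setE by blast
  have "D \<noteq> {}" using D(2)[of UNIV] by auto
  define d where "d = from_nat_into D"
  have rd: "range d = D" unfolding d_def using D(1) \<open>D \<noteq> {}\<close> by simp
  define l where "l n = (s (d n), \<phi> (d n) - s (d n) \<bullet> d n)" for n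
  have l: "aff (l n) x = \<phi> (d n) + s (d n) \<bullet> (x - d n)" for n x
    by (simp add: l_def aff_def inner_diff_right)
  have "\<exists>n. \<phi> x - e < aff (l n) x" if "e > 0" for x e
  proof -
    have cont: "continuous_on UNIV \<phi>" using convex_on_continuous[OF open_UNIV \<phi>] .
    define h where "h = (\<lambda>d. 2 * \<phi> d - \<phi> (2 *\<^sub>R d - x))"
    have "continuous_on UNIV h" unfolding h_def
      by (intro continuous_intros continuous_on_compose2[OF cont]) auto
    then have "open (h -` {\<phi> x - e<..})" by (simp add: open_vimage)
    moreover have "x \<in> h -` {\<phi> x - e<..}" using \<open>e > 0\<close> by (simp add: h_def scaleR_2)
    ultimately obtain n where n: "h (d n) > \<phi> x - e" using D(2)[of "h -` {\<phi> x - e<..}"] rd by blast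
    have "\<phi> (2 *\<^sub>R d n - x) \<ge> \<phi> (d n) + s (d n) \<bullet> ((2 *\<^sub>R d n - x) - d n)" by (rule s)
    moreover have "(2 *\<^sub>R d n - x) - d n = - (x - d n)" by (simp add: scaleR_2)
    ultimately have "aff (l n) x \<ge> h (d n)" unfolding l h_def by (simp only: inner_minus_right)
    then show ?thesis using n by (intro exI[of _ n]) simp
  qed
  then show ?thesis using that[of l] s l by metis
qed

text \<open>A convex function is the increasing limit of finite maxima of its tangents. Subtracting
  the first tangent makes everything nonnegative, so monotone convergence also covers infinite
  integrals.\<close>

lemma cx_leI_P1:
  fixes \<mu> \<rho> :: "'a::euclidean_space measure"
  assumes \<mu>: "P1 \<mu>" and \<rho>: "P1 \<rho>"
    and le: "\<And>p qs. integral\<^sup>L \<mu> (maxaff p qs) \<le> integral\<^sup>L \<rho> (maxaff p qs)"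
  shows "cx_le \<mu> \<rho>"
  unfolding cx_le_def
proof (intro allI impI)
  fix \<phi> :: "'a \<Rightarrow> real" assume \<phi>: "convex_on UNIV \<phi>"
  obtain l :: "nat \<Rightarrow> 'a \<times> real" where l: "\<And>n x. aff (l n) x \<le> \<phi> x"
    "\<And>x e. e > 0 \<Longrightarrow> \<exists>n. \<phi> x - e < aff (l n) x"
    using convex_tangents_dense[OF \<phi>] by blast
  define \<psi> where "\<psi> x = \<phi> x - aff (l 0) x" for x
  define f where "f n = maxaff (l 0) (rev (map l [0..<n]))" for n
  have fSuc: "f (Suc n) x = max (aff (l n) x) (f n x)" for n x by (simp add: f_def)
  have f_le: "f n x \<le> \<phi> x" for n x unfolding f_def using l(1) by (intro maxaff_le) auto
  have f_ge: "aff (l 0) x \<le> f n x" for n x unfolding f_def by (rule base_le_maxaff)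
  have f_inc: "incseq (\<lambda>n. f n x)" for x by (rule incseq_SucI) (simp add: fSuc)
  have f_lim: "(\<lambda>n. f n x) \<longlonglongrightarrow> \<phi> x" for x
  proof (rule increasing_LIMSEQ)
    show "f n x \<le> f (Suc n) x" for n by (simp add: fSuc)
    show "\<exists>n. \<phi> x \<le> f n x + e" if e: "0 < e" for e
    proof -
      obtain n where "\<phi> x - e < aff (l n) x" using l(2)[OF e] by blast
      then have "\<phi> x \<le> f (Suc n) x + e" by (simp add: fSuc)
      then show ?thesis by blast
    qed
  qed (use f_le in auto)
  have aff_int: "integrable M (aff (l 0))" if "P1 M" for M :: "'a measure"
    using P1_integrable_maxaff[OF that, of "l 0" "[]"] unfolding maxaff.simps .
  have nn: "(\<integral>\<^sup>+x. ennreal (\<psi> x) \<partial>M) = (SUP n. ennreal (integral\<^sup>L M (f n) - integral\<^sup>L M (aff (l 0))))"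
    if M: "P1 M" for M :: "'a measure"
  proof -
    have int: "integrable M (f n)" for n unfolding f_def by (rule P1_integrable_maxaff[OF M])
    have "(\<integral>\<^sup>+x. ennreal (\<psi> x) \<partial>M) = (\<integral>\<^sup>+x. (SUP n. ennreal (f n x - aff (l 0) x)) \<partial>M)"
    proof (rule nn_integral_cong)
      fix x
      have "(\<lambda>n. ennreal (f n x - aff (l 0) x)) \<longlonglongrightarrow> ennreal (\<psi> x)"
        unfolding \<psi>_def by (intro tendsto_ennrealI tendsto_diff f_lim tendsto_const)
      moreover have "incseq (\<lambda>n. ennreal (f n x - aff (l 0) x))"
        using f_inc by (auto simp: incseq_def intro!: ennreal_leI)
      ultimately show "ennreal (\<psi> x) = (SUP n. ennreal (f n x - aff (l 0) x))"
        using LIMSEQ_SUP LIMSEQ_unique by blast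
    qed
    also have "\<dots> = (SUP n. \<integral>\<^sup>+x. ennreal (f n x - aff (l 0) x) \<partial>M)"
    proof (rule nn_integral_monotone_convergence_SUP)
      show "incseq (\<lambda>n x. ennreal (f n x - aff (l 0) x))"
        using f_inc by (auto simp: incseq_def le_fun_def intro!: ennreal_leI)
      show "(\<lambda>x. ennreal (f n x - aff (l 0) x)) \<in> borel_measurable M" for n
        using borel_measurable_integrable[OF int[of n]] borel_measurable_integrable[OF aff_int[OF M]] by measurable
    qed
    also have "(\<lambda>n. \<integral>\<^sup>+x. ennreal (f n x - aff (l 0) x) \<partial>M) = (\<lambda>n. ennreal (integral\<^sup>L M (f n) - integral\<^sup>L M (aff (l 0))))"
    proof
      fix n
      have "(\<integral>\<^sup>+x. ennreal (f n x - aff (l 0) x) \<partial>M) = ennreal (integral\<^sup>L M (\<lambda>x. f n x - aff (l 0) x))"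
        using int[of n] aff_int[OF M] f_ge by (intro nn_integral_eq_integral) auto
      then show "(\<integral>\<^sup>+x. ennreal (f n x - aff (l 0) x) \<partial>M) = ennreal (integral\<^sup>L M (f n) - integral\<^sup>L M (aff (l 0)))"
        using int[of n] aff_int[OF M] by simp
    qed
    finally show ?thesis .
  qed
  \<comment> \<open>An affine function and its negative are both test functions, so the inequality
    becomes an equality.\<close>
  have aff_eq: "integral\<^sup>L \<mu> (aff (l 0)) = integral\<^sup>L \<rho> (aff (l 0))"
  proof (rule antisym)
    have m: "maxaff q [] = aff q" for q :: "'a \<times> real" by auto
    show "integral\<^sup>L \<mu> (aff (l 0)) \<le> integral\<^sup>L \<rho> (aff (l 0))" using le[of "l 0" "[]"] by (simp add: m)
    have neg: "aff (- fst (l 0), - snd (l 0)) = (\<lambda>x. - aff (l 0) x)" by (auto simp: aff_def)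
    show "integral\<^sup>L \<rho> (aff (l 0)) \<le> integral\<^sup>L \<mu> (aff (l 0))"
      using le[of "(- fst (l 0), - snd (l 0))" "[]"] by (simp add: m neg)
  qed
  have eq: "ext_integral M \<phi> = enn2ereal (\<integral>\<^sup>+x. ennreal (\<psi> x) \<partial>M) + ereal (integral\<^sup>L M (aff (l 0)))"
    if M: "P1 M" for M :: "'a measure"
  proof -
    have "\<psi> \<in> borel_measurable M"
      unfolding \<psi>_def using P1_measurable[OF M convex_on_borel_measurable[OF \<phi>]]
        borel_measurable_integrable[OF aff_int[OF M]] by measurable
    from ext_integral_nonneg_plus[OF this _ aff_int[OF M]] l(1)[of 0] show ?thesis
      by (simp add: \<psi>_def)
  qed
  have "(\<integral>\<^sup>+x. ennreal (\<psi> x) \<partial>\<mu>) \<le> (\<integral>\<^sup>+x. ennreal (\<psi> x) \<partial>\<rho>)"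
    unfolding nn[OF \<mu>] nn[OF \<rho>] aff_eq using le by (intro SUP_mono' ennreal_leI) (simp add: f_def)
  then show "ext_integral \<mu> \<phi> \<le> ext_integral \<rho> \<phi>"
    unfolding eq[OF \<mu>] eq[OF \<rho>] aff_eq by (intro add_right_mono) (simp add: less_eq_ennreal.rep_eq)
qed

lemmas cx_leI = cx_leI_P1[OF P2_imp_P1 P2_imp_P1]

lemma cx_le_barycentre:
  fixes \<mu> \<rho> :: "'a::euclidean_space measure"
  assumes "P2 \<mu>" "P2 \<rho>" "cx_le \<mu> \<rho>"
  shows "integral\<^sup>L \<mu> (\<lambda>x. x) = integral\<^sup>L \<rho> (\<lambda>x. x)"
proof (rule euclidean_eqI)
  fix i :: 'a
  have int: "integrable M (\<lambda>x. p \<bullet> x)" if "P2 M" for M and p :: 'a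
    using P2_integrable_ident[OF that] by (intro integrable_inner_right)
  have le: "integral\<^sup>L \<mu> (\<lambda>x. p \<bullet> x) \<le> integral\<^sup>L \<rho> (\<lambda>x. p \<bullet> x)" for p
  proof (rule cx_leD[OF assms(3)])
    have "aff (p, 0) = (\<lambda>x. p \<bullet> x)" by (auto simp: aff_def)
    then show "convex_on UNIV (\<lambda>x. p \<bullet> x)" using convex_on_aff[of "(p, 0)"] by simp
  qed (use int assms(1,2) in auto)
  have "integral\<^sup>L \<mu> (\<lambda>x. i \<bullet> x) = integral\<^sup>L \<rho> (\<lambda>x. i \<bullet> x)"
    using le[of i] le[of "- i"] by simp
  then show "integral\<^sup>L \<mu> (\<lambda>x. x) \<bullet> i = integral\<^sup>L \<rho> (\<lambda>x. x) \<bullet> i"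
    using P2_integrable_ident[OF assms(1)] P2_integrable_ident[OF assms(2)]
    by (simp add: integral_inner_right inner_commute)
qed

section \<open>Duality for finitely many constraints\<close>

lemma mix_measure:
  fixes \<rho>1 \<rho>2 :: "'a::euclidean_space measure"
  assumes P: "P2 \<rho>1" "P2 \<rho>2"
  shows sets_mix: "sets (mix t \<rho>1 \<rho>2) = sets borel"
    and emeasure_mix: "A \<in> sets borel \<Longrightarrow>
      emeasure (mix t \<rho>1 \<rho>2) A = ennreal t * emeasure \<rho>1 A + ennreal (1 - t) * emeasure \<rho>2 A"
proof -
  have sp: "sigma_algebra UNIV (sets (borel :: 'a measure))"
    using sets.sigma_algebra_axioms[of borel] by simp
  then show "sets (mix t \<rho>1 \<rho>2) = sets borel"
    unfolding mix_def using sigma_algebra.sigma_sets_eq[OF sp] by simp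
  assume A: "A \<in> sets borel"
  show "emeasure (mix t \<rho>1 \<rho>2) A = ennreal t * emeasure \<rho>1 A + ennreal (1 - t) * emeasure \<rho>2 A"
    unfolding mix_def
  proof (rule emeasure_measure_of_sigma[OF sp])
    show "positive (sets borel) (\<lambda>A. ennreal t * emeasure \<rho>1 A + ennreal (1 - t) * emeasure \<rho>2 A)"
      by (simp add: positive_def)
    show "countably_additive (sets borel) (\<lambda>A. ennreal t * emeasure \<rho>1 A + ennreal (1 - t) * emeasure \<rho>2 A)"
    proof (rule countably_additiveI)
      fix B :: "nat \<Rightarrow> 'a set"
      assume B: "range B \<subseteq> sets borel" "disjoint_family B"
      have "(\<Sum>i. emeasure \<rho> (B i)) = emeasure \<rho> (\<Union>i. B i)" if "P2 \<rho>" for \<rho>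
        using B P2D(2)[OF that] by (intro suminf_emeasure) auto
      then show "(\<Sum>i. ennreal t * emeasure \<rho>1 (B i) + ennreal (1 - t) * emeasure \<rho>2 (B i)) =
        ennreal t * emeasure \<rho>1 (\<Union>i. B i) + ennreal (1 - t) * emeasure \<rho>2 (\<Union>i. B i)"
        using P by (simp add: suminf_add[symmetric] ennreal_suminf_cmult)
    qed
  qed (use A in auto)
qed

lemma nn_integral_mix:
  fixes \<rho>1 \<rho>2 :: "'a::euclidean_space measure"
  assumes P: "P2 \<rho>1" "P2 \<rho>2" and f: "f \<in> borel_measurable borel"
  shows "(\<integral>\<^sup>+x. f x \<partial>mix t \<rho>1 \<rho>2) = ennreal t * (\<integral>\<^sup>+x. f x \<partial>\<rho>1) + ennreal (1 - t) * (\<integral>\<^sup>+x. f x \<partial>\<rho>2)"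
  using f
proof (induction rule: borel_measurable_induct)
  case (cong f g)
  have "f = g" using cong by auto
  then show ?case using cong by simp
next
  case (set A)
  then show ?case
    using sets_mix[OF P, of t] P2D(2)[OF P(1)] P2D(2)[OF P(2)] by (simp add: emeasure_mix[OF P])
next
  case (mult f c)
  then show ?case
    by (simp add: nn_integral_cmult measurable_cong_sets[OF sets_mix[OF P] refl]
      measurable_cong_sets[OF P2D(2)[OF P(1)] refl] measurable_cong_sets[OF P2D(2)[OF P(2)] refl] distrib_left mult_ac)
next
  case (add f g)
  then show ?case
    by (simp add: nn_integral_add measurable_cong_sets[OF sets_mix[OF P] refl]
      measurable_cong_sets[OF P2D(2)[OF P(1)] refl] measurable_cong_sets[OF P2D(2)[OF P(2)] refl] distrib_left add_ac)
next
  case (seq U)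
  have m: "(\<integral>\<^sup>+x. (SUP i. U i) x \<partial>M) = (SUP i. \<integral>\<^sup>+x. U i x \<partial>M)" if M: "sets M = sets borel" for M
  proof -
    have "U i \<in> borel_measurable M" for i using seq(1) by (simp add: measurable_cong_sets[OF M refl])
    then have "(\<integral>\<^sup>+x. (SUP i. U i x) \<partial>M) = (SUP i. \<integral>\<^sup>+x. U i x \<partial>M)"
      using \<open>incseq U\<close> by (intro nn_integral_monotone_convergence_SUP)
    then show ?thesis by (simp add: image_comp)
  qed
  have inc: "incseq (\<lambda>i. \<integral>\<^sup>+x. U i x \<partial>M)" for M
    using \<open>incseq U\<close> by (auto simp: incseq_def le_fun_def intro!: nn_integral_mono)
  show ?case
    unfolding m[OF sets_mix[OF P]] m[OF P2D(2)[OF P(1)]] m[OF P2D(2)[OF P(2)]] seq.IH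
    using inc by (simp add: SUP_mult_left_ennreal ennreal_SUP_add incseq_def mult_left_mono)
qed

lemma mix_integral:
  fixes \<rho>1 \<rho>2 :: "'a::euclidean_space measure" and f :: "'a \<Rightarrow> real"
  assumes P: "P2 \<rho>1" "P2 \<rho>2" and t: "0 \<le> t" "t \<le> 1" and f: "f \<in> borel_measurable borel"
    and int: "integrable \<rho>1 f" "integrable \<rho>2 f"
  shows "integrable (mix t \<rho>1 \<rho>2) f" (is ?I)
    and "integral\<^sup>L (mix t \<rho>1 \<rho>2) f = t * integral\<^sup>L \<rho>1 f + (1 - t) * integral\<^sup>L \<rho>2 f" (is ?E)
proof -
  have fin: "(\<integral>\<^sup>+x. ennreal \<bar>f x\<bar> \<partial>\<rho>1) < \<infinity>" "(\<integral>\<^sup>+x. ennreal \<bar>f x\<bar> \<partial>\<rho>2) < \<infinity>"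
    using int by (simp_all add: integrable_iff_bounded)
  have "(\<integral>\<^sup>+x. ennreal \<bar>f x\<bar> \<partial>mix t \<rho>1 \<rho>2) < \<infinity>"
    using fin f by (subst nn_integral_mix[OF P]) (auto simp: ennreal_mult_less_top)
  then show I: ?I
    using f by (simp add: integrable_iff_bounded measurable_cong_sets[OF sets_mix[OF P] refl])
  have split: "enn2real (\<integral>\<^sup>+x. ennreal (g x) \<partial>mix t \<rho>1 \<rho>2)
      = t * enn2real (\<integral>\<^sup>+x. ennreal (g x) \<partial>\<rho>1) + (1 - t) * enn2real (\<integral>\<^sup>+x. ennreal (g x) \<partial>\<rho>2)"
    if g: "g \<in> borel_measurable borel" "integrable \<rho>1 g" "integrable \<rho>2 g" for g :: "'a \<Rightarrow> real"
  proof -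
    have "(\<integral>\<^sup>+x. ennreal (g x) \<partial>\<rho>1) < \<infinity>" "(\<integral>\<^sup>+x. ennreal (g x) \<partial>\<rho>2) < \<infinity>"
      using g by (auto simp: real_integrable_def top.not_eq_extremum)
    then show ?thesis
      using g t by (subst nn_integral_mix[OF P]) (auto simp: enn2real_plus enn2real_mult ennreal_mult_less_top)
  qed
  show ?E
    unfolding real_lebesgue_integral_def[OF I] real_lebesgue_integral_def[OF int(1)] real_lebesgue_integral_def[OF int(2)]
    using f int by (simp add: split algebra_simps)
qed

lemma P2_mix:
  fixes \<rho>1 \<rho>2 :: "'a::euclidean_space measure"
  assumes P: "P2 \<rho>1" "P2 \<rho>2" and t: "0 \<le> t" "t \<le> 1"
  shows "P2 (mix t \<rho>1 \<rho>2)"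
proof -
  have "space (mix t \<rho>1 \<rho>2) = UNIV" using sets_eq_imp_space_eq[OF sets_mix[OF P, of t]] by simp
  moreover have "emeasure \<rho> UNIV = 1" if "P2 \<rho>" for \<rho> :: "'a measure"
    using prob_space.emeasure_space_1[OF P2D(1)[OF that]] P2D(3)[OF that] by simp
  moreover have "ennreal t + ennreal (1 - t) = 1"
    using t by (simp flip: ennreal_plus)
  ultimately have "prob_space (mix t \<rho>1 \<rho>2)"
    using P by (intro prob_spaceI) (simp add: emeasure_mix[OF P])
  then show ?thesis
    using mix_integral(1)[OF P t _ P2D(4)[OF P(1)] P2D(4)[OF P(2)]] sets_mix[OF P] by (simp add: P2_def)
qed

lemma m2_mix:
  assumes "P2 \<rho>1" "P2 \<rho>2" "0 \<le> t" "t \<le> 1"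
  shows "m2 (mix t \<rho>1 \<rho>2) = t * m2 \<rho>1 + (1 - t) * m2 \<rho>2"
  unfolding m2_def using assms by (intro mix_integral) (auto simp: P2D(4))

lemma cx_le_mix:
  fixes \<mu> :: "'a::euclidean_space measure"
  assumes "P2 \<mu>" "P2 \<rho>1" "P2 \<rho>2" "0 \<le> t" "t \<le> 1" "cx_le \<mu> \<rho>1" "cx_le \<mu> \<rho>2"
  shows "cx_le \<mu> (mix t \<rho>1 \<rho>2)"
proof (rule cx_leI)
  fix p :: "'a \<times> real" and qs
  let ?\<phi> = "maxaff p qs"
  have "integral\<^sup>L \<mu> ?\<phi> = t * integral\<^sup>L \<mu> ?\<phi> + (1 - t) * integral\<^sup>L \<mu> ?\<phi>" by (simp add: algebra_simps)
  also have "\<dots> \<le> t * integral\<^sup>L \<rho>1 ?\<phi> + (1 - t) * integral\<^sup>L \<rho>2 ?\<phi>"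
    using assms by (intro add_mono mult_left_mono cx_leD convex_on_maxaff P2_integrable_maxaff) auto
  also have "\<dots> = integral\<^sup>L (mix t \<rho>1 \<rho>2) ?\<phi>"
    using assms by (intro mix_integral(2)[symmetric] convex_on_borel_measurable convex_on_maxaff P2_integrable_maxaff) auto
  finally show "integral\<^sup>L \<mu> ?\<phi> \<le> integral\<^sup>L (mix t \<rho>1 \<rho>2) ?\<phi>" .
qed (use assms P2_mix in auto)

section \<open>Weak duality and boundedness of the admissible values\<close>

lemma half_sq_plus_C11_1_mono:
  assumes P: "P2 \<mu>" "P2 \<rho>" and le: "cx_le \<mu> \<rho>" and u: "C11_1 u"
  shows "m2 \<mu> / 2 + integral\<^sup>L \<mu> u \<le> m2 \<rho> / 2 + integral\<^sup>L \<rho> u"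
  using cx_leD[OF le C11_1_convex[OF u] integral_half_sq_plus_C11_1(1)[OF P(1) u] integral_half_sq_plus_C11_1(1)[OF P(2) u]]
  by (simp only: integral_half_sq_plus_C11_1(2)[OF _ u] P)

text \<open>Using \<open>u\<close> for \<mu> and \<open>- u\<close> for \<nu>, the two integrals of
  \<open>u\<close> against \<rho> cancel in the sum.\<close>

lemma weak_duality:
  assumes "P2 \<mu>" "P2 \<nu>" "P2 \<rho>" and "cx_le \<mu> \<rho>" "cx_le \<nu> \<rho>" and u: "C11_1 u"
  shows "integral\<^sup>L \<mu> u - integral\<^sup>L \<nu> u \<le> m2 \<rho> - (m2 \<mu> + m2 \<nu>) / 2"
  using half_sq_plus_C11_1_mono[of \<mu> \<rho> u] half_sq_plus_C11_1_mono[OF _ _ _ C11_1_uminus[OF u], of \<nu> \<rho>] assms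
  by (simp add: field_simps)

text \<open>Jensen's inequality, by integrating the subgradient inequality at the
  barycentre.\<close>

lemma convex_barycentre_le:
  fixes \<phi> :: "'a::euclidean_space \<Rightarrow> real"
  assumes M: "P2 M" and \<phi>: "convex_on UNIV \<phi>" and int: "integrable M \<phi>"
  shows "\<phi> (integral\<^sup>L M (\<lambda>x. x)) \<le> integral\<^sup>L M \<phi>"
proof -
  interpret prob_space M using P2D(1)[OF M] .
  let ?b = "integral\<^sup>L M (\<lambda>x. x)"
  obtain p where p: "\<And>y. \<phi> y \<ge> \<phi> ?b + p \<bullet> (y - ?b)" using convex_subgradient[OF \<phi>] by blast
  have "integral\<^sup>L M (\<lambda>x. \<phi> ?b + p \<bullet> (x - ?b)) \<le> integral\<^sup>L M \<phi>"
    using P2_integrable_ident[OF M] p by (intro integral_mono int) auto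
  then show ?thesis using P2_integrable_ident[OF M] by (simp add: inner_diff_right prob_space)
qed

text \<open>With \<open>T x = 2 x - b\<close>, the mixture of the images of \<open>\<mu>\<close> and \<open>\<nu>\<close> under \<open>T\<close> is an upper bound:
  \<open>\<phi> x \<le> (\<phi> (T x) + \<phi> b) / 2\<close> by convexity, and \<open>\<phi> b\<close> is at most the integral of \<open>\<phi> \<circ> T\<close>.\<close>

lemma exists_cx_upper_bound:
  fixes \<mu> \<nu> :: "'a::euclidean_space measure"
  assumes b: "P2b b \<mu>" "P2b b \<nu>"
  obtains \<rho> where "P2 \<rho>" "cx_le \<mu> \<rho>" "cx_le \<nu> \<rho>"
proof -
  define T where "T x = 2 *\<^sub>R x - b" for x :: 'a
  have T: "T ((1 - t) *\<^sub>R x + t *\<^sub>R y) = (1 - t) *\<^sub>R T x + t *\<^sub>R T y" for t x y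
    by (simp add: T_def algebra_simps)
  have Tm[measurable]: "T \<in> borel_measurable borel" unfolding T_def[abs_def] by measurable
  have PT: "P2 (distr M borel T)" if M: "P2 M" for M
  proof -
    note TM = P2_measurable[OF M Tm]
    have "integrable M (\<lambda>x. (norm (T x))\<^sup>2)"
    proof (rule P2_integrable_quadratic[OF M, where A="2 * (norm b)\<^sup>2" and B=8])
      fix x
      have "(norm (T x))\<^sup>2 \<le> (2 * norm x + norm b)\<^sup>2"
        unfolding T_def using norm_triangle_ineq4[of "2 *\<^sub>R x" b] by (intro power_mono) auto
      also have "\<dots> \<le> 2 * (norm b)\<^sup>2 + 8 * (norm x)\<^sup>2"
        using zero_le_power2[of "2 * norm x - norm b"] by (simp add: power2_eq_square algebra_simps)
      finally show "norm ((norm (T x))\<^sup>2) \<le> 2 * (norm b)\<^sup>2 + 8 * (norm x)\<^sup>2" by simp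
    qed measurable
    then show ?thesis
      using prob_space.prob_space_distr[OF P2D(1)[OF M] TM] integrable_distr_eq[OF TM, of "\<lambda>x. (norm x)\<^sup>2"]
      by (simp add: P2_def)
  qed
  define \<rho> where "\<rho> M N = mix (1/2) (distr M borel T) (distr N borel T)" for M N
  have \<rho>: "P2 (\<rho> M N)" if "P2 M" "P2 N" for M N unfolding \<rho>_def using that by (intro P2_mix PT) auto
  have int\<rho>: "integral\<^sup>L (\<rho> M N) \<phi> = (integral\<^sup>L M (\<lambda>x. \<phi> (T x)) + integral\<^sup>L N (\<lambda>x. \<phi> (T x))) / 2"
    and le: "integral\<^sup>L M \<phi> \<le> integral\<^sup>L (\<rho> M N) \<phi>"
    if M: "P2b b M" and N: "P2b b N" and \<phi>: "\<phi> = maxaff p qs" for M N \<phi> p qs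
  proof -
    have P: "P2 M" "P2 N" and bar: "integral\<^sup>L N (\<lambda>x. x) = b" using M N by (auto simp: P2b_def)
    have c: "convex_on UNIV \<phi>" unfolding \<phi> by (rule convex_on_maxaff)
    have m[measurable]: "\<phi> \<in> borel_measurable borel" by (rule convex_on_borel_measurable[OF c])
    have i: "integrable K \<phi>" if "P2 K" for K unfolding \<phi> by (rule P2_integrable_maxaff[OF that])
    have iT: "integrable K (\<lambda>x. \<phi> (T x))" if "P2 K" for K
      using i[OF PT[OF that]] integrable_distr_eq[OF P2_measurable[OF that Tm] m] by simp
    have dT: "integral\<^sup>L (distr K borel T) \<phi> = integral\<^sup>L K (\<lambda>x. \<phi> (T x))" if "P2 K" for K
      by (rule integral_distr[OF P2_measurable[OF that Tm] m])
    show eq: "integral\<^sup>L (\<rho> M N) \<phi> = (integral\<^sup>L M (\<lambda>x. \<phi> (T x)) + integral\<^sup>L N (\<lambda>x. \<phi> (T x))) / 2"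
      unfolding \<rho>_def using P by (subst mix_integral(2)) (auto simp: PT i dT)
    have "\<phi> (T b) \<le> integral\<^sup>L N (\<lambda>x. \<phi> (T x))"
      using convex_barycentre_le[OF P(2) convex_on_compose_affine[OF c T] iT[OF P(2)]] by (simp add: bar)
    then have "\<phi> b \<le> integral\<^sup>L N (\<lambda>x. \<phi> (T x))" by (simp add: T_def scaleR_2)
    moreover have "integral\<^sup>L M \<phi> \<le> integral\<^sup>L M (\<lambda>x. (\<phi> (T x) + \<phi> b) / 2)"
    proof (rule integral_mono[OF i[OF P(1)]])
      interpret prob_space M using P2D(1)[OF P(1)] .
      show "integrable M (\<lambda>x. (\<phi> (T x) + \<phi> b) / 2)" using iT[OF P(1)] by simp
      fix x
      \<comment> \<open>The point \<open>x\<close> is the midpoint of \<open>T x\<close> and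
        \<open>b\<close>.\<close>
      have "\<phi> ((1 - 1/2) *\<^sub>R T x + (1/2) *\<^sub>R b) \<le> (1 - 1/2) * \<phi> (T x) + (1/2) * \<phi> b"
        using convex_onD[OF c, of "1/2" "T x" b] by simp
      also have "(1 - 1/2) *\<^sub>R T x + (1/2) *\<^sub>R b = x" by (simp add: T_def algebra_simps)
      finally show "\<phi> x \<le> (\<phi> (T x) + \<phi> b) / 2" by simp
    qed
    moreover have "integral\<^sup>L M (\<lambda>x. (\<phi> (T x) + \<phi> b) / 2) = (integral\<^sup>L M (\<lambda>x. \<phi> (T x)) + \<phi> b) / 2"
    proof -
      interpret prob_space M using P2D(1)[OF P(1)] .
      show ?thesis using iT[OF P(1)] by (simp add: prob_space)
    qed
    ultimately show "integral\<^sup>L M \<phi> \<le> integral\<^sup>L (\<rho> M N) \<phi>" unfolding eq by simp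
  qed
  have P: "P2 \<mu>" "P2 \<nu>" using b by (auto simp: P2b_def)
  show ?thesis
  proof (rule that[of "\<rho> \<mu> \<nu>"])
    show "cx_le \<mu> (\<rho> \<mu> \<nu>)" using le[OF b refl] by (intro cx_leI P \<rho>)
    \<comment> \<open>The bound \<open>le\<close> concerns the first component only; it is used with
      the roles of the two measures exchanged, which leaves the integral of the mixture
      unchanged.\<close>
    show "cx_le \<nu> (\<rho> \<mu> \<nu>)"
    proof (rule cx_leI[OF P(2) \<rho>[OF P]])
      fix p :: "'a \<times> real" and qs
      show "integral\<^sup>L \<nu> (maxaff p qs) \<le> integral\<^sup>L (\<rho> \<mu> \<nu>) (maxaff p qs)"
        using le[OF b(2,1) refl, of p qs] unfolding int\<rho>[OF b refl] int\<rho>[OF b(2,1) refl] by (simp add: add.commute)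
    qed
  qed (rule \<rho>[OF P])
qed

text \<open>Membership alone does not bound an element by a real \<open>Sup\<close>; boundedness
  comes from weak duality against a common upper bound, and this is where equal barycentres
  enter.\<close>

lemma Z2_upper:
  assumes "P2b b \<mu>" "P2b b \<nu>" "C11_1 u"
  shows "integral\<^sup>L \<mu> u - integral\<^sup>L \<nu> u \<le> Z2 \<mu> \<nu>"
  unfolding Z2_def
proof (rule cSup_upper)
  obtain \<rho> where "P2 \<rho>" "cx_le \<mu> \<rho>" "cx_le \<nu> \<rho>" using exists_cx_upper_bound[OF assms(1,2)] .
  then show "bdd_above {integral\<^sup>L \<mu> u - integral\<^sup>L \<nu> u | u. C11_1 u}"
    using weak_duality[of \<mu> \<nu> \<rho>] assms by (intro bdd_aboveI[of _ "m2 \<rho> - (m2 \<mu> + m2 \<nu>) / 2"]) (auto simp: P2b_def)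
qed (use assms in auto)

lemma Z2_least:
  assumes "\<And>u. C11_1 u \<Longrightarrow> integral\<^sup>L \<mu> u - integral\<^sup>L \<nu> u \<le> c"
  shows "Z2 \<mu> \<nu> \<le> c"
  unfolding Z2_def using assms C11_1_zero by (intro cSup_least) auto

text \<open>Replacing \<open>w\<close> by the envelope \<open>W\<close> and \<open>v\<close> by
  \<open>|z|^2 - W\<close> only increases the left side. Both replacements are convex, so
  \<open>W - |z|^2 / 2\<close> is admissible, and the increased value is its \<open>Z2\<close> value
  plus the two half second moments.\<close>

lemma dual_pair_bound:
  fixes \<mu> \<nu> :: "'a::euclidean_space measure"
  assumes b: "P2b b \<mu>" "P2b b \<nu>" and w: "convex_on UNIV w" and v: "convex_on UNIV v"
    and le: "\<And>z. w z + v z \<le> (norm z)\<^sup>2"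
    and int: "integrable \<mu> w" "integrable \<nu> v"
  shows "integral\<^sup>L \<mu> w + integral\<^sup>L \<nu> v \<le> Z2 \<mu> \<nu> + (m2 \<mu> + m2 \<nu>) / 2"
proof -
  have P: "P2 \<mu>" "P2 \<nu>" using b by (auto simp: P2b_def)
  have le1: "w z + v z \<le> 1 * (norm z)\<^sup>2" for z using le by simp
  obtain W where W: "convex_on UNIV W" "convex_on UNIV (\<lambda>z. 1 * (norm z)\<^sup>2 - W z)"
    "\<And>z. w z \<le> W z" "\<And>z. W z \<le> 1 * (norm z)\<^sup>2 - v z"
    using convex_envelope_semiconcave[OF w v le1] by blast
  define u where "u z = W z - (norm z)\<^sup>2 / 2" for z
  have "C11_1 u"
  proof (rule C11_1I)
    show "convex_on UNIV (\<lambda>x. (norm x)\<^sup>2 / 2 + u x)" using W(1) by (simp add: u_def)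
    show "convex_on UNIV (\<lambda>x. (norm x)\<^sup>2 / 2 - u x)" 
    proof -
      have "(norm x)\<^sup>2 / 2 - u x = 1 * (norm x)\<^sup>2 - W x" for x by (simp add: u_def)
      then show ?thesis using W(2) by presburger
    qed
  qed
  have iW: "integrable M W" if "P2 M" for M by (rule P2_integrable_semiconcave[OF that W(1,2)])
  have "integral\<^sup>L \<mu> w \<le> integral\<^sup>L \<mu> W" using int iW P W(3) by (intro integral_mono) auto
  moreover have "integral\<^sup>L \<nu> W \<le> integral\<^sup>L \<nu> (\<lambda>z. (norm z)\<^sup>2 - v z)"
    using int iW P P2D(4) W(4) by (intro integral_mono Bochner_Integration.integrable_diff) auto
  moreover have "integral\<^sup>L \<nu> (\<lambda>z. (norm z)\<^sup>2 - v z) = m2 \<nu> - integral\<^sup>L \<nu> v"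
    using int(2) P2D(4)[OF P(2)] by (simp add: m2_def)
  moreover have "integral\<^sup>L \<mu> u = integral\<^sup>L \<mu> W - m2 \<mu> / 2" "integral\<^sup>L \<nu> u = integral\<^sup>L \<nu> W - m2 \<nu> / 2"
    unfolding u_def m2_def using iW[OF P(1)] iW[OF P(2)] P2D(4)[OF P(1)] P2D(4)[OF P(2)] by simp_all
  ultimately show ?thesis using Z2_upper[OF b \<open>C11_1 u\<close>] by (simp add: field_simps)
qed

text \<open>The multiplier is the least slope \<open>(J y - m) / c y\<close> over the strictly
  feasible points. A point violating the constraint can be mixed with any such \<open>y\<close> to
  meet it with equality, and optimality there compares the two slopes. Only mixtures are used, so
  \<open>X\<close> may be a set of probability measures.\<close>

lemma lagrange_multiplier:
  fixes J c :: "'x \<Rightarrow> real"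
  assumes mix: "\<And>x y t. x \<in> X \<Longrightarrow> y \<in> X \<Longrightarrow> 0 \<le> t \<Longrightarrow> t \<le> 1 \<Longrightarrow>
      \<exists>z\<in>X. J z = t * J x + (1 - t) * J y \<and> c z = t * c x + (1 - t) * c y"
    and slater: "x0 \<in> X" "c x0 > 0"
    and opt: "\<And>x. x \<in> X \<Longrightarrow> c x \<ge> 0 \<Longrightarrow> J x \<ge> m"
  shows "\<exists>l\<ge>0. \<forall>x\<in>X. J x - l * c x \<ge> m"
proof -
  define S where "S = (\<lambda>y. (J y - m) / c y) ` {y\<in>X. c y > 0}"
  define l where "l = Inf S"
  have "S \<noteq> {}" using slater by (auto simp: S_def)
  have S0: "s \<ge> 0" if "s \<in> S" for s using that opt by (auto simp: S_def)
  then have bdd: "bdd_below S" by (meson bdd_belowI)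
  have "l \<ge> 0" unfolding l_def using S0 \<open>S \<noteq> {}\<close> by (intro cInf_greatest)
  moreover have "J x - l * c x \<ge> m" if x: "x \<in> X" for x
  proof -
    consider "c x > 0" | "c x = 0" | "c x < 0" by linarith
    then show ?thesis
    proof cases
      case 1
      then have "l \<le> (J x - m) / c x" unfolding l_def using x by (intro cInf_lower bdd) (auto simp: S_def)
      then show ?thesis using 1 by (simp add: field_simps)
    next
      case 2
      then show ?thesis using opt[OF x] by simp
    next
      case 3
      have "(m - J x) / (- c x) \<le> l"
        unfolding l_def
      proof (rule cInf_greatest[OF \<open>S \<noteq> {}\<close>])
        fix s assume "s \<in> S"
        then obtain y where y: "y \<in> X" "c y > 0" "s = (J y - m) / c y" by (auto simp: S_def)
        \<comment> \<open>The weight for which the constraint value of the mixture is zero.\<close>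
        define t where "t = c y / (c y - c x)"
        have t: "0 \<le> t" "t \<le> 1" using 3 y by (auto simp: t_def divide_simps)
        have t1: "1 - t = - c x / (c y - c x)" using 3 y by (simp add: t_def field_simps)
        obtain z where z: "z \<in> X" "J z = t * J x + (1 - t) * J y" "c z = t * c x + (1 - t) * c y"
          using mix[OF x y(1) t] by blast
        have "c z = 0" using z(3) unfolding t1 unfolding t_def using 3 y by (simp add: field_simps)
        then have "m \<le> t * J x + (1 - t) * J y" using opt[OF z(1)] z(2) by simp
        then have "m * (c y - c x) \<le> (t * J x + (1 - t) * J y) * (c y - c x)" using 3 y by (intro mult_right_mono) auto
        also have "\<dots> = (t * (c y - c x)) * J x + ((1 - t) * (c y - c x)) * J y" by (simp add: algebra_simps)
        also have "t * (c y - c x) = c y" using 3 y by (simp add: t_def)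
        also have "(1 - t) * (c y - c x) = - c x" using 3 y by (simp add: t1)
        finally have "m * (c y - c x) \<le> c y * J x - c x * J y" by simp
        then show "(m - J x) / (- c x) \<le> s" using 3 y by (simp add: y(3) field_simps)
      qed
      then show ?thesis using 3 by (simp add: field_simps)
    qed
  qed
  ultimately show ?thesis by blast
qed

text \<open>Induction on the number of constraints: the last one is first absorbed into the domain
  \<open>Y\<close>, the others are priced by the induction hypothesis, and the resulting Lagrangian
  \<open>J'\<close> is an affine objective with a single constraint left.\<close>

lemma lagrange_multipliers:
  fixes J :: "'x \<Rightarrow> real" and c :: "nat \<Rightarrow> 'x \<Rightarrow> real"
  assumes mix: "\<And>x y t. x \<in> X \<Longrightarrow> y \<in> X \<Longrightarrow> 0 \<le> t \<Longrightarrow> t \<le> 1 \<Longrightarrow>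
      \<exists>z\<in>X. J z = t * J x + (1 - t) * J y \<and> (\<forall>k<K. c k z = t * c k x + (1 - t) * c k y)"
    and slater: "x0 \<in> X" "\<And>k. k < K \<Longrightarrow> c k x0 > 0"
    and opt: "\<And>x. x \<in> X \<Longrightarrow> (\<And>k. k < K \<Longrightarrow> c k x \<ge> 0) \<Longrightarrow> J x \<ge> m"
  shows "\<exists>l. (\<forall>k<K. l k \<ge> 0) \<and> (\<forall>x\<in>X. J x - (\<Sum>k<K. l k * c k x) \<ge> m)"
  using assms
proof (induction K arbitrary: X)
  case 0
  then show ?case by auto
next
  case (Suc K)
  define Y where "Y = {x\<in>X. c K x \<ge> 0}"
  have "\<exists>l. (\<forall>k<K. l k \<ge> 0) \<and> (\<forall>x\<in>Y. J x - (\<Sum>k<K. l k * c k x) \<ge> m)"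
  proof (rule Suc.IH)
    fix x y t assume xy: "x \<in> Y" "y \<in> Y" and t: "0 \<le> t" "t \<le> (1::real)"
    then obtain z where z: "z \<in> X" "J z = t * J x + (1 - t) * J y" "\<forall>k<Suc K. c k z = t * c k x + (1 - t) * c k y"
      using Suc.prems(1)[of x y t] by (auto simp: Y_def)
    have "c K z \<ge> 0" using z(3) xy t by (auto simp: Y_def)
    then show "\<exists>z\<in>Y. J z = t * J x + (1 - t) * J y \<and> (\<forall>k<K. c k z = t * c k x + (1 - t) * c k y)"
      using z by (auto simp: Y_def)
  next
    show "x0 \<in> Y" using Suc.prems(2) Suc.prems(3)[of K] by (auto simp: Y_def)
    show "c k x0 > 0" if "k < K" for k using Suc.prems(3)[of k] that by simp
    show "J x \<ge> m" if "x \<in> Y" "\<And>k. k < K \<Longrightarrow> c k x \<ge> 0" for x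
      using Suc.prems(4)[of x] that by (auto simp: Y_def less_Suc_eq)
  qed
  then obtain l where l: "\<And>k. k < K \<Longrightarrow> l k \<ge> 0" "\<And>x. x \<in> Y \<Longrightarrow> J x - (\<Sum>k<K. l k * c k x) \<ge> m" by blast
  define J' where "J' x = J x - (\<Sum>k<K. l k * c k x)" for x
  have "\<exists>h\<ge>0. \<forall>x\<in>X. J' x - h * c K x \<ge> m"
  proof (rule lagrange_multiplier)
    fix x y t assume xy: "x \<in> X" "y \<in> X" and t: "0 \<le> t" "t \<le> (1::real)"
    then obtain z where z: "z \<in> X" "J z = t * J x + (1 - t) * J y" "\<forall>k<Suc K. c k z = t * c k x + (1 - t) * c k y"
      using Suc.prems(1)[of x y t] by auto
    have "(\<Sum>k<K. l k * c k z) = (\<Sum>k<K. t * (l k * c k x) + (1 - t) * (l k * c k y))"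
    proof (intro sum.cong refl)
      fix k assume "k \<in> {..<K}"
      then have k: "c k z = t * c k x + (1 - t) * c k y" using z(3) by simp
      show "l k * c k z = t * (l k * c k x) + (1 - t) * (l k * c k y)" unfolding k by (simp add: algebra_simps)
    qed
    then have eq: "(\<Sum>k<K. l k * c k z) = t * (\<Sum>k<K. l k * c k x) + (1 - t) * (\<Sum>k<K. l k * c k y)"
      by (simp only: sum.distrib sum_distrib_left)
    have "J' z = t * J' x + (1 - t) * J' y"
      unfolding J'_def z(2) eq by (simp add: algebra_simps)
    then show "\<exists>z\<in>X. J' z = t * J' x + (1 - t) * J' y \<and> c K z = t * c K x + (1 - t) * c K y"
      using z by auto
  qed (use Suc.prems l in \<open>auto simp: Y_def J'_def\<close>)
  then obtain h where h: "h \<ge> 0" "\<And>x. x \<in> X \<Longrightarrow> J' x - h * c K x \<ge> m" by blast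
  show ?case
  proof (intro exI[of _ "l(K := h)"] conjI ballI allI impI)
    show "(l(K := h)) k \<ge> 0" if "k < Suc K" for k using that l(1) h(1) by (auto simp: less_Suc_eq)
    have "J x - (\<Sum>k<Suc K. (l(K := h)) k * c k x) = J' x - h * c K x" for x by (simp add: J'_def)
    then show "J x - (\<Sum>k<Suc K. (l(K := h)) k * c k x) \<ge> m" if "x \<in> X" for x using h(2)[OF that] by metis
  qed
qed

lemma convex_on_weighted_sum:
  fixes f :: "nat \<Rightarrow> 'a::real_vector \<Rightarrow> real"
  assumes "\<And>k. k < K \<Longrightarrow> a k \<ge> 0" "\<And>k. k < K \<Longrightarrow> convex_on UNIV (f k)"
  shows "convex_on UNIV (\<lambda>x. \<Sum>k<K. a k * f k x)"
  using assms by (induction K) (auto intro!: convex_on_add convex_on_cmul simp: convex_on_const)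

lemma P2_return: "P2 (return borel z)"
  unfolding P2_def by (auto simp: prob_space_return integrable_iff_bounded nn_integral_return)

text \<open>If it failed, every measure meeting the relaxed constraints would have second moment at
  least \<open>D + e\<close>. Relaxing by \<open>e\<close> makes a common upper bound strictly
  feasible, so multipliers exist, and they assemble to a dual pair whose value exceeds
  \<open>D\<close>.\<close>

lemma finite_constraints_approx:
  fixes \<mu> \<nu> :: "'a::euclidean_space measure" and p :: "nat \<Rightarrow> 'a \<times> real" and qs :: "nat \<Rightarrow> ('a \<times> real) list"
  assumes b: "P2b b \<mu>" "P2b b \<nu>" and e: "e > 0"
  defines "\<phi> k \<equiv> maxaff (p k) (qs k)"
  shows "\<exists>\<rho>. P2 \<rho> \<and> m2 \<rho> \<le> Z2 \<mu> \<nu> + (m2 \<mu> + m2 \<nu>) / 2 + e \<and>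
    (\<forall>k<K. max (integral\<^sup>L \<mu> (\<phi> k)) (integral\<^sup>L \<nu> (\<phi> k)) - e \<le> integral\<^sup>L \<rho> (\<phi> k))"
proof (rule ccontr)
  assume contra: "\<not> ?thesis"
  define D where "D = Z2 \<mu> \<nu> + (m2 \<mu> + m2 \<nu>) / 2"
  define \<alpha> where "\<alpha> k = max (integral\<^sup>L \<mu> (\<phi> k)) (integral\<^sup>L \<nu> (\<phi> k))" for k
  define c where "c k \<rho> = integral\<^sup>L \<rho> (\<phi> k) - (\<alpha> k - e)" for k \<rho>
  have P: "P2 \<mu>" "P2 \<nu>" using b by (auto simp: P2b_def)
  interpret \<nu>: prob_space \<nu> using P2D(1)[OF P(2)] .
  have \<phi>c: "convex_on UNIV (\<phi> k)" for k unfolding \<phi>_def by (rule convex_on_maxaff)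
  have \<phi>m[measurable]: "\<phi> k \<in> borel_measurable borel" for k by (rule convex_on_borel_measurable[OF \<phi>c])
  have \<phi>i: "integrable M (\<phi> k)" if "P2 M" for M k unfolding \<phi>_def by (rule P2_integrable_maxaff[OF that])
  have opt: "D + e \<le> m2 \<rho>" if "P2 \<rho>" "\<And>k. k < K \<Longrightarrow> c k \<rho> \<ge> 0" for \<rho>
    using contra that by (force simp: D_def c_def \<alpha>_def)
  obtain \<rho>0 where \<rho>0: "P2 \<rho>0" "cx_le \<mu> \<rho>0" "cx_le \<nu> \<rho>0" using exists_cx_upper_bound[OF b] .
  have "\<exists>l. (\<forall>k<K. l k \<ge> 0) \<and> (\<forall>\<rho>\<in>Collect P2. m2 \<rho> - (\<Sum>k<K. l k * c k \<rho>) \<ge> D + e)"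
  proof (rule lagrange_multipliers)
    show "\<rho>0 \<in> Collect P2" using \<rho>0 by simp
    show "c k \<rho>0 > 0" if "k < K" for k
      using cx_leD[OF \<rho>0(2) \<phi>c \<phi>i \<phi>i, of k] cx_leD[OF \<rho>0(3) \<phi>c \<phi>i \<phi>i, of k] \<rho>0(1) P e
      by (simp add: c_def \<alpha>_def)
    fix x y :: "'a measure" and t :: real assume A: "x \<in> Collect P2" "y \<in> Collect P2" "0 \<le> t" "t \<le> 1"
    show "\<exists>z\<in>Collect P2. m2 z = t * m2 x + (1 - t) * m2 y \<and> (\<forall>k<K. c k z = t * c k x + (1 - t) * c k y)"
      using A by (intro bexI[of _ "mix t x y"])
        (auto simp: m2_mix P2_mix c_def mix_integral(2) \<phi>i algebra_simps)
  qed (use opt in auto)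
  then obtain l where l: "\<And>k. k < K \<Longrightarrow> l k \<ge> 0"
    "\<And>\<rho>. P2 \<rho> \<Longrightarrow> m2 \<rho> - (\<Sum>k<K. l k * c k \<rho>) \<ge> D + e" by auto
  define A where "A = {k. integral\<^sup>L \<nu> (\<phi> k) \<le> integral\<^sup>L \<mu> (\<phi> k)}"
  \<comment> \<open>Each constraint involves a maximum; its multiplier is assigned entirely to the
    measure that attains it.\<close>
  define a a' where "a k = (if k \<in> A then l k else 0)" and "a' k = (if k \<in> A then 0 else l k)" for k
  define C where "C = D + e - (\<Sum>k<K. l k * (\<alpha> k - e))"
  define w v where "w z = (\<Sum>k<K. a k * \<phi> k z)" and "v z = (\<Sum>k<K. a' k * \<phi> k z) + C" for z
  have aa: "a k + a' k = l k" for k by (simp add: a_def a'_def)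
  have "integral\<^sup>L \<mu> w + integral\<^sup>L \<nu> v \<le> Z2 \<mu> \<nu> + (m2 \<mu> + m2 \<nu>) / 2"
  proof (rule dual_pair_bound[OF b])
    show "convex_on UNIV w" unfolding w_def
      using l(1) \<phi>c by (intro convex_on_weighted_sum) (auto simp: a_def)
    show "convex_on UNIV v" unfolding v_def
      using l(1) \<phi>c by (intro convex_on_add convex_on_weighted_sum) (auto simp: a'_def convex_on_const)
    show "integrable \<mu> w" "integrable \<nu> v" unfolding w_def v_def using \<phi>i P by auto
    fix z :: 'a
    \<comment> \<open>Inserting Dirac masses into the Lagrangian inequality makes it
      pointwise.\<close>
    have "m2 (return borel z) = (norm z)\<^sup>2" by (simp add: m2_def integral_return)
    moreover have "c k (return borel z) = \<phi> k z - (\<alpha> k - e)" for k by (simp add: c_def integral_return)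
    ultimately have "(norm z)\<^sup>2 - (\<Sum>k<K. l k * (\<phi> k z - (\<alpha> k - e))) \<ge> D + e"
      using l(2)[OF P2_return[of z]] by simp
    then show "w z + v z \<le> (norm z)\<^sup>2"
      by (simp add: w_def v_def C_def aa[symmetric] sum_subtractf sum.distrib algebra_simps)
  qed
  moreover have "integral\<^sup>L \<mu> w + integral\<^sup>L \<nu> v = (\<Sum>k<K. l k * \<alpha> k) + C"
  proof -
    have "integral\<^sup>L \<mu> w = (\<Sum>k<K. a k * integral\<^sup>L \<mu> (\<phi> k))"
      unfolding w_def using \<phi>i[OF P(1)] by simp
    moreover have "integral\<^sup>L \<nu> v = (\<Sum>k<K. a' k * integral\<^sup>L \<nu> (\<phi> k)) + C"
      unfolding v_def using \<phi>i[OF P(2)] by (simp add: \<nu>.prob_space)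
    moreover have "a k * integral\<^sup>L \<mu> (\<phi> k) + a' k * integral\<^sup>L \<nu> (\<phi> k) = l k * \<alpha> k" for k
      by (auto simp: a_def a'_def \<alpha>_def A_def max_def)
    ultimately show ?thesis by (simp add: sum.distrib[symmetric])
  qed
  \<comment> \<open>The relaxation contributes the nonnegative term \<open>e\<close> times the sum
    of the multipliers, so the dual value is at least \<open>D + e\<close>.\<close>
  moreover have "(\<Sum>k<K. l k * \<alpha> k) + C = D + e + e * (\<Sum>k<K. l k)"
    by (simp add: C_def sum_subtractf sum_distrib_left algebra_simps)
  moreover have "e * (\<Sum>k<K. l k) \<ge> 0" using e l(1) by (intro mult_nonneg_nonneg sum_nonneg) auto
  ultimately show False using e unfolding D_def by linarith
qed

section \<open>Weak compactness\<close>

lemma pointwise_convergent_subsequence: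
  fixes f :: "nat \<Rightarrow> nat \<Rightarrow> real"
  assumes f: "\<And>n i. f n i \<in> {0..1}"
  obtains r where "strict_mono r" "\<And>i. convergent (\<lambda>n. f (r n) i)"
proof -
  have "compactin (product_topology (\<lambda>_. euclidean) UNIV) (PiE UNIV (\<lambda>_::nat. {0..1::real}))"
    by (subst compactin_PiE) (simp add: compactin_euclidean_iff)
  then have "compact (PiE UNIV (\<lambda>_::nat. {0..1::real}))"
    by (simp add: euclidean_product_topology compactin_euclidean_iff)
  then have "seq_compact (PiE UNIV (\<lambda>_::nat. {0..1::real}))"
    by (rule compact_imp_seq_compact)
  moreover have "\<forall>n. f n \<in> PiE UNIV (\<lambda>_. {0..1})" using f by auto
  ultimately obtain l r where r: "strict_mono r" "(f \<circ> r) \<longlonglongrightarrow> l"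
    unfolding seq_compact_def by blast
  have "(\<lambda>n. f (r n) i) \<longlonglongrightarrow> l i" for i
  proof -
    have "continuous_on UNIV (\<lambda>x :: nat \<Rightarrow> real. x i)" by simp
    then have "isCont (\<lambda>x :: nat \<Rightarrow> real. x i) l" by (metis UNIV_I continuous_on_eq_continuous_at open_UNIV)
    from isCont_tendsto_compose[OF this r(2)] show ?thesis by simp
  qed
  then show ?thesis using that[OF r(1)] convergentI by blast
qed

text \<open>Both total masses are 1, so nothing can be missing. One-sided bounds from Fatou's lemma
  thus suffice to identify a limit law.\<close>

lemma pmf_eqI_le:
  assumes le: "\<And>x. pmf p x \<le> pmf q x"
  shows "p = q"
proof (rule pmf_eqI)
  fix x
  have "(\<integral>\<^sup>+x. ennreal (pmf q x) \<partial>count_space UNIV) = (\<integral>\<^sup>+x. ennreal (pmf p x) + ennreal (pmf q x - pmf p x) \<partial>count_space UNIV)"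
    using le by (intro nn_integral_cong) (simp flip: ennreal_plus)
  also have "\<dots> = 1 + (\<integral>\<^sup>+x. ennreal (pmf q x - pmf p x) \<partial>count_space UNIV)"
    by (subst nn_integral_add) (auto simp: nn_integral_pmf measure_pmf.emeasure_space_1)
  finally have "1 + 0 = 1 + (\<integral>\<^sup>+x. ennreal (pmf q x - pmf p x) \<partial>count_space UNIV)"
    by (simp add: nn_integral_pmf measure_pmf.emeasure_space_1)
  then have "(\<integral>\<^sup>+x. ennreal (pmf q x - pmf p x) \<partial>count_space UNIV) = 0"
    unfolding ennreal_add_left_cancel by simp
  then have "ennreal (pmf q x - pmf p x) = 0" by (simp add: nn_integral_0_iff_AE AE_count_space)
  then show "pmf p x = pmf q x" using le[of x] by (simp add: ennreal_eq_0_iff)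
qed

section \<open>Dyadic rounding\<close>

definition grid :: "nat \<Rightarrow> 'a::euclidean_space \<Rightarrow> 'a" where
  "grid k z = (\<Sum>i\<in>Basis. (of_int \<lfloor>2 ^ k * (z \<bullet> i)\<rfloor> / 2 ^ k) *\<^sub>R i)"

lemma grid_inner: "i \<in> Basis \<Longrightarrow> grid k z \<bullet> i = of_int \<lfloor>2 ^ k * (z \<bullet> i)\<rfloor> / 2 ^ k"
  by (simp add: grid_def)

lemma grid_measurable[measurable]: "grid k \<in> borel_measurable borel"
  unfolding grid_def by measurable

text \<open>Rounding always downwards makes nested roundings collapse, since the floor of a floor
  divided by an integer is the floor of the quotient. This is the consistency behind the inverse
  limit below.\<close>

lemma grid_grid:
  assumes "j \<le> k"
  shows "grid j (grid k z) = grid j z"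
proof (rule euclidean_eqI)
  fix i :: 'a assume i: "i \<in> Basis"
  let ?t = "z \<bullet> i" and ?n = "2 ^ (k - j) :: int"
  have k: "(2::real) ^ k = 2 ^ j * real_of_int ?n" using assms by (simp flip: power_add)
  have "\<lfloor>2 ^ j * (real_of_int \<lfloor>2 ^ k * ?t\<rfloor> / 2 ^ k)\<rfloor> = \<lfloor>real_of_int \<lfloor>2 ^ k * ?t\<rfloor> / real_of_int ?n\<rfloor>"
    unfolding k by simp
  also have "\<dots> = \<lfloor>2 ^ k * ?t\<rfloor> div ?n" by (rule floor_divide_of_int_eq)
  also have "\<dots> = \<lfloor>2 ^ k * ?t / real_of_int ?n\<rfloor>" by (rule floor_divide_real_eq_div[symmetric]) simp
  also have "2 ^ k * ?t / real_of_int ?n = 2 ^ j * ?t" unfolding k by simp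
  finally show "grid j (grid k z) \<bullet> i = grid j z \<bullet> i" using i by (simp add: grid_inner)
qed

lemma norm_grid_diff: "norm (grid k z - z) \<le> DIM('a) / 2 ^ k" for z :: "'a::euclidean_space"
proof -
  have "norm (grid k z - z) \<le> (\<Sum>i\<in>Basis. \<bar>(grid k z - z) \<bullet> i\<bar>)" by (rule norm_le_l1)
  also have "\<dots> \<le> (\<Sum>i\<in>(Basis::'a set). 1 / 2 ^ k)"
  proof (rule sum_mono)
    fix i :: 'a assume i: "i \<in> Basis"
    let ?t = "2 ^ k * (z \<bullet> i)"
    have "(grid k z - z) \<bullet> i = (of_int \<lfloor>?t\<rfloor> - ?t) / 2 ^ k"
      using i by (simp add: grid_inner inner_diff_left field_simps)
    moreover have "\<bar>of_int \<lfloor>?t\<rfloor> - ?t\<bar> \<le> 1" by linarith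
    ultimately show "\<bar>(grid k z - z) \<bullet> i\<bar> \<le> 1 / 2 ^ k" by (simp add: divide_right_mono)
  qed
  finally show ?thesis by simp
qed

text \<open>Grid points are coded by integer vectors indexed by \<open>Basis\<close>, which reduces
  countability and finiteness to those of function spaces.\<close>

lemma grid_range_eq:
  "grid k ` A = (\<lambda>h. \<Sum>i\<in>Basis. (of_int (h i) / 2 ^ k) *\<^sub>R i) ` ((\<lambda>z. \<lambda>i\<in>Basis. \<lfloor>2 ^ k * (z \<bullet> i)\<rfloor>) ` A)"
  unfolding image_image grid_def by (intro image_cong refl sum.cong) auto

lemma countable_grid: "countable (range (grid k :: 'a::euclidean_space \<Rightarrow> 'a))"
proof -
  have "countable (PiE (Basis :: 'a set) (\<lambda>_. UNIV :: int set))" by (intro countable_PiE) auto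
  then have "countable ((\<lambda>z :: 'a. \<lambda>i\<in>Basis. \<lfloor>2 ^ k * (z \<bullet> i)\<rfloor>) ` UNIV)"
    by (rule countable_subset[rotated]) auto
  then show ?thesis unfolding grid_range_eq by (rule countable_image)
qed

lemma finite_grid_cball: "finite (grid k ` cball (0::'a::euclidean_space) R)"
proof -
  define N where "N = \<lceil>2 ^ k * R\<rceil> + 1"
  have "(\<lambda>z :: 'a. \<lambda>i\<in>Basis. \<lfloor>2 ^ k * (z \<bullet> i)\<rfloor>) ` cball 0 R \<subseteq> PiE Basis (\<lambda>_. {- N..N})"
  proof (clarsimp simp: PiE_iff)
    fix z i :: 'a assume z: "norm z \<le> R" and i: "i \<in> Basis"
    have "\<bar>2 ^ k * (z \<bullet> i)\<bar> \<le> 2 ^ k * R"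
      using Basis_le_norm[OF i, of z] z by (simp add: abs_mult)
    then show "- N \<le> \<lfloor>2 ^ k * (z \<bullet> i)\<rfloor> \<and> \<lfloor>2 ^ k * (z \<bullet> i)\<rfloor> \<le> N" unfolding N_def by linarith
  qed
  then have "finite ((\<lambda>z :: 'a. \<lambda>i\<in>Basis. \<lfloor>2 ^ k * (z \<bullet> i)\<rfloor>) ` cball 0 R)"
    by (rule finite_subset) (intro finite_PiE, auto)
  then show ?thesis unfolding grid_range_eq by (rule finite_imageI)
qed

lemma grid_vimage_measurable[measurable]: "grid k -` {g} \<in> sets borel"
  using measurable_sets[OF grid_measurable, of "{g}" k] by simp

text \<open>Turns integrals of rounded functions into sums over a countable grid that does not vary
  with the measure, so that Fatou's lemma for counting measure applies to a sequence of
  measures.\<close>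

lemma nn_integral_grid:
  fixes M :: "'a::euclidean_space measure"
  assumes "sets M = sets borel"
  shows "(\<integral>\<^sup>+g. f g * emeasure M (grid k -` {g}) \<partial>count_space (range (grid k))) = (\<integral>\<^sup>+z. f (grid k z) \<partial>M)"
proof -
  have [measurable]: "grid k -` {g} \<in> sets M" for g :: 'a using assms by simp
  have "(\<integral>\<^sup>+g. f g * emeasure M (grid k -` {g}) \<partial>count_space (range (grid k)))
      = (\<integral>\<^sup>+g. (\<integral>\<^sup>+z. f g * indicator (grid k -` {g}) z \<partial>M) \<partial>count_space (range (grid k)))"
    by (simp add: nn_integral_cmult_indicator)
  also have "\<dots> = (\<integral>\<^sup>+z. (\<integral>\<^sup>+g. f g * indicator (grid k -` {g}) z \<partial>count_space (range (grid k))) \<partial>M)"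
    by (rule nn_integral_count_space_nn_integral[symmetric]) (auto simp: countable_grid)
  also have "\<dots> = (\<integral>\<^sup>+z. f (grid k z) \<partial>M)"
  proof (rule nn_integral_cong)
    fix z
    have "(\<integral>\<^sup>+g. f g * indicator (grid k -` {g}) z \<partial>count_space (range (grid k)))
        = (\<Sum>g\<in>{grid k z}. f g * indicator (grid k -` {g}) z)"
      by (rule nn_integral_count_space') (auto simp: indicator_def split: if_splits)
    then show "(\<integral>\<^sup>+g. f g * indicator (grid k -` {g}) z \<partial>count_space (range (grid k))) = f (grid k z)" by simp
  qed
  finally show ?thesis .
qed

text \<open>Markov's inequality for \<open>|x|^2\<close>; a uniform bound on \<open>m2\<close> thus
  gives tightness.\<close>

lemma P2_tail:
  assumes M: "P2 M" and R: "R > 0"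
  shows "measure M (- cball 0 R) \<le> m2 M / R\<^sup>2"
proof -
  interpret prob_space M using P2D(1)[OF M] .
  have [measurable]: "- cball 0 R \<in> sets M" using P2D(2)[OF M] by auto
  have "measure M (- cball 0 R) = integral\<^sup>L M (indicator (- cball 0 R))" by simp
  also have "\<dots> \<le> integral\<^sup>L M (\<lambda>x. (norm x)\<^sup>2 / R\<^sup>2)"
  proof (rule integral_mono)
    show "integrable M (\<lambda>x. (norm x)\<^sup>2 / R\<^sup>2)" using P2D(4)[OF M] by simp
    show "indicator (- cball 0 R) x \<le> (norm x)\<^sup>2 / R\<^sup>2" for x :: 'a
      using R power_mono[of R "norm x" 2] by (auto simp: indicator_def divide_simps)
    show "integrable M (indicat_real (- cball 0 R))"
      by (rule integrable_const_bound[where B=1]) (auto simp: indicator_def)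
  qed
  also have "\<dots> = m2 M / R\<^sup>2" by (simp add: m2_def)
  finally show ?thesis .
qed

text \<open>Weak compactness is obtained from Kolmogorov's extension theorem: the laws of the dyadic
  roundings \<open>grid k\<close> have limits along a subsequence for every \<open>k\<close>, and these limits are consistent,
  so they come from a law on sequences, almost all of which converge.\<close>

lemma grid_limit_pmfs:
  fixes \<rho> :: "nat \<Rightarrow> 'a::euclidean_space measure"
  assumes P: "\<And>n. P2 (\<rho> n)" and M: "\<And>n. m2 (\<rho> n) \<le> M"
  shows "\<exists>r A. strict_mono r
    \<and> (\<forall>k f. (\<forall>g. f g < \<infinity>) \<longrightarrow> (\<integral>\<^sup>+g. f g \<partial>measure_pmf (A k)) \<le> liminf (\<lambda>n. \<integral>\<^sup>+z. f (grid k z) \<partial>\<rho> (r n)))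
    \<and> (\<forall>j k. j \<le> k \<longrightarrow> map_pmf (grid j) (A k) = A j)"
proof -
  interpret prob_space "\<rho> n" for n using P2D(1)[OF P] .
  have setsP[measurable_cong]: "sets (\<rho> n) = sets borel" for n using P2D(2)[OF P] .
  have space: "space (\<rho> n) = UNIV" for n using P2D(3)[OF P] .
  define \<Gamma> :: "'a set" where "\<Gamma> = (\<Union>k. range (grid k))"
  have \<Gamma>: "countable \<Gamma>" unfolding \<Gamma>_def by (intro countable_UN countable_grid) auto
  \<comment> \<open>All cell masses, for every level \<open>k\<close> and grid point
    \<open>g\<close>, listed in one sequence so that a single subsequence serves them all.\<close>
  define f where "f n i = measure (\<rho> n) (grid (fst (prod_decode i)) -` {from_nat_into \<Gamma> (snd (prod_decode i))})" for n i
  have "f n i \<in> {0..1}" for n i unfolding f_def by auto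
  then obtain r where r: "strict_mono r" "\<And>i. convergent (\<lambda>n. f (r n) i)"
    using pointwise_convergent_subsequence[of f] by blast
  define a where "a k g = lim (\<lambda>n. measure (\<rho> (r n)) (grid k -` {g}))" for k g
  have a: "(\<lambda>n. measure (\<rho> (r n)) (grid k -` {g})) \<longlonglongrightarrow> a k g" if "g \<in> range (grid k)" for k g
  proof -
    have "g \<in> \<Gamma>" using that by (auto simp: \<Gamma>_def)
    then have "(\<lambda>n. measure (\<rho> (r n)) (grid k -` {g})) = (\<lambda>n. f (r n) (prod_encode (k, to_nat_on \<Gamma> g)))"
      using \<Gamma> by (simp add: f_def)
    then show ?thesis unfolding a_def using r(2) by (simp add: convergent_LIMSEQ_iff)
  qed
  have a0: "a k g \<ge> 0" if "g \<in> range (grid k)" for k g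
    using a[OF that] by (rule LIMSEQ_le_const) auto
  \<comment> \<open>Finiteness of the values of \<open>f\<close> makes multiplication by them
    continuous on \<open>ennreal\<close>.\<close>
  have fatou: "(\<integral>\<^sup>+g. f g * ennreal (a k g) \<partial>count_space (range (grid k)))
      \<le> liminf (\<lambda>n. \<integral>\<^sup>+z. f (grid k z) \<partial>\<rho> (r n))" if "\<And>g. f g < \<infinity>" for f :: "'a \<Rightarrow> ennreal" and k
  proof -
    have "(\<integral>\<^sup>+g. f g * ennreal (a k g) \<partial>count_space (range (grid k)))
        = (\<integral>\<^sup>+g. liminf (\<lambda>n. f g * emeasure (\<rho> (r n)) (grid k -` {g})) \<partial>count_space (range (grid k)))"
    proof (rule nn_integral_cong)
      fix g :: 'a assume "g \<in> space (count_space (range (grid k)))"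
      then have "(\<lambda>n. f g * emeasure (\<rho> (r n)) (grid k -` {g})) \<longlonglongrightarrow> f g * ennreal (a k g)"
        using that[of g] a by (intro ennreal_tendsto_cmult) (auto simp: emeasure_eq_measure)
      then show "f g * ennreal (a k g) = liminf (\<lambda>n. f g * emeasure (\<rho> (r n)) (grid k -` {g}))"
        using lim_imp_Liminf[OF trivial_limit_sequentially] by metis
    qed
    also have "\<dots> \<le> liminf (\<lambda>n. \<integral>\<^sup>+g. f g * emeasure (\<rho> (r n)) (grid k -` {g}) \<partial>count_space (range (grid k)))"
      by (rule nn_integral_liminf) simp
    also have "\<dots> = liminf (\<lambda>n. \<integral>\<^sup>+z. f (grid k z) \<partial>\<rho> (r n))"
      by (simp add: nn_integral_grid[OF setsP])
    finally show ?thesis .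
  qed
  define q where "q k g = (if g \<in> range (grid k) then a k g else 0)" for k g
  have q0: "q k g \<ge> 0" for k g by (simp add: q_def a0)
  have restr: "(\<integral>\<^sup>+g. f g * ennreal (q k g) \<partial>count_space UNIV) = (\<integral>\<^sup>+g. f g * ennreal (a k g) \<partial>count_space (range (grid k)))" for f k
    by (subst nn_integral_count_space_indicator) (auto intro!: nn_integral_cong simp: q_def indicator_def)
  \<comment> \<open>Fatou gives mass at most 1. No mass escapes, because finitely many cells cover a
    ball that carries mass at least \<open>1 - e\<close> for every \<open>n\<close>.\<close>
  have q1: "(\<integral>\<^sup>+g. ennreal (q k g) \<partial>count_space UNIV) = 1" for k
  proof (rule antisym)
    have "(\<integral>\<^sup>+g. ennreal (q k g) \<partial>count_space UNIV) \<le> liminf (\<lambda>n. \<integral>\<^sup>+z. 1 \<partial>\<rho> (r n))"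
      using restr[of "\<lambda>_. 1" k] fatou[of "\<lambda>_. 1" k] by simp
    also have "\<dots> = 1" by (simp add: emeasure_space_1 Liminf_const)
    finally show "(\<integral>\<^sup>+g. ennreal (q k g) \<partial>count_space UNIV) \<le> 1" .
    show "1 \<le> (\<integral>\<^sup>+g. ennreal (q k g) \<partial>count_space UNIV)"
    proof (rule ennreal_le_epsilon)
      fix e :: real assume e: "e > 0"
      \<comment> \<open>Chosen so that the tail bound is at most \<open>e\<close>; the added 1 keeps
        \<open>R\<close> positive.\<close>
      define R where "R = sqrt ((\<bar>M\<bar> + 1) / e)"
      have R: "R > 0" "(\<bar>M\<bar> + 1) / R\<^sup>2 = e" using e by (auto simp: R_def)
      define F where "F = grid k ` cball (0::'a) R"
      have F: "finite F" "F \<subseteq> range (grid k)" unfolding F_def using finite_grid_cball by auto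
      have "1 - e \<le> (\<Sum>g\<in>F. measure (\<rho> (r n)) (grid k -` {g}))" for n
      proof -
        have "measure (\<rho> (r n)) (cball 0 R) = 1 - measure (\<rho> (r n)) (- cball 0 R)"
          using prob_compl[of "cball 0 R" "r n"] by (simp add: space Compl_eq_Diff_UNIV setsP)
        moreover have "m2 (\<rho> (r n)) / R\<^sup>2 \<le> (\<bar>M\<bar> + 1) / R\<^sup>2"
          using M[of "r n"] by (intro divide_right_mono) auto
        ultimately have "1 - e \<le> measure (\<rho> (r n)) (cball 0 R)"
          using P2_tail[OF P R(1), of "r n"] R(2) by linarith
        also have "\<dots> \<le> measure (\<rho> (r n)) (\<Union>g\<in>F. grid k -` {g})"
        proof (rule finite_measure_mono)
          show "(\<Union>g\<in>F. grid k -` {g}) \<in> sets (\<rho> (r n))" using F(1) by (intro sets.finite_UN) (auto simp: setsP)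
        qed (auto simp: F_def)
        also have "\<dots> = (\<Sum>g\<in>F. measure (\<rho> (r n)) (grid k -` {g}))"
          using F by (intro finite_measure_finite_Union) (auto simp: disjoint_family_on_def setsP)
        finally show ?thesis .
      qed
      moreover have "(\<lambda>n. \<Sum>g\<in>F. measure (\<rho> (r n)) (grid k -` {g})) \<longlonglongrightarrow> (\<Sum>g\<in>F. a k g)"
        using F by (intro tendsto_sum a) auto
      ultimately have "1 - e \<le> (\<Sum>g\<in>F. a k g)" by (intro LIMSEQ_le_const) auto
      also have "\<dots> = (\<Sum>g\<in>F. q k g)" using F by (intro sum.cong) (auto simp: q_def)
      finally have "ennreal 1 \<le> ennreal ((\<Sum>g\<in>F. q k g) + e)" by (intro ennreal_leI) simp
      also have "\<dots> = (\<Sum>g\<in>F. ennreal (q k g)) + ennreal e"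
        using e q0 by (simp add: sum_nonneg ennreal_plus sum_ennreal)
      also have "(\<Sum>g\<in>F. ennreal (q k g)) = (\<integral>\<^sup>+g. ennreal (q k g) \<partial>count_space F)"
        using F by (simp add: nn_integral_count_space_finite)
      also have "\<dots> \<le> (\<integral>\<^sup>+g. ennreal (q k g) \<partial>count_space UNIV)"
        by (subst nn_integral_count_space_indicator) (auto intro!: nn_integral_mono simp: indicator_def)
      finally show "1 \<le> (\<integral>\<^sup>+g. ennreal (q k g) \<partial>count_space UNIV) + ennreal e" by simp
    qed
  qed
  define A where "A k = embed_pmf (q k)" for k
  have pmfA: "pmf (A k) g = q k g" for k g unfolding A_def by (rule pmf_embed_pmf[OF q0 q1])
  have intA: "(\<integral>\<^sup>+g. f g \<partial>measure_pmf (A k)) \<le> liminf (\<lambda>n. \<integral>\<^sup>+z. f (grid k z) \<partial>\<rho> (r n))"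
    if "\<And>g. f g < \<infinity>" for k f
    using fatou[OF that, of k] by (simp add: nn_integral_measure_pmf pmfA restr[symmetric] mult.commute)
  \<comment> \<open>Fatou yields only an inequality between the two mass functions, which is enough
    for probability masses.\<close>
  have "map_pmf (grid j) (A k) = A j" if "j \<le> k" for j k
  proof (rule pmf_eqI_le)
    fix g
    have "ennreal (pmf (map_pmf (grid j) (A k)) g) = emeasure (measure_pmf (A k)) (grid j -` {g})"
      by (simp add: pmf_map measure_pmf.emeasure_eq_measure)
    also have "\<dots> = (\<integral>\<^sup>+h. indicator (grid j -` {g}) h \<partial>measure_pmf (A k))" by simp
    also have "\<dots> \<le> liminf (\<lambda>n. \<integral>\<^sup>+z. indicator (grid j -` {g}) (grid k z) \<partial>\<rho> (r n))"
      by (rule intA) (simp add: indicator_def)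
    also have "(\<lambda>n. \<integral>\<^sup>+z. indicator (grid j -` {g}) (grid k z) \<partial>\<rho> (r n)) = (\<lambda>n. emeasure (\<rho> (r n)) (grid j -` {g}))"
    proof
      fix n
      have "indicator (grid j -` {g}) (grid k z) = (indicator (grid j -` {g}) z :: ennreal)" for z
        by (simp add: indicator_def grid_grid[OF that])
      then show "(\<integral>\<^sup>+z. indicator (grid j -` {g}) (grid k z) \<partial>\<rho> (r n)) = emeasure (\<rho> (r n)) (grid j -` {g})"
        by (simp add: setsP)
    qed
    also have "liminf (\<lambda>n. emeasure (\<rho> (r n)) (grid j -` {g})) = ennreal (q j g)"
    proof (cases "g \<in> range (grid j)")
      case True
      then have "(\<lambda>n. emeasure (\<rho> (r n)) (grid j -` {g})) \<longlonglongrightarrow> ennreal (q j g)"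
        using a[OF True] by (simp add: q_def emeasure_eq_measure)
      then show ?thesis using lim_imp_Liminf[OF trivial_limit_sequentially] by blast
    next
      case False
      then have "grid j -` {g} = {}" by auto
      then show ?thesis using False by (simp add: q_def Liminf_const)
    qed
    finally show "pmf (map_pmf (grid j) (A k)) g \<le> pmf (A j) g" by (simp add: pmfA q0)
  qed
  then show ?thesis using r(1) intA by (intro exI[of _ r] exI[of _ A]) simp
qed

text \<open>Under \<open>A N\<close> with \<open>N\<close> large, all coarser roundings are
  functions of the finest one. This determines consistent joint laws for every finite set of levels,
  and Kolmogorov's theorem on a Polish space gives the law of the whole sequence.\<close>

lemma grid_inverse_limit:
  fixes A :: "nat \<Rightarrow> 'a::euclidean_space pmf"
  assumes A: "\<And>j k. j \<le> k \<Longrightarrow> map_pmf (grid j) (A k) = A j"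
  shows "\<exists>L :: (nat \<Rightarrow> 'a) measure. prob_space L \<and> sets L = sets (PiM UNIV (\<lambda>_. borel))
    \<and> (\<forall>k. \<forall>f\<in>borel_measurable borel. (\<integral>\<^sup>+\<omega>. f (\<omega> k) \<partial>L) = (\<integral>\<^sup>+g. f g \<partial>measure_pmf (A k)))
    \<and> (AE \<omega> in L. \<forall>j k. j \<le> k \<longrightarrow> \<omega> j = grid j (\<omega> k))"
proof -
  define c where "c J = (\<lambda>g :: 'a. \<lambda>j\<in>J. grid j g)" for J :: "nat set"
  \<comment> \<open>The sum of \<open>J\<close> serves as an upper bound for all levels in
    \<open>J\<close>, defined for the empty set as well; \<open>P_eq\<close> shows that any larger
    level gives the same law.\<close>
  define P where "P J = distr (measure_pmf (A (\<Sum>J))) (PiM J (\<lambda>_. borel)) (c J)" for J :: "nat set"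
  have c_meas: "c J \<in> measurable (measure_pmf p) (PiM J (\<lambda>_. borel))" for J p
    by (auto simp: c_def space_PiM measurable_def)
  have le: "j \<le> \<Sum>J" if "j \<in> J" "finite J" for j and J :: "nat set"
    using member_le_sum[of j J "\<lambda>x. x"] that by simp
  have P_eq: "P J = distr (measure_pmf (A N)) (PiM J (\<lambda>_. borel)) (c J)" if J: "finite J" and N: "\<Sum>J \<le> N" for J N
  proof -
    have "measure_pmf (A (\<Sum>J)) = distr (measure_pmf (A N)) (count_space UNIV) (grid (\<Sum>J))"
      unfolding A[OF N, symmetric] by (rule map_pmf_rep_eq)
    then have "P J = distr (measure_pmf (A N)) (PiM J (\<lambda>_. borel)) (c J \<circ> grid (\<Sum>J))"
      unfolding P_def by (simp add: distr_distr[OF _ _] c_def measurable_def space_PiM)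
    also have "c J \<circ> grid (\<Sum>J) = c J"
      using J le by (auto simp: c_def fun_eq_iff restrict_def grid_grid)
    finally show ?thesis .
  qed
  have proj: "projective_family UNIV P (\<lambda>_. borel)"
  proof (rule projective_family.intro)
    fix J H :: "nat set" assume JH: "J \<subseteq> H" "finite H"
    then have J: "finite J" using finite_subset by blast
    have "P J = distr (measure_pmf (A (\<Sum>H))) (PiM J (\<lambda>_. borel)) (c J)"
      using JH J by (intro P_eq sum_mono2) auto
    also have "c J = (\<lambda>f. restrict f J) \<circ> c H" using JH by (auto simp: c_def fun_eq_iff)
    also have "distr (measure_pmf (A (\<Sum>H))) (PiM J (\<lambda>_. borel)) ((\<lambda>f. restrict f J) \<circ> c H)
      = distr (P H) (PiM J (\<lambda>_. borel)) (\<lambda>f. restrict f J)"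
      unfolding P_def using JH by (intro distr_distr[symmetric] measurable_restrict_subset c_meas)
    finally show "P J = distr (P H) (PiM J (\<lambda>_. borel)) (\<lambda>f. restrict f J)" .
  next
    fix J :: "nat set"
    show "prob_space (P J)" unfolding P_def by (rule measure_pmf.prob_space_distr[OF c_meas])
  qed
  interpret PP: polish_projective UNIV P
    using proj by (simp add: polish_projective_def)
  define L where "L = PP.lim"
  have setsL[measurable_cong]: "sets L = sets (PiM UNIV (\<lambda>_. borel))" unfolding L_def by simp
  have spaceL: "space L = UNIV" using sets_eq_imp_space_eq[OF setsL] by (simp add: space_PiM)
  have distrL: "distr L (PiM J (\<lambda>_. borel)) (\<lambda>\<omega>. restrict \<omega> J) = P J" if J: "finite J" for J
  proof (rule measure_eqI)
    show "sets (distr L (PiM J (\<lambda>_. borel)) (\<lambda>\<omega>. restrict \<omega> J)) = sets (P J)" by (simp add: P_def)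
    fix X assume "X \<in> sets (distr L (PiM J (\<lambda>_. borel)) (\<lambda>\<omega>. restrict \<omega> J))"
    then have X: "X \<in> sets (PiM J (\<lambda>_. borel))" by simp
    have "emeasure (distr L (PiM J (\<lambda>_. borel)) (\<lambda>\<omega>. restrict \<omega> J)) X = emeasure L ((\<lambda>\<omega>. restrict \<omega> J) -` X \<inter> space L)"
      using X by (intro emeasure_distr) (auto intro!: measurable_restrict_subset simp: measurable_cong_sets[OF setsL refl])
    also have "(\<lambda>\<omega>. restrict \<omega> J) -` X \<inter> space L = prod_emb UNIV (\<lambda>_. borel) J X"
      by (auto simp: prod_emb_def spaceL)
    also have "emeasure L \<dots> = emeasure (P J) X" unfolding L_def using J X by (intro PP.emeasure_lim_emb) auto
    finally show "emeasure (distr L (PiM J (\<lambda>_. borel)) (\<lambda>\<omega>. restrict \<omega> J)) X = emeasure (P J) X" .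
  qed
  have rm: "(\<lambda>\<omega>. restrict \<omega> J) \<in> measurable L (PiM J (\<lambda>_. borel))" for J
    by (auto intro!: measurable_restrict_subset simp: measurable_cong_sets[OF setsL refl])
  have "prob_space L" unfolding L_def by (rule PP.P.prob_space_axioms)
  moreover have "(\<integral>\<^sup>+\<omega>. f (\<omega> k) \<partial>L) = (\<integral>\<^sup>+g. f g \<partial>measure_pmf (A k))"
    if f[measurable]: "f \<in> borel_measurable borel" for k and f :: "'a \<Rightarrow> ennreal"
  proof -
    have "(\<integral>\<^sup>+\<omega>. f (\<omega> k) \<partial>L) = (\<integral>\<^sup>+\<eta>. f (\<eta> k) \<partial>distr L (PiM {k} (\<lambda>_. borel)) (\<lambda>\<omega>. restrict \<omega> {k}))"
      by (subst nn_integral_distr[OF rm]) auto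
    also have "\<dots> = (\<integral>\<^sup>+g. f (grid k g) \<partial>measure_pmf (A k))"
      by (subst distrL, simp, unfold P_def, subst nn_integral_distr[OF c_meas]) (auto simp: c_def)
    also have "\<dots> = (\<integral>\<^sup>+g. f g \<partial>measure_pmf (map_pmf (grid k) (A k)))"
      by (simp add: map_pmf_rep_eq nn_integral_distr)
    finally show ?thesis by (simp add: A)
  qed
  moreover have "AE \<omega> in L. \<omega> j = grid j (\<omega> k)" if jk: "j \<le> k" for j k
  proof -
    have "AE \<eta> in distr L (PiM {j, k} (\<lambda>_. borel)) (\<lambda>\<omega>. restrict \<omega> {j, k}). \<eta> j = grid j (\<eta> k)"
    proof -
      have "AE g in measure_pmf (A (\<Sum>{j, k})). c {j, k} g j = grid j (c {j, k} g k)"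
        using jk by (intro AE_I2) (simp add: c_def grid_grid)
      moreover have "{\<eta> \<in> space (PiM {j, k} (\<lambda>_. borel :: 'a measure)). \<eta> j = grid j (\<eta> k)} \<in> sets (PiM {j, k} (\<lambda>_. borel))"
        by measurable
      ultimately show ?thesis
        by (subst distrL, simp, unfold P_def, subst AE_distr_iff[OF c_meas]) auto
    qed
    then show ?thesis by (subst (asm) AE_distr_iff[OF rm]) auto
  qed
  then have "AE \<omega> in L. \<forall>j k. j \<le> k \<longrightarrow> \<omega> j = grid j (\<omega> k)" by (simp add: AE_all_countable)
  ultimately show ?thesis using setsL by (intro exI[of _ L]) simp
qed

text \<open>Weak convergence is stated in the one-sided form given by Fatou's lemma.\<close>

lemma weak_limit:
  fixes \<rho> :: "nat \<Rightarrow> 'a::euclidean_space measure"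
  assumes P: "\<And>n. P2 (\<rho> n)" and M: "\<And>n. m2 (\<rho> n) \<le> M"
  obtains \<sigma> where "prob_space \<sigma>" "sets \<sigma> = sets borel"
    "\<And>f B L. continuous_on UNIV f \<Longrightarrow> (\<And>x. f x \<ge> 0) \<Longrightarrow> L \<ge> 0 \<Longrightarrow>
      (\<And>x y. f y \<le> f x + L * norm (y - x) * (1 + norm x + norm y)) \<Longrightarrow> B \<ge> 0 \<Longrightarrow>
      eventually (\<lambda>n. (\<integral>\<^sup>+x. ennreal (f x) \<partial>\<rho> n) \<le> ennreal B) sequentially \<Longrightarrow>
      (\<integral>\<^sup>+x. ennreal (f x) \<partial>\<sigma>) \<le> ennreal B"
proof -
  obtain r A where r: "strict_mono r" and
    A: "\<And>k f. (\<And>g. f g < \<infinity>) \<Longrightarrow> (\<integral>\<^sup>+g. f g \<partial>measure_pmf (A k)) \<le> liminf (\<lambda>n. \<integral>\<^sup>+z. f (grid k z) \<partial>\<rho> (r n))"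
    "\<And>j k. j \<le> k \<Longrightarrow> map_pmf (grid j) (A k) = A j"
    using grid_limit_pmfs[of \<rho> M, OF P M] by blast
  obtain Q :: "(nat \<Rightarrow> 'a) measure" where Q: "prob_space Q" "sets Q = sets (PiM UNIV (\<lambda>_. borel))"
    "\<And>k f. f \<in> borel_measurable borel \<Longrightarrow> (\<integral>\<^sup>+\<omega>. f (\<omega> k) \<partial>Q) = (\<integral>\<^sup>+g. f g \<partial>measure_pmf (A k))"
    "AE \<omega> in Q. \<forall>j k. j \<le> k \<longrightarrow> \<omega> j = grid j (\<omega> k)"
    using grid_inverse_limit[of A, OF A(2)] by blast
  interpret Q: prob_space Q by fact
  note [measurable_cong] = Q(2)
  define Z where "Z \<omega> = lim (\<lambda>k. \<omega> k)" for \<omega> :: "nat \<Rightarrow> 'a"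
  have [measurable]: "(\<lambda>\<omega>. \<omega> k) \<in> borel_measurable Q" for k by measurable
  have Zm[measurable]: "Z \<in> borel_measurable Q" unfolding Z_def by (rule borel_measurable_lim_metric) measurable
  have Zlim: "AE \<omega> in Q. (\<lambda>k. \<omega> k) \<longlonglongrightarrow> Z \<omega>"
    using Q(4)
  proof eventually_elim
    case (elim \<omega>)
    \<comment> \<open>All coordinates after the \<open>j\<close>th round to the \<open>j\<close>th,
      so they stay within the mesh bound of it.\<close>
    have "Cauchy \<omega>"
    proof (rule metric_CauchyI)
      fix e :: real assume "e > 0"
      have "(\<lambda>j. 2 * (DIM('a) / 2 ^ j)) \<longlonglongrightarrow> 2 * (real DIM('a) * 0)"
        unfolding divide_inverse by (intro tendsto_intros) (simp add: LIMSEQ_inverse_realpow_zero)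
      then have "eventually (\<lambda>j. 2 * (DIM('a) / 2 ^ j) < e) sequentially"
        using \<open>e > 0\<close> by (intro order_tendstoD(2)) auto
      then obtain j where j: "2 * (DIM('a) / 2 ^ j) < e" by (auto simp: eventually_sequentially)
      have "dist (\<omega> k) (\<omega> j) \<le> DIM('a) / 2 ^ j" if "k \<ge> j" for k
        using elim that norm_grid_diff[of j "\<omega> k"] by (simp add: dist_norm norm_minus_commute)
      then have "dist (\<omega> m) (\<omega> n) < e" if "m \<ge> j" "n \<ge> j" for m n
        using that j dist_triangle2[of "\<omega> m" "\<omega> n" "\<omega> j"] by (smt (verit, best))
      then show "\<exists>N. \<forall>m\<ge>N. \<forall>n\<ge>N. dist (\<omega> m) (\<omega> n) < e" by blast
    qed
    then show ?case unfolding Z_def by (simp add: Cauchy_convergent_iff convergent_LIMSEQ_iff)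
  qed
  define \<sigma> where "\<sigma> = distr Q borel Z"
  have "(\<integral>\<^sup>+x. ennreal (f x) \<partial>\<sigma>) \<le> ennreal B"
    if f: "continuous_on UNIV f" "\<And>x. f x \<ge> 0" and L: "L \<ge> 0"
      and lip: "\<And>x y. f y \<le> f x + L * norm (y - x) * (1 + norm x + norm y)" and B: "B \<ge> 0"
      and ev: "eventually (\<lambda>n. (\<integral>\<^sup>+x. ennreal (f x) \<partial>\<rho> n) \<le> ennreal B) sequentially" for f :: "'a \<Rightarrow> real" and B L
  proof -
    have fm[measurable]: "f \<in> borel_measurable borel" using f(1) by (rule borel_measurable_continuous_onI)
    have M0: "M \<ge> 0" using M[of 0] by (rule order_trans[rotated]) (simp add: m2_def)
    define d where "d = real DIM('a)"
    define \<eta> where "\<eta> k = L * (d / 2 ^ k) * (3 + d)" for k :: nat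
    have d: "d \<ge> 0" by (simp add: d_def)
    have \<eta>0: "\<eta> k \<ge> 0" for k using L d by (simp add: \<eta>_def)
    have f_grid: "f (grid k z) \<le> f z + \<eta> k * (1 + (norm z)\<^sup>2)" for k z
    proof -
      have dk: "d / 2 ^ k \<le> d" using d by (simp add: divide_le_eq mult_le_cancel_left1)
      have n: "norm (grid k z - z) \<le> d / 2 ^ k" using norm_grid_diff[of k z] by (simp add: d_def)
      have "norm (grid k z) \<le> norm z + d" using n dk norm_triangle_sub[of "grid k z" z] by linarith
      then have "1 + norm z + norm (grid k z) \<le> 1 + d + 2 * norm z" by simp
      also have "\<dots> \<le> (3 + d) * (1 + (norm z)\<^sup>2)"
        using norm_le_one_plus_sq[of z] mult_nonneg_nonneg[OF d zero_le_power2[of "norm z"]] zero_le_power2[of "norm z"]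
        by (simp only: distrib_left distrib_right mult_1_right)
      finally have 1: "1 + norm z + norm (grid k z) \<le> (3 + d) * (1 + (norm z)\<^sup>2)" .
      have "f (grid k z) \<le> f z + L * norm (grid k z - z) * (1 + norm z + norm (grid k z))" by (rule lip)
      also have "\<dots> \<le> f z + (L * (d / 2 ^ k)) * ((3 + d) * (1 + (norm z)\<^sup>2))"
        using n 1 L d by (intro add_left_mono mult_mono) auto
      finally show ?thesis by (simp add: \<eta>_def mult.assoc)
    qed
    \<comment> \<open>The limit in \<open>n\<close> at a fixed level \<open>k\<close>; the limit in
      \<open>k\<close> is a second use of Fatou's lemma, along the almost surely convergent
      sequence.\<close>
    have bound: "(\<integral>\<^sup>+g. ennreal (f g) \<partial>measure_pmf (A k)) \<le> ennreal (B + \<eta> k * (1 + M))" for k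
    proof -
      have "eventually (\<lambda>n. (\<integral>\<^sup>+z. ennreal (f (grid k z)) \<partial>\<rho> (r n)) \<le> ennreal (B + \<eta> k * (1 + M))) sequentially"
        using eventually_subseq[OF r ev]
      proof eventually_elim
        case (elim n)
        interpret prob_space "\<rho> (r n)" using P2D(1)[OF P] .
        have "(\<integral>\<^sup>+z. ennreal (f (grid k z)) \<partial>\<rho> (r n)) \<le> (\<integral>\<^sup>+z. ennreal (f z) + ennreal (\<eta> k * (1 + (norm z)\<^sup>2)) \<partial>\<rho> (r n))"
          using f_grid f(2) \<eta>0 by (intro nn_integral_mono) (simp flip: ennreal_plus)
        also have "\<dots> = (\<integral>\<^sup>+z. ennreal (f z) \<partial>\<rho> (r n)) + (\<integral>\<^sup>+z. ennreal (\<eta> k * (1 + (norm z)\<^sup>2)) \<partial>\<rho> (r n))"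
          by (intro nn_integral_add P2_measurable[OF P]) measurable
        also have "(\<integral>\<^sup>+z. ennreal (\<eta> k * (1 + (norm z)\<^sup>2)) \<partial>\<rho> (r n)) = ennreal (integral\<^sup>L (\<rho> (r n)) (\<lambda>z. \<eta> k * (1 + (norm z)\<^sup>2)))"
          using P2D(4)[OF P[of "r n"]] \<eta>0 by (intro nn_integral_eq_integral) auto
        also have "integral\<^sup>L (\<rho> (r n)) (\<lambda>z. \<eta> k * (1 + (norm z)\<^sup>2)) = \<eta> k * (1 + m2 (\<rho> (r n)))"
          using P2D(4)[OF P[of "r n"]] by (simp add: m2_def prob_space)
        also have "(\<integral>\<^sup>+z. ennreal (f z) \<partial>\<rho> (r n)) + ennreal (\<eta> k * (1 + m2 (\<rho> (r n)))) \<le> ennreal B + ennreal (\<eta> k * (1 + M))"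
          using elim M[of "r n"] \<eta>0[of k] by (intro add_mono ennreal_leI mult_left_mono) auto
        finally show ?case using B \<eta>0[of k] M0 by (simp add: ennreal_plus)
      qed
      then have "liminf (\<lambda>n. \<integral>\<^sup>+z. ennreal (f (grid k z)) \<partial>\<rho> (r n)) \<le> liminf (\<lambda>n. ennreal (B + \<eta> k * (1 + M)))"
        by (rule Liminf_mono)
      also have "\<dots> = ennreal (B + \<eta> k * (1 + M))" by (rule Liminf_const) simp
      finally have "liminf (\<lambda>n. \<integral>\<^sup>+z. ennreal (f (grid k z)) \<partial>\<rho> (r n)) \<le> ennreal (B + \<eta> k * (1 + M))" .
      with A(1)[of "\<lambda>g. ennreal (f g)" k] show ?thesis by (rule order_trans) simp
    qed
    have "(\<integral>\<^sup>+x. ennreal (f x) \<partial>\<sigma>) = (\<integral>\<^sup>+\<omega>. ennreal (f (Z \<omega>)) \<partial>Q)"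
      unfolding \<sigma>_def by (rule nn_integral_distr) auto
    also have "\<dots> = (\<integral>\<^sup>+\<omega>. liminf (\<lambda>k. ennreal (f (\<omega> k))) \<partial>Q)"
    proof (rule nn_integral_cong_AE)
      show "AE \<omega> in Q. ennreal (f (Z \<omega>)) = liminf (\<lambda>k. ennreal (f (\<omega> k)))"
        using Zlim
      proof eventually_elim
        case (elim \<omega>)
        have "(\<lambda>k. ennreal (f (\<omega> k))) \<longlonglongrightarrow> ennreal (f (Z \<omega>))"
          by (intro tendsto_ennrealI continuous_on_tendsto_compose[OF f(1) elim]) auto
        then show ?case using lim_imp_Liminf[OF trivial_limit_sequentially] by metis
      qed
    qed
    also have "\<dots> \<le> liminf (\<lambda>k. \<integral>\<^sup>+\<omega>. ennreal (f (\<omega> k)) \<partial>Q)" by (rule nn_integral_liminf) measurable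
    also have "(\<lambda>k. \<integral>\<^sup>+\<omega>. ennreal (f (\<omega> k)) \<partial>Q) = (\<lambda>k. \<integral>\<^sup>+g. ennreal (f g) \<partial>measure_pmf (A k))"
      by (intro ext Q(3)) measurable
    also have "liminf \<dots> \<le> liminf (\<lambda>k. ennreal (B + \<eta> k * (1 + M)))"
      using bound by (intro Liminf_mono) auto
    also have "\<dots> = ennreal B"
    proof -
      have "(\<lambda>k. B + \<eta> k * (1 + M)) \<longlonglongrightarrow> B + (L * (d * 0) * (3 + d)) * (1 + M)"
        unfolding \<eta>_def divide_inverse by (intro tendsto_intros) (simp add: LIMSEQ_inverse_realpow_zero)
      then have "(\<lambda>k. ennreal (B + \<eta> k * (1 + M))) \<longlonglongrightarrow> ennreal B" by (intro tendsto_ennrealI) simp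
      then show ?thesis using lim_imp_Liminf[OF trivial_limit_sequentially] by blast
    qed
    finally show ?thesis .
  qed
  moreover have "prob_space \<sigma>" unfolding \<sigma>_def by (rule Q.prob_space_distr) measurable
  moreover have "sets \<sigma> = sets borel" by (simp add: \<sigma>_def)
  ultimately show ?thesis using that by blast
qed

section \<open>Strong duality and the projections\<close>

lemma aff_dense_approx:
  fixes D :: "('a::euclidean_space \<times> real) set"
  assumes D: "\<And>X. open X \<Longrightarrow> X \<noteq> {} \<Longrightarrow> \<exists>d\<in>D. d \<in> X" and e: "e > 0"
  shows "\<exists>p'\<in>D. \<forall>x. \<bar>aff p x - aff p' x\<bar> \<le> e * (1 + norm x)"
proof -
  obtain p' where p': "p' \<in> D" "p' \<in> ball p e" using D[of "ball p e"] e by auto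
  have 1: "norm (fst p - fst p') \<le> e" using dist_fst_le[of p p'] p'(2) by (simp add: dist_norm)
  have 2: "\<bar>snd p - snd p'\<bar> \<le> e" using dist_snd_le[of p p'] p'(2) by (simp add: dist_norm)
  have "\<bar>aff p x - aff p' x\<bar> \<le> e * (1 + norm x)" for x
  proof -
    have "aff p x - aff p' x = (fst p - fst p') \<bullet> x + (snd p - snd p')" by (simp add: aff_def inner_diff_left)
    moreover have "\<bar>(fst p - fst p') \<bullet> x\<bar> \<le> e * norm x"
      using Cauchy_Schwarz_ineq2[of "fst p - fst p'" x] mult_right_mono[OF 1, of "norm x"] by simp
    ultimately show ?thesis using 2 by (simp add: distrib_left)
  qed
  then show ?thesis using p'(1) by blast
qed

text \<open>Uniform approximation is impossible for different slopes; an error relative to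
  \<open>1 + |x|\<close> is still small after integration.\<close>

lemma maxaff_dense_approx:
  fixes D :: "('a::euclidean_space \<times> real) set"
  assumes D: "\<And>X. open X \<Longrightarrow> X \<noteq> {} \<Longrightarrow> \<exists>d\<in>D. d \<in> X" and e: "e > 0"
  shows "\<exists>p'\<in>D. \<exists>qs'\<in>lists D. \<forall>x. \<bar>maxaff p qs x - maxaff p' qs' x\<bar> \<le> e * (1 + norm x)"
proof (induction qs)
  case Nil
  obtain p' where "p' \<in> D" "\<forall>x. \<bar>aff p x - aff p' x\<bar> \<le> e * (1 + norm x)"
    using aff_dense_approx[OF D e] by blast
  then show ?case by (intro bexI[of _ p'] bexI[of _ "[]"]) auto
next
  case (Cons q qs)
  then obtain p' qs' where pq: "p' \<in> D" "qs' \<in> lists D" "\<And>x. \<bar>maxaff p qs x - maxaff p' qs' x\<bar> \<le> e * (1 + norm x)" by blast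
  obtain q' where q': "q' \<in> D" "\<And>x. \<bar>aff q x - aff q' x\<bar> \<le> e * (1 + norm x)"
    using aff_dense_approx[OF D e] by blast
  have "\<bar>maxaff p (q # qs) x - maxaff p' (q' # qs') x\<bar> \<le> e * (1 + norm x)" for x
    using pq(3)[of x] q'(2)[of x] by (auto simp: max_def)
  then show ?case using pq q' by (intro bexI[of _ p'] bexI[of _ "q' # qs'"]) auto
qed

lemma norm_sq_locally_Lipschitz: "(norm y)\<^sup>2 \<le> (norm x)\<^sup>2 + norm (y - x) * (1 + norm x + norm y)"
proof -
  have "(norm y)\<^sup>2 - (norm x)\<^sup>2 = (norm y - norm x) * (norm y + norm x)" by (simp add: power2_eq_square algebra_simps)
  also have "\<dots> \<le> norm (y - x) * (1 + norm x + norm y)" using norm_triangle_ineq2[of y x] by (intro mult_mono) auto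
  finally show ?thesis by simp
qed

lemma m2_nonneg: "m2 M \<ge> 0"
  by (simp add: m2_def)

lemma le_of_le_add_mult:
  fixes a b c :: real
  assumes "\<And>e. e > 0 \<Longrightarrow> a \<le> b + e * c"
  shows "a \<le> b"
proof (rule field_le_epsilon)
  fix e :: real assume e: "e > 0"
  have "e / (\<bar>c\<bar> + 1) > 0" using e by simp
  from assms[OF this] have "a \<le> b + e / (\<bar>c\<bar> + 1) * c" .
  moreover have "e / (\<bar>c\<bar> + 1) * c \<le> e / (\<bar>c\<bar> + 1) * (\<bar>c\<bar> + 1)" using e by (intro mult_left_mono) auto
  ultimately show "a \<le> b + e" by simp
qed

text \<open>The \<open>n\<close>th measure satisfies the first \<open>n\<close> of countably many
  constraints up to \<open>1 / Suc n\<close>. A weak limit keeps the bound on \<open>m2\<close>; it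
  keeps lower bounds for \<open>integral \<phi>\<close> because adding a small multiple of
  \<open>|x|^2\<close> makes a constant minus \<open>\<phi>\<close> nonnegative.\<close>

lemma strong_duality:
  fixes \<mu> \<nu> :: "'a::euclidean_space measure"
  assumes b: "P2b b \<mu>" "P2b b \<nu>"
  shows "\<exists>\<rho>. P2 \<rho> \<and> cx_le \<mu> \<rho> \<and> cx_le \<nu> \<rho> \<and> m2 \<rho> \<le> Z2 \<mu> \<nu> + (m2 \<mu> + m2 \<nu>) / 2"
proof -
  have P: "P2 \<mu>" "P2 \<nu>" using b by (auto simp: P2b_def)
  define D where "D = Z2 \<mu> \<nu> + (m2 \<mu> + m2 \<nu>) / 2"
  obtain T :: "('a \<times> real) set" where T: "countable T" "\<And>X. open X \<Longrightarrow> X \<noteq> {} \<Longrightarrow> \<exists>d\<in>T. d \<in> X"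
    using countable_dense_setE by blast
  have "T \<noteq> {}" using T(2)[of UNIV] by auto
  define S where "S = T \<times> lists T"
  have S: "countable S" "S \<noteq> {}" using T(1) \<open>T \<noteq> {}\<close> by (auto simp: S_def intro!: countable_SIGMA countable_lists)
  define pq where "pq = from_nat_into S"
  have range_pq: "range pq = S" unfolding pq_def using S by simp
  define \<phi> where "\<phi> k = maxaff (fst (pq k)) (snd (pq k))" for k
  define \<alpha> where "\<alpha> k = max (integral\<^sup>L \<mu> (\<phi> k)) (integral\<^sup>L \<nu> (\<phi> k))" for k
  have "\<exists>\<rho>. P2 \<rho> \<and> m2 \<rho> \<le> D + 1 / real (Suc n) \<and> (\<forall>k<n. \<alpha> k - 1 / real (Suc n) \<le> integral\<^sup>L \<rho> (\<phi> k))" for n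
    unfolding D_def \<alpha>_def \<phi>_def by (rule finite_constraints_approx[OF b]) simp
  then obtain \<rho> where \<rho>: "\<And>n. P2 (\<rho> n)" "\<And>n. m2 (\<rho> n) \<le> D + 1 / real (Suc n)"
    "\<And>n k. k < n \<Longrightarrow> \<alpha> k - 1 / real (Suc n) \<le> integral\<^sup>L (\<rho> n) (\<phi> k)" by metis
  have M: "m2 (\<rho> n) \<le> D + 1" for n
  proof -
    have "1 / real (Suc n) \<le> 1" by simp
    then show ?thesis using \<rho>(2)[of n] by linarith
  qed
  have small: "eventually (\<lambda>n. 1 / real (Suc n) \<le> e) sequentially" if "e > 0" for e
    using order_tendstoD(2)[OF LIMSEQ_inverse_real_of_nat that]
    by eventually_elim (simp add: inverse_eq_divide)
  obtain \<sigma> where \<sigma>: "prob_space \<sigma>" "sets \<sigma> = sets borel"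
    "\<And>f B L. continuous_on UNIV f \<Longrightarrow> (\<And>x. f x \<ge> 0) \<Longrightarrow> L \<ge> 0 \<Longrightarrow>
      (\<And>x y. f y \<le> f x + L * norm (y - x) * (1 + norm x + norm y)) \<Longrightarrow> B \<ge> 0 \<Longrightarrow>
      eventually (\<lambda>n. (\<integral>\<^sup>+x. ennreal (f x) \<partial>\<rho> n) \<le> ennreal B) sequentially \<Longrightarrow>
      (\<integral>\<^sup>+x. ennreal (f x) \<partial>\<sigma>) \<le> ennreal B"
    using weak_limit[of \<rho> "D + 1", OF \<rho>(1) M] by metis
  have nn_m2: "(\<integral>\<^sup>+x. ennreal ((norm x)\<^sup>2) \<partial>M) = ennreal (m2 M)" if "P2 M" for M :: "'a measure"
    unfolding m2_def using P2D(4)[OF that] by (intro nn_integral_eq_integral) auto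
  have sq: "(\<integral>\<^sup>+x. ennreal ((norm x)\<^sup>2) \<partial>\<sigma>) \<le> ennreal (D + e)" if "e > 0" for e
  proof (rule \<sigma>(3)[where L=1])
    show ev: "eventually (\<lambda>n. (\<integral>\<^sup>+x. ennreal ((norm x)\<^sup>2) \<partial>\<rho> n) \<le> ennreal (D + e)) sequentially"
      using small[OF that] unfolding nn_m2[OF \<rho>(1)]
      by eventually_elim (intro ennreal_leI order_trans[OF \<rho>(2)], simp)
    have "eventually (\<lambda>n. m2 (\<rho> n) \<le> D + e) sequentially"
      using small[OF that] by eventually_elim (intro order_trans[OF \<rho>(2)], simp)
    then obtain n where "m2 (\<rho> n) \<le> D + e" by (auto simp: eventually_sequentially)
    then show "D + e \<ge> 0" using m2_nonneg[of "\<rho> n"] by linarith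
  qed (use norm_sq_locally_Lipschitz in \<open>auto intro!: continuous_intros\<close>)
  have "(\<integral>\<^sup>+x. ennreal ((norm x)\<^sup>2) \<partial>\<sigma>) < \<infinity>" using sq[of 1] by (simp add: order_le_less_trans)
  then have P\<sigma>: "P2 \<sigma>" unfolding P2_def using \<sigma>(1,2)
    by (auto simp: integrable_iff_bounded measurable_cong_sets[OF \<sigma>(2) refl])
  have "m2 \<sigma> \<le> D"
  proof (rule field_le_epsilon)
    fix e :: real assume e: "e > 0"
    have "eventually (\<lambda>n. m2 (\<rho> n) \<le> D + e) sequentially"
      using small[OF e] by eventually_elim (intro order_trans[OF \<rho>(2)], simp)
    then obtain n where "m2 (\<rho> n) \<le> D + e" by (auto simp: eventually_sequentially)
    then have "D + e \<ge> 0" using m2_nonneg[of "\<rho> n"] by linarith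
    then show "m2 \<sigma> \<le> D + e" using sq[OF e] unfolding nn_m2[OF P\<sigma>] by simp
  qed
  have dense_le: "\<alpha> k \<le> integral\<^sup>L \<sigma> (\<phi> k)" for k
  proof (rule le_of_le_add_mult[where c = "D + 2"])
    fix d :: real assume d: "d > 0"
    have c: "convex_on UNIV (\<phi> k)" unfolding \<phi>_def by (rule convex_on_maxaff)
    have int: "integrable M (\<phi> k)" if "P2 M" for M unfolding \<phi>_def by (rule P2_integrable_maxaff[OF that])
    obtain L where L: "L \<ge> 0" "\<And>x y. \<phi> k x - \<phi> k y \<le> L * norm (x - y)"
      unfolding \<phi>_def using maxaff_Lipschitz by blast
    \<comment> \<open>The least constant that makes \<open>f\<close> nonnegative from the Lipschitz
      bound: \<open>L s - d s^2\<close> is at most \<open>L^2 / (4 d)\<close>.\<close>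
    define C where "C = \<phi> k 0 + L\<^sup>2 / (4 * d)"
    define f where "f x = C + d * (norm x)\<^sup>2 - \<phi> k x" for x
    have f0: "f x \<ge> 0" for x
    proof -
      have "0 \<le> d * (norm x - L / (2 * d))\<^sup>2" using d by simp
      also have "\<dots> = d * (norm x)\<^sup>2 - L * norm x + L\<^sup>2 / (4 * d)"
        using d by (simp add: power2_eq_square field_simps)
      finally show ?thesis using L(2)[of x 0] by (simp add: f_def C_def)
    qed
    have fL: "f y \<le> f x + (d + L) * norm (y - x) * (1 + norm x + norm y)" for x y
    proof -
      have "\<phi> k x - \<phi> k y \<le> L * norm (y - x) * (1 + norm x + norm y)"
      proof -
        have "L * norm (y - x) * 1 \<le> L * norm (y - x) * (1 + norm x + norm y)"
          using L(1) by (intro mult_left_mono) auto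
        then show ?thesis using L(2)[of x y] by (simp add: norm_minus_commute)
      qed
      moreover have "d * (norm y)\<^sup>2 \<le> d * ((norm x)\<^sup>2 + norm (y - x) * (1 + norm x + norm y))"
        using d by (intro mult_left_mono norm_sq_locally_Lipschitz) auto
      ultimately show ?thesis by (simp add: f_def algebra_simps)
    qed
    have fi: "(\<integral>\<^sup>+x. ennreal (f x) \<partial>M) = ennreal (C + d * m2 M - integral\<^sup>L M (\<phi> k))" if "P2 M" for M
    proof -
      interpret prob_space M using P2D(1)[OF that] .
      have "integrable M f" unfolding f_def using int[OF that] P2D(4)[OF that] by simp
      then have "(\<integral>\<^sup>+x. ennreal (f x) \<partial>M) = ennreal (integral\<^sup>L M f)" using f0 by (intro nn_integral_eq_integral) auto
      also have "integral\<^sup>L M f = C + d * m2 M - integral\<^sup>L M (\<phi> k)"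
        unfolding f_def m2_def using int[OF that] P2D(4)[OF that] by (simp add: prob_space)
      finally show ?thesis .
    qed
    have fi0: "0 \<le> C + d * m2 M - integral\<^sup>L M (\<phi> k)" if "P2 M" for M
    proof -
      interpret prob_space M using P2D(1)[OF that] .
      have "0 \<le> integral\<^sup>L M f" using f0 by simp
      also have "integral\<^sup>L M f = C + d * m2 M - integral\<^sup>L M (\<phi> k)"
        unfolding f_def m2_def using int[OF that] P2D(4)[OF that] by (simp add: prob_space)
      finally show ?thesis .
    qed
    \<comment> \<open>Here \<open>D + 1\<close> bounds all second moments, and the last
      \<open>d\<close> absorbs the relaxation of the constraint for large \<open>n\<close>. The
      total error \<open>d (D + 2)\<close> vanishes with \<open>d\<close>.\<close>
    define B where "B = C + d * (D + 1) - \<alpha> k + d"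
    have ev: "eventually (\<lambda>n. C + d * m2 (\<rho> n) - integral\<^sup>L (\<rho> n) (\<phi> k) \<le> B) sequentially"
      using small[OF d] eventually_gt_at_top[of k]
    proof eventually_elim
      case (elim n)
      have "d * m2 (\<rho> n) \<le> d * (D + 1)" using d M by (intro mult_left_mono) auto
      then show ?case using \<rho>(3)[OF elim(2)] elim(1) unfolding B_def by linarith
    qed
    then obtain n where "C + d * m2 (\<rho> n) - integral\<^sup>L (\<rho> n) (\<phi> k) \<le> B" by (auto simp: eventually_sequentially)
    then have B0: "B \<ge> 0" using fi0[OF \<rho>(1)[of n]] by linarith
    have "(\<integral>\<^sup>+x. ennreal (f x) \<partial>\<sigma>) \<le> ennreal B"
    proof (rule \<sigma>(3)[where L="d + L"])
      show "continuous_on UNIV f" unfolding f_def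
        by (intro continuous_intros convex_on_continuous[OF open_UNIV c])
      show "eventually (\<lambda>n. (\<integral>\<^sup>+x. ennreal (f x) \<partial>\<rho> n) \<le> ennreal B) sequentially"
        unfolding fi[OF \<rho>(1)] using ev by eventually_elim (rule ennreal_leI)
    qed (use f0 fL B0 d L(1) in auto)
    then have "C + d * m2 \<sigma> - integral\<^sup>L \<sigma> (\<phi> k) \<le> B" unfolding fi[OF P\<sigma>] using B0 by simp
    moreover have "d * m2 \<sigma> \<ge> 0" using d m2_nonneg[of \<sigma>] by simp
    ultimately show "\<alpha> k \<le> integral\<^sup>L \<sigma> (\<phi> k) + d * (D + 2)" by (simp add: B_def algebra_simps)
  qed
  have cx: "cx_le M \<sigma>" if PM: "P2 M" and le: "\<And>k. integral\<^sup>L M (\<phi> k) \<le> integral\<^sup>L \<sigma> (\<phi> k)" for M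
  proof (rule cx_leI[OF PM P\<sigma>])
    fix p :: "'a \<times> real" and qs
    have nint: "integrable N (\<lambda>x. 1 + norm x)" if "P2 N" for N :: "'a measure"
    proof -
      interpret prob_space N using P2D(1)[OF that] .
      show ?thesis using P2_integrable_ident[OF that] by simp
    qed
    show "integral\<^sup>L M (maxaff p qs) \<le> integral\<^sup>L \<sigma> (maxaff p qs)"
    proof (rule le_of_le_add_mult[where c = "integral\<^sup>L M (\<lambda>x. 1 + norm x) + integral\<^sup>L \<sigma> (\<lambda>x. 1 + norm x)"])
      fix e :: real assume e: "e > 0"
      obtain p' qs' where "p' \<in> T" "qs' \<in> lists T" and
        ap: "\<And>x. \<bar>maxaff p qs x - maxaff p' qs' x\<bar> \<le> e * (1 + norm x)"
        using maxaff_dense_approx[OF T(2) e, of p qs] by auto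
      then have "(p', qs') \<in> range pq" unfolding range_pq S_def by simp
      then obtain k where k: "pq k = (p', qs')" by (metis imageE)
      have \<phi>k: "\<phi> k = maxaff p' qs'" by (simp add: \<phi>_def k)
      note ints = nint[OF PM] nint[OF P\<sigma>] P2_integrable_maxaff[OF PM] P2_integrable_maxaff[OF P\<sigma>]
      have "integral\<^sup>L M (maxaff p qs) \<le> integral\<^sup>L M (\<lambda>x. \<phi> k x + e * (1 + norm x))"
        using ap unfolding \<phi>k
        by (intro integral_mono Bochner_Integration.integrable_add integrable_mult_right ints) (smt (verit))
      also have "\<dots> = integral\<^sup>L M (\<phi> k) + e * integral\<^sup>L M (\<lambda>x. 1 + norm x)"
        unfolding \<phi>k by (subst Bochner_Integration.integral_add) (simp_all add: ints del: maxaff.simps)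
      finally have 1: "integral\<^sup>L M (maxaff p qs) \<le> integral\<^sup>L M (\<phi> k) + e * integral\<^sup>L M (\<lambda>x. 1 + norm x)" .
      have "integral\<^sup>L \<sigma> (\<phi> k) \<le> integral\<^sup>L \<sigma> (\<lambda>x. maxaff p qs x + e * (1 + norm x))"
        using ap unfolding \<phi>k
        by (intro integral_mono Bochner_Integration.integrable_add integrable_mult_right ints) (smt (verit))
      also have "\<dots> = integral\<^sup>L \<sigma> (maxaff p qs) + e * integral\<^sup>L \<sigma> (\<lambda>x. 1 + norm x)"
        by (subst Bochner_Integration.integral_add) (simp_all add: ints del: maxaff.simps)
      finally show "integral\<^sup>L M (maxaff p qs) \<le> integral\<^sup>L \<sigma> (maxaff p qs)
          + e * (integral\<^sup>L M (\<lambda>x. 1 + norm x) + integral\<^sup>L \<sigma> (\<lambda>x. 1 + norm x))"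
        using 1 le[of k] by (simp add: distrib_left)
    qed
  qed
  have "cx_le \<mu> \<sigma>" "cx_le \<nu> \<sigma>"
    using dense_le by (auto intro!: cx P simp: \<alpha>_def)
  then show ?thesis using P\<sigma> \<open>m2 \<sigma> \<le> D\<close> unfolding D_def by blast
qed

text \<open>\<open>c |z|\<^sup>2 - W z\<close> and \<open>W\<close> are both convex, so equality of the second moments forces equality of
  the integrals of \<open>W\<close>.\<close>

lemma cx_le_equal_m2_rigid:
  fixes \<rho> \<sigma> :: "'a::euclidean_space measure"
  assumes P: "P2 \<rho>" "P2 \<sigma>" and le: "cx_le \<rho> \<sigma>" and m: "m2 \<sigma> \<le> m2 \<rho>"
    and \<phi>: "convex_on UNIV \<phi>" and L: "\<And>x y. \<phi> x - \<phi> y \<le> L * norm (x - y)"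
  shows "integral\<^sup>L \<rho> \<phi> = integral\<^sup>L \<sigma> \<phi>"
proof (rule antisym)
  have int: "integrable \<rho> \<phi>" "integrable \<sigma> \<phi>" using P1_integrable_Lipschitz[OF P2_imp_P1 L] P by auto
  show "integral\<^sup>L \<rho> \<phi> \<le> integral\<^sup>L \<sigma> \<phi>" using cx_leD[OF le \<phi> int] .
  interpret \<rho>: prob_space \<rho> using P2D(1)[OF P(1)] .
  interpret \<sigma>: prob_space \<sigma> using P2D(1)[OF P(2)] .
  show "integral\<^sup>L \<sigma> \<phi> \<le> integral\<^sup>L \<rho> \<phi>"
  proof (rule le_of_le_add_mult[where c = "L\<^sup>2 / 4"])
    fix e :: real assume e: "e > 0"
    \<comment> \<open>The approximation error \<open>L^2 / (4 c)\<close> becomes a multiple of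
      \<open>e\<close>.\<close>
    define c where "c = 1 / e"
    have c: "c > 0" using e by (simp add: c_def)
    obtain W where W: "convex_on UNIV W" "convex_on UNIV (\<lambda>z. c * (norm z)\<^sup>2 - W z)"
      "\<And>z. \<phi> z - L\<^sup>2 / (4 * c) \<le> W z" "\<And>z. W z \<le> \<phi> z"
      using Lipschitz_convex_approx[OF \<phi> L c] by blast
    have iW: "integrable \<rho> W" "integrable \<sigma> W" using P2_integrable_semiconcave[OF _ W(1,2)] P by auto
    have "integral\<^sup>L \<rho> (\<lambda>z. c * (norm z)\<^sup>2 - W z) \<le> integral\<^sup>L \<sigma> (\<lambda>z. c * (norm z)\<^sup>2 - W z)"
      using iW P2D(4)[OF P(1)] P2D(4)[OF P(2)] by (intro cx_leD[OF le W(2)]) auto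
    then have "c * m2 \<rho> - integral\<^sup>L \<rho> W \<le> c * m2 \<sigma> - integral\<^sup>L \<sigma> W"
      unfolding m2_def using iW P2D(4)[OF P(1)] P2D(4)[OF P(2)] by simp
    moreover have "c * m2 \<sigma> \<le> c * m2 \<rho>" using m c by simp
    moreover have "integral\<^sup>L \<rho> W \<le> integral\<^sup>L \<rho> \<phi>" using int iW W(4) by (intro integral_mono) auto
    moreover have "integral\<^sup>L \<sigma> \<phi> - L\<^sup>2 / (4 * c) \<le> integral\<^sup>L \<sigma> W"
    proof -
      have "integral\<^sup>L \<sigma> (\<lambda>z. \<phi> z - L\<^sup>2 / (4 * c)) \<le> integral\<^sup>L \<sigma> W"
        using int iW W(3) by (intro integral_mono) auto
      then show ?thesis using int by (simp add: \<sigma>.prob_space)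
    qed
    moreover have "L\<^sup>2 / (4 * c) = e * (L\<^sup>2 / 4)" using e by (simp add: c_def)
    ultimately show "integral\<^sup>L \<sigma> \<phi> \<le> integral\<^sup>L \<rho> \<phi> + e * (L\<^sup>2 / 4)" by linarith
  qed
qed

lemma m2_mono: "P2 \<rho> \<Longrightarrow> P2 \<sigma> \<Longrightarrow> cx_le \<rho> \<sigma> \<Longrightarrow> m2 \<rho> \<le> m2 \<sigma>"
  unfolding m2_def by (intro cx_leD convex_on_norm_sq P2D(4))

lemma cx_join_iff:
  fixes \<mu> \<nu> :: "'a::euclidean_space measure"
  assumes b: "P2b b \<mu>" "P2b b \<nu>"
  shows "\<rho> \<in> cx_join \<mu> \<nu> \<longleftrightarrow> P2 \<rho> \<and> cx_le \<mu> \<rho> \<and> cx_le \<nu> \<rho> \<and> m2 \<rho> = Z2 \<mu> \<nu> + (m2 \<mu> + m2 \<nu>) / 2"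
proof -
  have P: "P2 \<mu>" "P2 \<nu>" using b by (auto simp: P2b_def)
  have low: "Z2 \<mu> \<nu> + (m2 \<mu> + m2 \<nu>) / 2 \<le> m2 \<rho>" if "P2 \<rho>" "cx_le \<mu> \<rho>" "cx_le \<nu> \<rho>" for \<rho>
    using Z2_least[of \<mu> \<nu> "m2 \<rho> - (m2 \<mu> + m2 \<nu>) / 2"] weak_duality[OF P that] by simp
  obtain \<rho>' where \<rho>': "P2 \<rho>'" "cx_le \<mu> \<rho>'" "cx_le \<nu> \<rho>'" "m2 \<rho>' \<le> Z2 \<mu> \<nu> + (m2 \<mu> + m2 \<nu>) / 2"
    using strong_duality[OF b] by blast
  show ?thesis
    unfolding cx_join_def is_arg_min_def using low \<rho>' by (force simp: not_less)
qed

lemma cx_join_nonempty: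
  assumes b: "P2b b \<mu>" "P2b b \<nu>"
  obtains \<rho> where "\<rho> \<in> cx_join \<mu> \<nu>"
proof -
  have P: "P2 \<mu>" "P2 \<nu>" using b by (auto simp: P2b_def)
  obtain \<rho>' where \<rho>': "P2 \<rho>'" "cx_le \<mu> \<rho>'" "cx_le \<nu> \<rho>'" "m2 \<rho>' \<le> Z2 \<mu> \<nu> + (m2 \<mu> + m2 \<nu>) / 2"
    using strong_duality[OF b] by blast
  moreover have "Z2 \<mu> \<nu> + (m2 \<mu> + m2 \<nu>) / 2 \<le> m2 \<rho>'"
    using Z2_least[of \<mu> \<nu> "m2 \<rho>' - (m2 \<mu> + m2 \<nu>) / 2"] weak_duality[OF P \<rho>'(1-3)] by simp
  ultimately have "\<rho>' \<in> cx_join \<mu> \<nu>" by (simp add: cx_join_iff[OF b])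
  then show ?thesis by (rule that)
qed

lemma cx_join_commute: "cx_join \<mu> \<nu> = cx_join \<nu> \<mu>"
  unfolding cx_join_def by (auto simp: is_arg_min_def)

text \<open>The constraints are preserved by mixtures and \<open>m2\<close> is affine along
  them.\<close>

lemma cx_join_mix_convex:
  fixes \<mu> \<nu> :: "'a::euclidean_space measure"
  assumes b: "P2b b \<mu>" "P2b b \<nu>"
  shows "mix_convex (cx_join \<mu> \<nu>)"
proof -
  have P: "P2 \<mu>" "P2 \<nu>" using b by (auto simp: P2b_def)
  have "t * c + (1 - t) * c = c" for t c :: real by (simp add: algebra_simps)
  then show ?thesis
    unfolding mix_convex_def using P by (auto simp: cx_join_iff[OF b] P2_mix cx_le_mix m2_mix)
qed

text \<open>For admissible \<open>u\<close>, the convex function \<open>|x|^2 / 2 + u\<close> has a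
  larger integral under \<rho> than under \<mu>. Testing \<open>Z2 \<nu> \<rho>\<close> with minus
  half of it therefore bounds half of the corresponding difference between \<mu> and \<nu>,
  uniformly in \<rho>.\<close>

lemma Z2_ge_projection:
  fixes \<mu> \<nu> :: "'a::euclidean_space measure"
  assumes b: "P2b b \<mu>" "P2b b \<nu>" and \<rho>: "P2 \<rho>" "cx_le \<mu> \<rho>"
  shows "(Z2 \<mu> \<nu> + (m2 \<mu> + m2 \<nu>) / 2 - m2 \<nu>) / 2 \<le> Z2 \<nu> \<rho>"
proof -
  have P: "P2 \<mu>" "P2 \<nu>" using b by (auto simp: P2b_def)
  have b\<rho>: "P2b b \<rho>" using b(1) \<rho> cx_le_barycentre[OF P(1) \<rho>] by (simp add: P2b_def)
  have "Z2 \<mu> \<nu> \<le> 2 * Z2 \<nu> \<rho> - m2 \<mu> / 2 + m2 \<nu> / 2"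
  proof (rule Z2_least)
    fix u :: "'a \<Rightarrow> real" assume u: "C11_1 u"
    define v where "v x = - (1/2) * ((norm x)\<^sup>2 / 2 + u x)" for x
    have "C11_1 v"
    proof (rule C11_1I)
      have "convex_on UNIV (\<lambda>x. (1/2) * ((norm x)\<^sup>2 / 2 + - u x))"
        by (intro convex_on_cmul C11_1_convex C11_1_uminus u) simp
      then show "convex_on UNIV (\<lambda>x. (norm x)\<^sup>2 / 2 + v x)" by (simp add: v_def field_simps)
      have "convex_on UNIV (\<lambda>x. ((norm x)\<^sup>2 / 2 + 0) + (1/2) * ((norm x)\<^sup>2 / 2 + u x))"
        by (intro convex_on_add convex_on_cmul C11_1_convex C11_1_zero u) simp
      then show "convex_on UNIV (\<lambda>x. (norm x)\<^sup>2 / 2 - v x)" by (simp add: v_def)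
    qed
    have eq: "integral\<^sup>L M v = - (1/2) * (m2 M / 2 + integral\<^sup>L M u)" if "P2 M" for M
      unfolding v_def[abs_def] integral_half_sq_plus_C11_1(2)[OF that u, symmetric] by simp
    have "integral\<^sup>L \<nu> v - integral\<^sup>L \<rho> v \<le> Z2 \<nu> \<rho>" by (rule Z2_upper[OF b(2) b\<rho> \<open>C11_1 v\<close>])
    then show "integral\<^sup>L \<mu> u - integral\<^sup>L \<nu> u \<le> 2 * Z2 \<nu> \<rho> - m2 \<mu> / 2 + m2 \<nu> / 2"
      using half_sq_plus_C11_1_mono[OF P(1) \<rho> u] unfolding eq[OF P(2)] eq[OF \<rho>(1)] by (simp add: field_simps)
  qed
  then show ?thesis by (simp add: field_simps)
qed

lemma Z2_le_half_m2_diff: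
  assumes "P2 \<nu>" "P2 \<rho>" and "cx_le \<nu> \<rho>"
  shows "Z2 \<nu> \<rho> \<le> (m2 \<rho> - m2 \<nu>) / 2"
proof (rule Z2_least)
  show "integral\<^sup>L \<nu> u - integral\<^sup>L \<rho> u \<le> (m2 \<rho> - m2 \<nu>) / 2" if "C11_1 u" for u
    using half_sq_plus_C11_1_mono[OF assms that] by (simp add: field_simps)
qed

lemma Z2_cx_join:
  fixes \<mu> \<nu> :: "'a::euclidean_space measure"
  assumes b: "P2b b \<mu>" "P2b b \<nu>" and \<rho>: "\<rho> \<in> cx_join \<mu> \<nu>"
  shows "Z2 \<nu> \<rho> = (m2 \<rho> - m2 \<nu>) / 2"
    and "P2 \<rho>' \<Longrightarrow> cx_le \<mu> \<rho>' \<Longrightarrow> (m2 \<rho> - m2 \<nu>) / 2 \<le> Z2 \<nu> \<rho>'"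
proof -
  have P: "P2 \<mu>" "P2 \<nu>" using b by (auto simp: P2b_def)
  have f: "P2 \<rho>" "cx_le \<mu> \<rho>" "cx_le \<nu> \<rho>" and m: "m2 \<rho> = Z2 \<mu> \<nu> + (m2 \<mu> + m2 \<nu>) / 2"
    using \<rho> by (auto simp: cx_join_iff[OF b])
  show *: "(m2 \<rho> - m2 \<nu>) / 2 \<le> Z2 \<nu> \<rho>'" if "P2 \<rho>'" "cx_le \<mu> \<rho>'" for \<rho>'
    using Z2_ge_projection[OF b that] by (simp add: m)
  show "Z2 \<nu> \<rho> = (m2 \<rho> - m2 \<nu>) / 2"
    using *[OF f(1,2)] Z2_le_half_m2_diff[OF P(2) f(1,3)] by simp
qed

lemma zproj_eq_cx_join:
  fixes \<mu> \<nu> :: "'a::euclidean_space measure"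
  assumes b: "P2b b \<mu>" "P2b b \<nu>"
  shows "zproj \<mu> \<nu> = cx_join \<mu> \<nu>"
proof (intro equalityI subsetI)
  have P: "P2 \<mu>" "P2 \<nu>" using b by (auto simp: P2b_def)
  fix \<rho>
  {
    assume \<rho>: "\<rho> \<in> cx_join \<mu> \<nu>"
    then show "\<rho> \<in> zproj \<mu> \<nu>"
      using Z2_cx_join[OF b \<rho>] unfolding zproj_def is_arg_min_def by (force simp: cx_join_iff[OF b] not_less)
  next
    assume "\<rho> \<in> zproj \<mu> \<nu>"
    then have \<rho>: "P2 \<rho>" "cx_le \<mu> \<rho>" and min: "\<And>\<rho>'. P2 \<rho>' \<Longrightarrow> cx_le \<mu> \<rho>' \<Longrightarrow> Z2 \<nu> \<rho> \<le> Z2 \<nu> \<rho>'"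
      by (auto simp: zproj_def is_arg_min_def not_less)
    define D where "D = Z2 \<mu> \<nu> + (m2 \<mu> + m2 \<nu>) / 2"
    obtain \<rho>' where \<rho>': "\<rho>' \<in> cx_join \<mu> \<nu>" using cx_join_nonempty[OF b] .
    have "Z2 \<nu> \<rho> \<le> (D - m2 \<nu>) / 2"
      using min[of \<rho>'] \<rho>' Z2_cx_join(1)[OF b \<rho>'] by (auto simp: cx_join_iff[OF b] D_def)
    moreover have b\<rho>: "P2b b \<rho>" using b(1) \<rho> cx_le_barycentre[OF P(1) \<rho>] by (simp add: P2b_def)
    obtain \<sigma> where \<sigma>: "P2 \<sigma>" "cx_le \<nu> \<sigma>" "cx_le \<rho> \<sigma>" "m2 \<sigma> \<le> Z2 \<nu> \<rho> + (m2 \<nu> + m2 \<rho>) / 2"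
      using strong_duality[OF b(2) b\<rho>] by blast
    moreover have "D \<le> m2 \<sigma>"
      using Z2_least[of \<mu> \<nu> "m2 \<sigma> - (m2 \<mu> + m2 \<nu>) / 2"]
        weak_duality[OF P \<sigma>(1) cx_le_trans[OF \<rho>(2) \<sigma>(3)] \<sigma>(2)] by (simp add: D_def)
    moreover have "m2 \<rho> \<le> m2 \<sigma>" by (rule m2_mono[OF \<rho>(1) \<sigma>(1,3)])
    ultimately have m: "m2 \<sigma> \<le> m2 \<rho>" "m2 \<rho> = D" by argo+
    have "cx_le \<nu> \<rho>"
    proof (rule cx_leI[OF P(2) \<rho>(1)])
      fix p :: "'a \<times> real" and qs
      obtain L where L: "\<And>x y. maxaff p qs x - maxaff p qs y \<le> L * norm (x - y)" using maxaff_Lipschitz by blast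
      have "integral\<^sup>L \<nu> (maxaff p qs) \<le> integral\<^sup>L \<sigma> (maxaff p qs)"
        by (intro cx_leD[OF \<sigma>(2) convex_on_maxaff] P2_integrable_maxaff P \<sigma>(1))
      also have "\<dots> = integral\<^sup>L \<rho> (maxaff p qs)"
        by (rule cx_le_equal_m2_rigid[OF \<rho>(1) \<sigma>(1,3) m(1) convex_on_maxaff L, symmetric])
      finally show "integral\<^sup>L \<nu> (maxaff p qs) \<le> integral\<^sup>L \<rho> (maxaff p qs)" .
    qed
    then show "\<rho> \<in> cx_join \<mu> \<nu>" using \<rho> m(2) by (simp add: cx_join_iff[OF b] D_def)
  }
qed

section \<open>Non-uniqueness in higher dimension\<close>

definition coin :: "'a::euclidean_space measure \<Rightarrow> 'a measure \<Rightarrow> 'a measure" where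
  "coin M N = mix (1/2) M N"

definition sym2 :: "'a::euclidean_space \<Rightarrow> 'a measure" where
  "sym2 a = coin (return borel a) (return borel (- a))"

lemma P2_coin: "P2 M \<Longrightarrow> P2 N \<Longrightarrow> P2 (coin M N)"
  unfolding coin_def by (rule P2_mix) auto

lemma P2_sym2: "P2 (sym2 a)"
  unfolding sym2_def by (intro P2_coin P2_return)

text \<open>A relation instead of an equation, so that integrability and value propagate together
  through nested coin tosses.\<close>

definition has_int :: "'a::euclidean_space measure \<Rightarrow> ('a \<Rightarrow> real) \<Rightarrow> real \<Rightarrow> bool" where
  "has_int M f c \<longleftrightarrow> P2 M \<and> f \<in> borel_measurable borel \<and> integrable M f \<and> integral\<^sup>L M f = c"

lemma has_int_return: "f \<in> borel_measurable borel \<Longrightarrow> has_int (return borel a) f (f a)"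
  by (auto simp: has_int_def P2_return integral_return integrable_iff_bounded nn_integral_return)

lemma has_int_coin: "has_int M f c \<Longrightarrow> has_int N f d \<Longrightarrow> has_int (coin M N) f ((c + d) / 2)"
  unfolding has_int_def coin_def
  using mix_integral[of M N "1/2" f] P2_mix[of M N "1/2"] by auto

lemma has_int_sym2: "f \<in> borel_measurable borel \<Longrightarrow> has_int (sym2 a) f ((f a + f (- a)) / 2)"
  unfolding sym2_def by (intro has_int_coin has_int_return)

lemma P2b_0I:
  fixes M :: "'a::euclidean_space measure"
  assumes "\<And>b. has_int M (\<lambda>x. x \<bullet> b) 0"
  shows "P2b 0 M"
proof -
  have P: "P2 M" using assms by (auto simp: has_int_def)
  have "integral\<^sup>L M (\<lambda>x. x) = 0"
  proof (rule euclidean_eqI)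
    fix b :: 'a
    have "integral\<^sup>L M (\<lambda>x. x) \<bullet> b = integral\<^sup>L M (\<lambda>x. x \<bullet> b)"
      using P2_integrable_ident[OF P] by (rule integral_inner_left[symmetric])
    then show "integral\<^sup>L M (\<lambda>x. x) \<bullet> b = 0 \<bullet> b" using assms[of b] by (simp add: has_int_def)
  qed
  with P show ?thesis by (simp add: P2b_def)
qed

lemma convex_midpoint_le:
  fixes \<phi> :: "'a::real_vector \<Rightarrow> real"
  assumes "convex_on UNIV \<phi>"
  shows "2 * \<phi> x \<le> \<phi> (x + h) + \<phi> (x - h)"
proof -
  have "\<phi> ((1 - 1/2) *\<^sub>R (x + h) + (1/2) *\<^sub>R (x - h)) \<le> (1 - 1/2) * \<phi> (x + h) + (1/2) * \<phi> (x - h)"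
    using convex_onD[OF assms, of "1/2" "x + h" "x - h"] by simp
  also have "(1 - 1/2) *\<^sub>R (x + h) + (1/2) *\<^sub>R (x - h) = x"
    by (simp add: algebra_simps scaleR_add_left[symmetric])
  finally show ?thesis by simp
qed

text \<open>Here \<open>\<mu>\<close> and \<open>\<nu>\<close> live on orthogonal lines, so any common upper bound with these
  marginals along the two lines has minimal second moment, while the coupling of the marginals
  stays free: \<open>\<rho>1\<close> charges the origin and the corners \<open>\<plusminus>i \<plusminus> j\<close>, \<open>\<rho>2\<close> the points \<open>\<plusminus>i\<close>, \<open>\<plusminus>j\<close>.\<close>

lemma cx_join_not_unique:
  assumes dim: "DIM('a::euclidean_space) > 1"
  shows "\<exists>(b'::'a) \<mu>' \<nu>'. P2b b' \<mu>' \<and> P2b b' \<nu>' \<and>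
          (\<exists>\<rho>1 \<rho>2. \<rho>1 \<in> cx_join \<mu>' \<nu>' \<and> \<rho>2 \<in> cx_join \<mu>' \<nu>' \<and> \<rho>1 \<noteq> \<rho>2)"
proof -
  obtain i :: 'a where i: "i \<in> Basis" using nonempty_Basis by blast
  have "Basis \<noteq> {i}" using dim by (metis card.empty card_insert_disjoint empty_iff finite.emptyI less_irrefl One_nat_def)
  then obtain j where j: "j \<in> Basis" "j \<noteq> i" using i by blast
  have ip: "i \<bullet> i = 1" "j \<bullet> j = 1" "i \<bullet> j = 0" "j \<bullet> i = 0" using i j by (auto simp: inner_Basis)
  let ?O = "return borel (0 :: 'a)"
  define \<mu> where "\<mu> = coin ?O (sym2 i)"
  define \<nu> where "\<nu> = coin ?O (sym2 j)"
  define \<rho>1 where "\<rho>1 = coin ?O (coin (sym2 (i + j)) (sym2 (i - j)))"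
  define \<rho>2 where "\<rho>2 = coin (sym2 i) (sym2 j)"
  note hi = has_int_return has_int_sym2
  have h\<mu>: "has_int \<mu> f ((f 0 + (f i + f (- i)) / 2) / 2)"
    and h\<nu>: "has_int \<nu> f ((f 0 + (f j + f (- j)) / 2) / 2)"
    and h1: "has_int \<rho>1 f ((f 0 + ((f (i + j) + f (- (i + j))) / 2 + (f (i - j) + f (- (i - j))) / 2) / 2) / 2)"
    and h2: "has_int \<rho>2 f (((f i + f (- i)) / 2 + (f j + f (- j)) / 2) / 2)"
    if "f \<in> borel_measurable borel" for f
    unfolding \<mu>_def \<nu>_def \<rho>1_def \<rho>2_def using that by (intro has_int_coin hi; simp)+
  have P: "P2 \<mu>" "P2 \<nu>" "P2 \<rho>1" "P2 \<rho>2"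
    unfolding \<mu>_def \<nu>_def \<rho>1_def \<rho>2_def by (intro P2_coin P2_sym2 P2_return)+
  have b: "P2b 0 \<mu>" "P2b 0 \<nu>"
    using h\<mu>[of "\<lambda>x. x \<bullet> _"] h\<nu>[of "\<lambda>x. x \<bullet> _"] by (auto intro!: P2b_0I)
  have int_eq: "integral\<^sup>L M f = c" if "has_int M f c" for M :: "'a measure" and f c
    using that by (simp add: has_int_def)
  \<comment> \<open>Mass is only split symmetrically: for \<open>\<rho>1\<close> the points of one
    line move to corners along the other, for \<open>\<rho>2\<close> the mass at the origin moves to
    the other line.\<close>
  have cx: "cx_le \<mu> \<rho>1" "cx_le \<nu> \<rho>1" "cx_le \<mu> \<rho>2" "cx_le \<nu> \<rho>2"
  proof (safe intro!: cx_leI P)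
    fix p :: "'a \<times> real" and qs
    let ?\<phi> = "maxaff p qs"
    have c: "convex_on UNIV ?\<phi>" by (rule convex_on_maxaff)
    have m: "?\<phi> \<in> borel_measurable borel" by (rule convex_on_borel_measurable[OF c])
    note I = int_eq[OF h\<mu>[OF m]] int_eq[OF h\<nu>[OF m]] int_eq[OF h1[OF m]] int_eq[OF h2[OF m]]
    note mid = convex_midpoint_le[OF c]
    have neg: "- (i + j) = - i - j" "- (i - j) = - i + j" "j + i = i + j" "j - i = - i + j" "- j + i = i - j" "- j - i = - i - j"
      by simp_all
    show "integral\<^sup>L \<mu> ?\<phi> \<le> integral\<^sup>L \<rho>1 ?\<phi>"
      unfolding I neg using mid[of i j] mid[of "- i" j] by argo
    show "integral\<^sup>L \<nu> ?\<phi> \<le> integral\<^sup>L \<rho>1 ?\<phi>"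
      unfolding I neg using mid[of j i, unfolded neg] mid[of "- j" i, unfolded neg] by argo
    show "integral\<^sup>L \<mu> ?\<phi> \<le> integral\<^sup>L \<rho>2 ?\<phi>"
      unfolding I using mid[of 0 j] by simp
    show "integral\<^sup>L \<nu> ?\<phi> \<le> integral\<^sup>L \<rho>2 ?\<phi>"
      unfolding I using mid[of 0 i] by simp
  qed
  have sq_conv: "convex_on UNIV (\<lambda>x. (x \<bullet> k)\<^sup>2)" for k :: 'a
  proof (rule convex_on_if_subgradients)
    fix x
    have "(y \<bullet> k)\<^sup>2 \<ge> (x \<bullet> k)\<^sup>2 + ((2 * (x \<bullet> k)) *\<^sub>R k) \<bullet> (y - x)" for y
      using zero_le_power2[of "y \<bullet> k - x \<bullet> k"]
      by (simp add: power2_eq_square algebra_simps inner_diff_right inner_commute)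
    then show "\<exists>p. \<forall>y. (y \<bullet> k)\<^sup>2 \<ge> (x \<bullet> k)\<^sup>2 + p \<bullet> (y - x)" by blast
  qed
  have sq_int: "integrable M (\<lambda>x. (x \<bullet> k)\<^sup>2)" if "P2 M" for M and k :: 'a
  proof (rule P2_integrable_quadratic[OF that, where A=0 and B="(norm k)\<^sup>2"])
    fix x
    have "\<bar>x \<bullet> k\<bar>\<^sup>2 \<le> (norm x * norm k)\<^sup>2" by (intro power_mono Cauchy_Schwarz_ineq2) simp
    then show "norm ((x \<bullet> k)\<^sup>2) \<le> 0 + (norm k)\<^sup>2 * (norm x)\<^sup>2" by (simp add: power_mult_distrib mult.commute)
  qed measurable
  have norm_ge: "(x \<bullet> i)\<^sup>2 + (x \<bullet> j)\<^sup>2 \<le> (norm x)\<^sup>2" for x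
  proof -
    have "(x \<bullet> i)\<^sup>2 + (x \<bullet> j)\<^sup>2 = (\<Sum>k\<in>{i, j}. (x \<bullet> k)\<^sup>2)" using j by simp
    also have "\<dots> \<le> (\<Sum>k\<in>Basis. (x \<bullet> k)\<^sup>2)" using i j by (intro sum_mono2) auto
    also have "\<dots> = (norm x)\<^sup>2"
      unfolding power2_norm_eq_inner euclidean_inner[of x x] by (simp add: power2_eq_square)
    finally show ?thesis .
  qed
  \<comment> \<open>The squares of the two coordinates are convex; \<mu> forces 1/2 for the first,
    \<nu> forces 1/2 for the second.\<close>
  have low: "1 \<le> m2 \<rho>" if \<rho>: "P2 \<rho>" "cx_le \<mu> \<rho>" "cx_le \<nu> \<rho>" for \<rho>
  proof -
    have "integral\<^sup>L \<mu> (\<lambda>x. (x \<bullet> i)\<^sup>2) = 1 / 2" "integral\<^sup>L \<nu> (\<lambda>x. (x \<bullet> j)\<^sup>2) = 1 / 2"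
      using int_eq[OF h\<mu>[of "\<lambda>x. (x \<bullet> i)\<^sup>2"]] int_eq[OF h\<nu>[of "\<lambda>x. (x \<bullet> j)\<^sup>2"]] by (simp_all add: ip)
    moreover have "integral\<^sup>L \<mu> (\<lambda>x. (x \<bullet> i)\<^sup>2) \<le> integral\<^sup>L \<rho> (\<lambda>x. (x \<bullet> i)\<^sup>2)"
      by (intro cx_leD[OF \<rho>(2) sq_conv] sq_int P \<rho>(1))
    moreover have "integral\<^sup>L \<nu> (\<lambda>x. (x \<bullet> j)\<^sup>2) \<le> integral\<^sup>L \<rho> (\<lambda>x. (x \<bullet> j)\<^sup>2)"
      by (intro cx_leD[OF \<rho>(3) sq_conv] sq_int P \<rho>(1))
    moreover have "integral\<^sup>L \<rho> (\<lambda>x. (x \<bullet> i)\<^sup>2 + (x \<bullet> j)\<^sup>2) \<le> m2 \<rho>"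
      unfolding m2_def using norm_ge
      by (intro integral_mono Bochner_Integration.integrable_add sq_int[OF \<rho>(1)] P2D(4)[OF \<rho>(1)]) 
    ultimately show ?thesis using sq_int[OF \<rho>(1)] by simp
  qed
  have "m2 \<rho>1 = 1" "m2 \<rho>2 = 1"
    unfolding m2_def using int_eq[OF h1[of "\<lambda>x. (norm x)\<^sup>2"]] int_eq[OF h2[of "\<lambda>x. (norm x)\<^sup>2"]]
    by (simp_all add: power2_norm_eq_inner inner_simps ip)
  then have "\<rho>1 \<in> cx_join \<mu> \<nu>" "\<rho>2 \<in> cx_join \<mu> \<nu>"
    unfolding cx_join_def is_arg_min_def using P cx low by (auto simp: not_less)
  moreover have "\<rho>1 \<noteq> \<rho>2"
  proof
    assume "\<rho>1 = \<rho>2"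
    \<comment> \<open>This product vanishes on both lines, hence on the support of
      \<open>\<rho>2\<close>, but equals 1 at the corners charged by \<open>\<rho>1\<close>.\<close>
    moreover have m: "(\<lambda>x. (x \<bullet> i)\<^sup>2 * (x \<bullet> j)\<^sup>2) \<in> borel_measurable borel" by measurable
    ultimately show False
      using int_eq[OF h1[OF m]] int_eq[OF h2[OF m]] by (simp add: inner_simps ip)
  qed
  ultimately show ?thesis using b by blast
qed

section \<open>Convex order on the line\<close>

text \<open>For convex \<open>g\<close> this is the right derivative, since difference quotients
  decrease towards \<open>x\<close>. The right-hand choice makes it right continuous, as a
  distribution function has to be.\<close>

definition rderiv :: "(real \<Rightarrow> real) \<Rightarrow> real \<Rightarrow> real" where
  "rderiv g x = Inf ((\<lambda>y. (g y - g x) / (y - x)) ` {x<..})"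

lemma real_subgradient:
  fixes g :: "real \<Rightarrow> real"
  assumes "convex_on UNIV g"
  shows "\<exists>p. \<forall>y. g x + p * (y - x) \<le> g y"
  using convex_subgradient[OF assms, of x] by auto

lemma rderiv_slope_bdd:
  assumes g: "convex_on UNIV g"
  shows "bdd_below ((\<lambda>y. (g y - g x) / (y - x)) ` {x<..})"
proof -
  obtain p where p: "\<And>y. g x + p * (y - x) \<le> g y" using real_subgradient[OF g, of x] by blast
  show ?thesis
  proof (rule bdd_belowI2)
    fix y assume "y \<in> {x<..}"
    then show "p \<le> (g y - g x) / (y - x)" using p[of y] by (simp add: field_simps)
  qed
qed

lemma rderiv_lower:
  assumes g: "convex_on UNIV g" and xy: "x \<le> y"
  shows "rderiv g x * (y - x) \<le> g y - g x"
proof (cases "x = y")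
  case False
  then have "rderiv g x \<le> (g y - g x) / (y - x)"
    unfolding rderiv_def using xy by (intro cInf_lower rderiv_slope_bdd[OF g]) auto
  then show ?thesis using False xy by (simp add: field_simps)
qed simp

text \<open>Every subgradient at \<open>y\<close> lies below all slopes to the right of
  \<open>y\<close>, hence below \<open>rderiv g y\<close>.\<close>

lemma rderiv_upper:
  assumes g: "convex_on UNIV g" and xy: "x \<le> y"
  shows "g y - g x \<le> rderiv g y * (y - x)"
proof -
  obtain q where q: "\<And>z. g y + q * (z - y) \<le> g z" using real_subgradient[OF g, of y] by blast
  have "q \<le> rderiv g y"
    unfolding rderiv_def
  proof (rule cInf_greatest)
    fix s assume "s \<in> (\<lambda>z. (g z - g y) / (z - y)) ` {y<..}"
    then obtain z where z: "z > y" "s = (g z - g y) / (z - y)" by auto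
    then show "q \<le> s" using q[of z] by (simp add: le_divide_eq)
  qed simp
  then have "q * (y - x) \<le> rderiv g y * (y - x)" using xy by (intro mult_right_mono) auto
  then show ?thesis using q[of x] by (simp add: algebra_simps)
qed

lemma rderiv_mono:
  assumes g: "convex_on UNIV g" and xy: "x \<le> y"
  shows "rderiv g x \<le> rderiv g y"
proof (cases "x = y")
  case False
  have "rderiv g x * (y - x) \<le> rderiv g y * (y - x)"
    using rderiv_lower[OF assms] rderiv_upper[OF assms] by linarith
  then show ?thesis using False xy by simp
qed simp

text \<open>Some chord starting at \<open>a\<close> has slope close to \<open>rderiv g a\<close>.
  Moving its left end slightly to \<open>z\<close> changes the slope little, and that slope bounds
  \<open>rderiv g z\<close>.\<close>

lemma rderiv_right_continuous:
  assumes g: "convex_on UNIV g"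
  shows "continuous (at_right a) (rderiv g)"
proof (subst continuous_at_right_real_increasing[OF rderiv_mono[OF g]], assumption, intro allI impI)
  fix e :: real assume e: "e > 0"
  have cont: "continuous_on UNIV g" by (rule convex_on_continuous[OF open_UNIV g])
  let ?S = "(\<lambda>y. (g y - g a) / (y - a)) ` {a<..}"
  have "Inf ?S < rderiv g a + e" using e by (simp add: rderiv_def)
  then have "\<exists>s\<in>?S. s < rderiv g a + e" by (intro cInf_lessD) auto
  then obtain y where y: "y > a" "(g y - g a) / (y - a) < rderiv g a + e" by auto
  have "((\<lambda>z. (g y - g z) / (y - z)) \<longlongrightarrow> (g y - g a) / (y - a)) (at_right a)"
    using y cont by (intro tendsto_intros) (auto simp: continuous_on_def intro: tendsto_within_subset)
  then have "eventually (\<lambda>z. (g y - g z) / (y - z) < rderiv g a + e) (at_right a)"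
    using y(2) by (rule order_tendstoD(2))
  then obtain c where c: "c > a" "\<And>z. z > a \<Longrightarrow> z < c \<Longrightarrow> (g y - g z) / (y - z) < rderiv g a + e"
    unfolding eventually_at_right_field by auto
  define z where "z = (a + min c y) / 2"
  have z: "z > a" "z < c" "z < y" using c y by (auto simp: z_def)
  have "rderiv g z \<le> (g y - g z) / (y - z)" using rderiv_lower[OF g, of z y] z by (simp add: field_simps)
  then have "rderiv g z - rderiv g a < e" using c(2)[OF z(1,2)] by simp
  then show "\<exists>\<delta>>0. rderiv g (a + \<delta>) - rderiv g a < e" using z by (intro exI[of _ "z - a"]) auto
qed

text \<open>On a partition into \<open>n\<close> equal pieces the increments of \<open>F\<close>
  telescope, so the total change of \<open>D\<close> is at most a constant divided by
  \<open>n\<close>. This replaces an argument with derivatives, which need not exist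
  everywhere.\<close>

lemma constant_if_monotone_modulus:
  fixes D F :: "real \<Rightarrow> real"
  assumes ax: "a \<le> x" and D: "\<And>s t. a \<le> s \<Longrightarrow> s \<le> t \<Longrightarrow> t \<le> x \<Longrightarrow> \<bar>D t - D s\<bar> \<le> (t - s) * (F t - F s)"
  shows "D x = D a"
proof -
  have bound: "\<bar>D x - D a\<bar> \<le> ((x - a) * (F x - F a)) * inverse (real (Suc n))" for n
  proof -
    define N where "N = real (Suc n)"
    define h where "h = (x - a) / N"
    have N: "N > 0" by (simp add: N_def)
    have h0: "h \<ge> 0" using ax N by (simp add: h_def)
    have hN: "a + N * h = x" using N by (simp add: h_def)
    have "k \<le> Suc n \<Longrightarrow> \<bar>D (a + real k * h) - D a\<bar> \<le> h * (F (a + real k * h) - F a)" for k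
    proof (induction k)
      case (Suc k)
      have le: "a + real (Suc k) * h \<le> x"
        unfolding hN[symmetric] N_def using Suc.prems h0 by (intro add_left_mono mult_right_mono) auto
      have "\<bar>D (a + real (Suc k) * h) - D (a + real k * h)\<bar>
          \<le> (a + real (Suc k) * h - (a + real k * h)) * (F (a + real (Suc k) * h) - F (a + real k * h))"
        using h0 le by (intro D) (auto simp: algebra_simps)
      also have "a + real (Suc k) * h - (a + real k * h) = h" by (simp add: algebra_simps)
      finally show ?case using Suc by (simp add: algebra_simps)
    qed simp
    from this[of "Suc n"] have "\<bar>D x - D a\<bar> \<le> h * (F x - F a)" using hN by (simp add: N_def)
    then show ?thesis by (simp add: h_def N_def divide_inverse mult_ac)
  qed
  have "(\<lambda>n. ((x - a) * (F x - F a)) * inverse (real (Suc n))) \<longlonglongrightarrow> ((x - a) * (F x - F a)) * 0"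
    by (intro tendsto_intros LIMSEQ_inverse_real_of_nat)
  then have "\<bar>D x - D a\<bar> \<le> ((x - a) * (F x - F a)) * 0"
    by (rule LIMSEQ_le_const) (use bound in auto)
  then show ?thesis by simp
qed

text \<open>Taylor's formula with the second derivative as a Stieltjes measure. Over
  \<open>[s, t]\<close> both sides grow by an amount between \<open>(t - s) (F s - F a)\<close> and
  \<open>(t - s) (F t - F a)\<close>, where \<open>F = rderiv g\<close>, so their difference is
  constant, and it vanishes at \<open>a\<close>.\<close>

lemma convex_hinge_representation:
  assumes g: "convex_on UNIV g" and ax: "a \<le> x"
  shows "(\<integral>\<^sup>+t. ennreal (max (x - t) 0) * indicator {a<..} t \<partial>interval_measure (rderiv g))
    = ennreal (g x - g a - rderiv g a * (x - a))"
proof -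
  let ?F = "rderiv g"
  define m where "m = interval_measure ?F"
  have [measurable_cong]: "sets m = sets borel" by (simp add: m_def)
  define K where "K s = (\<integral>\<^sup>+t. ennreal (max (s - t) 0) * indicator {a<..} t \<partial>m)" for s
  have em: "emeasure m {a<..s} = ennreal (?F s - ?F a)" if "a \<le> s" for s
    unfolding m_def using that by (intro emeasure_interval_measure_Ioc rderiv_mono[OF g] rderiv_right_continuous[OF g])
  have Ka: "K a = 0" unfolding K_def by (intro nn_integral_zero') (auto simp: indicator_def max_def ennreal_neg)
  have ci: "(\<integral>\<^sup>+t. ennreal c * indicator {a<..s} t \<partial>m) = ennreal (c * (?F s - ?F a))" if "c \<ge> 0" "a \<le> s" for c s
    using that rderiv_mono[OF g that(2)] by (subst nn_integral_cmult_indicator) (auto simp: em ennreal_mult)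
  have lo: "K s + ennreal ((t - s) * (?F s - ?F a)) \<le> K t" if st: "a \<le> s" "s \<le> t" for s t
  proof -
    have "K s + ennreal ((t - s) * (?F s - ?F a))
        = (\<integral>\<^sup>+r. ennreal (max (s - r) 0) * indicator {a<..} r + ennreal (t - s) * indicator {a<..s} r \<partial>m)"
      unfolding K_def using st by (subst ci[symmetric]) (auto simp: nn_integral_add)
    also have "\<dots> \<le> K t"
      unfolding K_def using st
      by (intro nn_integral_mono) (auto simp: indicator_def max_def simp flip: ennreal_plus intro!: ennreal_leI)
    finally show ?thesis .
  qed
  have hi: "K t \<le> K s + ennreal ((t - s) * (?F t - ?F a))" if st: "a \<le> s" "s \<le> t" for s t
  proof -
    have "K t \<le> (\<integral>\<^sup>+r. ennreal (max (s - r) 0) * indicator {a<..} r + ennreal (t - s) * indicator {a<..t} r \<partial>m)"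
      unfolding K_def using st
      by (intro nn_integral_mono) (auto simp: indicator_def max_def simp flip: ennreal_plus intro!: ennreal_leI)
    also have "\<dots> = K s + ennreal ((t - s) * (?F t - ?F a))"
      unfolding K_def using st by (subst ci[symmetric]) (auto simp: nn_integral_add)
    finally show ?thesis .
  qed
  have fin: "K s < \<infinity>" if "a \<le> s" for s
    using hi[of a s] that Ka by (simp add: order_le_less_trans)
  define k where "k s = enn2real (K s)" for s
  have Kk: "K s = ennreal (k s)" if "a \<le> s" for s using fin[OF that] by (simp add: k_def)
  have k0: "k s \<ge> 0" for s by (simp add: k_def)
  have F0: "?F s - ?F a \<ge> 0" if "a \<le> s" for s using rderiv_mono[OF g that] by simp
  have lo': "k s + (t - s) * (?F s - ?F a) \<le> k t" if st: "a \<le> s" "s \<le> t" for s t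
  proof -
    have "ennreal (k s + (t - s) * (?F s - ?F a)) \<le> ennreal (k t)"
      using lo[OF st] st F0[of s] k0 Kk[of s] Kk[of t] by (simp add: ennreal_plus)
    then show ?thesis using k0 by simp
  qed
  have hi': "k t \<le> k s + (t - s) * (?F t - ?F a)" if st: "a \<le> s" "s \<le> t" for s t
  proof -
    have "0 \<le> (t - s) * (?F t - ?F a)" using F0[of t] st by simp
    then have "ennreal (k t) \<le> ennreal (k s + (t - s) * (?F t - ?F a))"
      using hi[OF st] st k0 Kk[of s] Kk[of t] by (simp add: ennreal_plus)
    moreover have "0 \<le> k s + (t - s) * (?F t - ?F a)" using k0[of s] \<open>0 \<le> (t - s) * (?F t - ?F a)\<close> by simp
    ultimately show ?thesis using ennreal_le_iff by blast
  qed
  define D where "D s = k s - (g s - g a - ?F a * (s - a))" for s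
  have "D x = D a"
  proof (rule constant_if_monotone_modulus[OF ax])
    fix s t assume st: "a \<le> s" "s \<le> t" "t \<le> x"
    show "\<bar>D t - D s\<bar> \<le> (t - s) * (?F t - ?F s)"
      using lo'[OF st(1,2)] hi'[OF st(1,2)] rderiv_lower[OF g st(2)] rderiv_upper[OF g st(2)]
      unfolding D_def by (simp add: abs_le_iff algebra_simps)
  qed
  moreover have "D a = 0" using Ka by (simp add: D_def k_def)
  ultimately have "k x = g x - g a - ?F a * (x - a)" by (simp add: D_def)
  then show ?thesis using Kk[OF ax] by (simp add: K_def m_def)
qed

section \<open>Hinge functions and their integrals \<open>G\<close>\<close>

lemma hinge_Lipschitz: "max (x - s) 0 - max (x - t) 0 \<le> 1 * norm (s - t)" "max (s - x) 0 - max (t - x) 0 \<le> 1 * norm (s - t)"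
  for x s t :: real
  by (auto simp: max_def)

lemma P1_integrable_hinge:
  assumes "P1 \<alpha>"
  shows "integrable \<alpha> (\<lambda>\<xi>::real. max (x - \<xi>) 0)" "integrable \<alpha> (\<lambda>\<xi>::real. max (\<xi> - x) 0)"
  by (rule P1_integrable_Lipschitz[OF assms hinge_Lipschitz(1)], rule P1_integrable_Lipschitz[OF assms hinge_Lipschitz(2)])

lemma convex_on_hinge: "convex_on UNIV (\<lambda>\<xi>::real. max (x - \<xi>) 0)"
proof -
  have "convex_on UNIV (\<lambda>\<xi>::real. x - \<xi>)" by (intro convex_onI) (auto simp: algebra_simps)
  moreover have "convex_on UNIV (\<lambda>\<xi>::real. 0 :: real)" by (simp add: convex_on_const)
  ultimately show ?thesis by (rule convex_on_max)
qed

text \<open>\<open>G\<close> integrates hinges that open to the left, while the representation of a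
  convex function uses hinges that open to the right; the two differ by an affine function, so only
  the barycentre enters.\<close>

lemma nn_integral_hinge:
  assumes "P1 \<alpha>"
  shows "(\<integral>\<^sup>+\<xi>. ennreal (max (\<xi> - t) 0) \<partial>\<alpha>) = ennreal (G \<alpha> t + integral\<^sup>L \<alpha> (\<lambda>x. x) - t)"
proof -
  interpret prob_space \<alpha> using P1D(1)[OF assms] .
  have "(\<integral>\<^sup>+\<xi>. ennreal (max (\<xi> - t) 0) \<partial>\<alpha>) = ennreal (integral\<^sup>L \<alpha> (\<lambda>\<xi>. max (\<xi> - t) 0))"
    by (intro nn_integral_eq_integral P1_integrable_hinge[OF assms]) auto
  also have "integral\<^sup>L \<alpha> (\<lambda>\<xi>. max (\<xi> - t) 0) = integral\<^sup>L \<alpha> (\<lambda>\<xi>. max (t - \<xi>) 0 + (\<xi> - t))"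
    by (intro Bochner_Integration.integral_cong) (auto simp: max_def)
  also have "\<dots> = G \<alpha> t + (integral\<^sup>L \<alpha> (\<lambda>x. x) - t)"
    using P1_integrable_hinge[OF assms] P1D(4)[OF assms] by (simp add: G_def prob_space)
  finally show ?thesis by (simp add: add_diff_eq)
qed

text \<open>\<open>\<phi>a n\<close> replaces \<open>\<phi>\<close> to the left of \<open>-n\<close> by its right tangent at \<open>-n\<close>, so that up to an affine
  function it is a mixture of the hinges \<open>max (x - t) 0\<close>.\<close>

lemma cx_le_if_G_le:
  fixes \<alpha> \<beta> :: "real measure"
  assumes P: "P1 \<alpha>" "P1 \<beta>" and bar: "integral\<^sup>L \<alpha> (\<lambda>x. x) = integral\<^sup>L \<beta> (\<lambda>x. x)"
    and G: "\<And>x. G \<alpha> x \<le> G \<beta> x"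
  shows "cx_le \<alpha> \<beta>"
proof (rule cx_leI_P1[OF P])
  fix p qs
  define \<phi> where "\<phi> = maxaff p (qs :: (real \<times> real) list)"
  have \<phi>c: "convex_on UNIV \<phi>" unfolding \<phi>_def by (rule convex_on_maxaff)
  obtain L where L0: "L \<ge> 0" and "\<forall>x y. \<phi> x - \<phi> y \<le> L * norm (x - y)"
    unfolding \<phi>_def using maxaff_Lipschitz by blast
  then have L: "\<phi> x - \<phi> y \<le> L * \<bar>x - y\<bar>" for x y by simp
  have \<phi>m[measurable]: "\<phi> \<in> borel_measurable borel" by (rule convex_on_borel_measurable[OF \<phi>c])
  let ?F = "rderiv \<phi>"
  have F: "\<bar>?F a\<bar> \<le> L" for a
    using rderiv_lower[OF \<phi>c, of a "a + 1"] rderiv_upper[OF \<phi>c, of "a - 1" a] L[of "a + 1" a] L[of "a - 1" a]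
    by simp
  define \<psi> where "\<psi> a x = (if a \<le> x then \<phi> x - \<phi> a - ?F a * (x - a) else 0)" for a x
  have \<psi>0: "\<psi> a x \<ge> 0" for a x using rderiv_lower[OF \<phi>c, of a x] by (auto simp: \<psi>_def)
  have \<psi>m[measurable]: "\<psi> a \<in> borel_measurable borel" for a unfolding \<psi>_def[abs_def] by measurable
  have \<psi>b: "\<psi> a x \<le> 2 * L * (\<bar>x\<bar> + \<bar>a\<bar>)" for a x
  proof -
    have "- (?F a * (x - a)) \<le> L * \<bar>x - a\<bar>"
      using abs_ge_minus_self[of "?F a * (x - a)"] mult_right_mono[OF F[of a] abs_ge_zero[of "x - a"]]
      by (simp add: abs_mult)
    then have "\<psi> a x \<le> 2 * L * \<bar>x - a\<bar>"
      using L[of x a] mult_nonneg_nonneg[OF L0 abs_ge_zero[of "x - a"]] unfolding \<psi>_def by (cases "a \<le> x") auto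
    also have "\<dots> \<le> 2 * L * (\<bar>x\<bar> + \<bar>a\<bar>)" using L0 by (intro mult_left_mono) auto
    finally show ?thesis .
  qed
  have \<psi>i: "integrable M (\<psi> a)" if M: "P1 M" for M a
  proof (rule Bochner_Integration.integrable_bound)
    interpret prob_space M using P1D(1)[OF M] .
    show "integrable M (\<lambda>x. 2 * L * (\<bar>x\<bar> + \<bar>a\<bar>))" using P1D(4)[OF M] by simp
    show "\<psi> a \<in> borel_measurable M" by (rule P1_measurable[OF M \<psi>m])
    show "AE x in M. norm (\<psi> a x) \<le> norm (2 * L * (\<bar>x\<bar> + \<bar>a\<bar>))"
      using \<psi>0 \<psi>b L0 by (intro AE_I2) simp
  qed
  have rep: "(\<integral>\<^sup>+t. ennreal (max (x - t) 0) * indicator {a<..} t \<partial>interval_measure ?F) = ennreal (\<psi> a x)" for a x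
  proof (cases "a \<le> x")
    case True
    then show ?thesis using convex_hinge_representation[OF \<phi>c True] by (simp add: \<psi>_def)
  next
    case False
    then have "(\<integral>\<^sup>+t. ennreal (max (x - t) 0) * indicator {a<..} t \<partial>interval_measure ?F) = 0"
      by (intro nn_integral_zero') (auto simp: indicator_def max_def ennreal_neg)
    then show ?thesis using False by (simp add: \<psi>_def)
  qed
  have sf: "sigma_finite_measure (interval_measure ?F)"
    by (rule sigma_finite_interval_measure[OF rderiv_mono[OF \<phi>c] rderiv_right_continuous[OF \<phi>c]])
  \<comment> \<open>Fubini: the integral of \<open>\<psi> a\<close> is a mixture of hinge integrals,
    with a mixing measure that is the same for all \<open>M\<close>.\<close>
  have nn: "(\<integral>\<^sup>+x. ennreal (\<psi> a x) \<partial>M) = (\<integral>\<^sup>+t. ennreal (G M t + integral\<^sup>L M (\<lambda>x. x) - t) * indicator {a<..} t \<partial>interval_measure ?F)"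
    if M: "P1 M" for M a
  proof -
    interpret M: prob_space M using P1D(1)[OF M] .
    interpret I: sigma_finite_measure "interval_measure ?F" by (rule sf)
    interpret pair_sigma_finite M "interval_measure ?F" ..
    note [measurable_cong] = P1D(2)[OF M]
    have "(\<integral>\<^sup>+x. ennreal (\<psi> a x) \<partial>M) = (\<integral>\<^sup>+x. (\<integral>\<^sup>+t. ennreal (max (x - t) 0) * indicator {a<..} t \<partial>interval_measure ?F) \<partial>M)"
      by (simp only: rep)
    also have "\<dots> = (\<integral>\<^sup>+t. (\<integral>\<^sup>+x. ennreal (max (x - t) 0) * indicator {a<..} t \<partial>M) \<partial>interval_measure ?F)"
      by (rule Fubini'[symmetric]) measurable
    also have "\<dots> = (\<integral>\<^sup>+t. (\<integral>\<^sup>+x. ennreal (max (x - t) 0) \<partial>M) * indicator {a<..} t \<partial>interval_measure ?F)"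
      by (intro nn_integral_cong nn_integral_multc) measurable
    finally show ?thesis unfolding nn_integral_hinge[OF M] .
  qed
  have \<psi>le: "integral\<^sup>L \<alpha> (\<psi> a) \<le> integral\<^sup>L \<beta> (\<psi> a)" for a
  proof -
    have "(\<integral>\<^sup>+x. ennreal (\<psi> a x) \<partial>\<alpha>) \<le> (\<integral>\<^sup>+x. ennreal (\<psi> a x) \<partial>\<beta>)"
      unfolding nn[OF P(1)] nn[OF P(2)] bar using G by (intro nn_integral_mono mult_right_mono ennreal_leI) auto
    then show ?thesis
      using \<psi>i[OF P(1), of a] \<psi>i[OF P(2), of a] \<psi>0
      by (simp add: nn_integral_eq_integral integral_nonneg)
  qed
  define \<phi>a where "\<phi>a n x = (\<phi> (- real n) + ?F (- real n) * (x + real n)) + \<psi> (- real n) x" for n x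
  have \<phi>a_eq: "\<phi>a n x = (if - real n \<le> x then \<phi> x else \<phi> (- real n) + ?F (- real n) * (x + real n))" for n x
    by (simp add: \<phi>a_def \<psi>_def)
  have \<phi>ale: "integral\<^sup>L \<alpha> (\<phi>a n) \<le> integral\<^sup>L \<beta> (\<phi>a n)" for n
  proof -
    have "integral\<^sup>L M (\<phi>a n) = (\<phi> (- real n) + ?F (- real n) * (integral\<^sup>L M (\<lambda>x. x) + real n)) + integral\<^sup>L M (\<psi> (- real n))"
      if M: "P1 M" for M
    proof -
      interpret prob_space M using P1D(1)[OF M] .
      show ?thesis unfolding \<phi>a_def[abs_def] using P1D(4)[OF M] \<psi>i[OF M] by (simp add: prob_space)
    qed
    then show ?thesis using \<psi>le bar P by simp
  qed
  \<comment> \<open>The Lipschitz bound controls the tangents at all points \<open>-n\<close> at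
    once and gives an integrable majorant of linear growth.\<close>
  have lim: "(\<lambda>n. integral\<^sup>L M (\<phi>a n)) \<longlonglongrightarrow> integral\<^sup>L M \<phi>" if M: "P1 M" for M
  proof (rule integral_dominated_convergence)
    interpret prob_space M using P1D(1)[OF M] .
    show "\<phi> \<in> borel_measurable M" by (rule P1_measurable[OF M \<phi>m])
    show "\<phi>a n \<in> borel_measurable M" for n
      unfolding \<phi>a_def[abs_def] by (rule P1_measurable[OF M]) measurable
    show "integrable M (\<lambda>x. \<bar>\<phi> 0\<bar> + 2 * L * \<bar>x\<bar>)" using P1D(4)[OF M] by simp
    show "AE x in M. (\<lambda>n. \<phi>a n x) \<longlonglongrightarrow> \<phi> x"
    proof (rule AE_I2)
      fix x
      have "eventually (\<lambda>n. \<phi>a n x = \<phi> x) sequentially"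
        unfolding eventually_sequentially
      proof (intro exI allI impI)
        fix n assume "nat \<lceil>- x\<rceil> \<le> n"
        then have "- real n \<le> x" by linarith
        then show "\<phi>a n x = \<phi> x" by (simp add: \<phi>a_eq)
      qed
      then show "(\<lambda>n. \<phi>a n x) \<longlonglongrightarrow> \<phi> x" by (rule tendsto_eventually)
    qed
    show "AE x in M. norm (\<phi>a n x) \<le> \<bar>\<phi> 0\<bar> + 2 * L * \<bar>x\<bar>" for n
    proof (rule AE_I2)
      fix x
      have b: "\<bar>\<phi> y\<bar> \<le> \<bar>\<phi> 0\<bar> + L * \<bar>y\<bar>" for y using L[of y 0] L[of 0 y] by auto
      have Lx: "0 \<le> L * \<bar>x\<bar>" using L0 by simp
      show "norm (\<phi>a n x) \<le> \<bar>\<phi> 0\<bar> + 2 * L * \<bar>x\<bar>"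
      proof (cases "- real n \<le> x")
        case True
        then show ?thesis using b[of x] Lx by (simp add: \<phi>a_eq)
      next
        case False
        have "L * \<bar>- real n\<bar> \<le> L * \<bar>x\<bar>" using L0 False by (intro mult_left_mono) auto
        moreover have "\<bar>?F (- real n) * (x + real n)\<bar> \<le> L * \<bar>x\<bar>"
          unfolding abs_mult using L0 False F by (intro mult_mono) auto
        ultimately show ?thesis using False b[of "- real n"] by (simp add: \<phi>a_eq) 
      qed
    qed
  qed
  show "integral\<^sup>L \<alpha> (maxaff p qs) \<le> integral\<^sup>L \<beta> (maxaff p qs)"
    unfolding \<phi>_def[symmetric] using \<phi>ale by (intro LIMSEQ_le[OF lim[OF P(1)] lim[OF P(2)]]) auto
qed

section \<open>The join on the line\<close>

lemma filterlim_shift_at_bot: "filterlim (\<lambda>x::real. x + c) at_bot at_bot"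
  unfolding filterlim_at_bot eventually_at_bot_linorder
  by (intro allI) (metis add.commute add_le_cancel_left diff_add_cancel)

lemma filterlim_shift_at_top: "filterlim (\<lambda>x::real. x + c) at_top at_top"
  unfolding filterlim_at_top eventually_at_top_linorder
  by (intro allI) (metis add.commute add_le_cancel_left diff_add_cancel)

lemma eventually_le_of_nat: "eventually (\<lambda>n. c \<le> real n) sequentially"
  using filterlim_real_sequentially by (simp add: filterlim_at_top)

lemma filterlim_at_bot_sequentially:
  assumes "c > 0"
  shows "filterlim (\<lambda>n. a - c * real n) at_bot sequentially"
  unfolding filterlim_at_bot
proof
  fix Z
  show "eventually (\<lambda>n. a - c * real n \<le> Z) sequentially"
    using eventually_le_of_nat[of "(a - Z) / c"] by eventually_elim (use assms in \<open>simp add: field_simps\<close>)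
qed

text \<open>The Stieltjes measure of the right derivative is the candidate. The limit at minus
  infinity removes the boundary terms of the hinge representation, and the asymptote at plus
  infinity gives total mass 1 and the barycentre.\<close>

lemma exists_measure_with_G:
  assumes g: "convex_on UNIV g" and bot: "(g \<longlongrightarrow> 0) at_bot"
    and top: "((\<lambda>x. g x - (x - b)) \<longlongrightarrow> 0) at_top"
  shows "\<exists>\<rho>. P1 \<rho> \<and> integral\<^sup>L \<rho> (\<lambda>x. x) = b \<and> G \<rho> = g"
proof -
  let ?F = "rderiv g"
  define \<rho> where "\<rho> = interval_measure ?F"
  \<comment> \<open>Unit difference quotients on both sides inherit their limits from
    \<open>g\<close>.\<close>
  have sand: "g x - g (x - 1) \<le> ?F x" "?F x \<le> g (x + 1) - g x" for x
    using rderiv_upper[OF g, of "x - 1" x] rderiv_lower[OF g, of x "x + 1"] by auto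
  have F_bot: "(?F \<longlongrightarrow> 0) at_bot"
  proof (rule tendsto_sandwich)
    have sh: "((\<lambda>x. g (x + c)) \<longlongrightarrow> 0) at_bot" for c by (rule filterlim_compose[OF bot filterlim_shift_at_bot])
    show "((\<lambda>x. g x - g (x - 1)) \<longlongrightarrow> 0) at_bot" using tendsto_diff[OF bot sh[of "- 1"]] by simp
    show "((\<lambda>x. g (x + 1) - g x) \<longlongrightarrow> 0) at_bot" using tendsto_diff[OF sh[of 1] bot] by simp
  qed (use sand in auto)
  have F_top: "(?F \<longlongrightarrow> 1) at_top"
  proof (rule tendsto_sandwich)
    have sh: "((\<lambda>x. g (x + c) - (x + c - b)) \<longlongrightarrow> 0) at_top" for c
      by (rule filterlim_compose[OF top filterlim_shift_at_top])
    show "((\<lambda>x. g x - g (x - 1)) \<longlongrightarrow> 1) at_top"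
      using tendsto_add[OF tendsto_diff[OF top sh[of "- 1"]] tendsto_const[of 1]] by simp
    show "((\<lambda>x. g (x + 1) - g x) \<longlongrightarrow> 1) at_top"
      using tendsto_add[OF tendsto_diff[OF sh[of 1] top] tendsto_const[of 1]] by simp
  qed (use sand in auto)
  have F0: "?F x \<ge> 0" for x
    by (rule tendsto_upperbound[OF F_bot])
      (auto simp: eventually_at_bot_linorder intro!: exI[of _ x] rderiv_mono[OF g])
  have gmono: "g x \<le> g y" if "x \<le> y" for x y
    using rderiv_lower[OF g that] mult_nonneg_nonneg[OF F0[of x], of "y - x"] that by simp
  have g0: "g x \<ge> 0" for x
    by (rule tendsto_upperbound[OF bot])
      (auto simp: eventually_at_bot_linorder intro!: exI[of _ x] gmono)
  interpret \<rho>: real_distribution \<rho>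
    unfolding \<rho>_def
    by (rule real_distribution_interval_measure[OF rderiv_mono[OF g] rderiv_right_continuous[OF g] F_bot F_top])
  have nn: "(\<integral>\<^sup>+t. ennreal (max (x - t) 0) \<partial>\<rho>) = ennreal (g x)" for x
  proof -
    define f where "f n t = ennreal (max (x - t) 0) * indicator {- real n<..} t" for n t
    have "(\<lambda>n. \<integral>\<^sup>+t. f n t \<partial>\<rho>) \<longlonglongrightarrow> (\<integral>\<^sup>+t. ennreal (max (x - t) 0) \<partial>\<rho>)"
    proof (rule nn_integral_LIMSEQ)
      show "incseq f" unfolding f_def by (auto simp: incseq_def le_fun_def indicator_def)
      show "f n \<in> borel_measurable \<rho>" for n unfolding f_def[abs_def] by measurable
      show "(\<lambda>n. f n t) \<longlonglongrightarrow> ennreal (max (x - t) 0)" for t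
      proof (rule tendsto_eventually)
        show "eventually (\<lambda>n. f n t = ennreal (max (x - t) 0)) sequentially"
          using eventually_le_of_nat[of "1 - t"] by eventually_elim (simp add: f_def)
      qed
    qed
    moreover have "(\<lambda>n. \<integral>\<^sup>+t. f n t \<partial>\<rho>) \<longlonglongrightarrow> ennreal (g x)"
    proof (rule Lim_transform_eventually)
      have c: "(\<lambda>n. g (- real n)) \<longlonglongrightarrow> 0"
        using filterlim_compose[OF bot filterlim_at_bot_sequentially[of 1 0]] by simp
      have d: "(\<lambda>n. g ((x - real n) / 2)) \<longlonglongrightarrow> 0"
        using filterlim_compose[OF bot filterlim_at_bot_sequentially[of "1/2" "x/2"]] by (simp add: diff_divide_distrib)
      have ev: "eventually (\<lambda>n. - real n \<le> x) sequentially"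
        using eventually_le_of_nat[of "- x"] by eventually_elim simp
      \<comment> \<open>The boundary slope at \<open>-n\<close> times half the length to
        \<open>x\<close> is at most the increment of \<open>g\<close> up to the midpoint, and both
        values of \<open>g\<close> tend to 0.\<close>
      have "(\<lambda>n. ?F (- real n) * (x + real n)) \<longlonglongrightarrow> 0"
      proof (rule tendsto_sandwich[where f="\<lambda>_. 0"])
        show "eventually (\<lambda>n. 0 \<le> ?F (- real n) * (x + real n)) sequentially"
          using ev by eventually_elim (use F0 in simp)
        show "eventually (\<lambda>n. ?F (- real n) * (x + real n) \<le> 2 * (g ((x - real n) / 2) - g (- real n))) sequentially"
          using ev
        proof eventually_elim
          case (elim n)
          have "?F (- real n) * ((x - real n) / 2 - (- real n)) \<le> g ((x - real n) / 2) - g (- real n)"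
            using elim by (intro rderiv_lower[OF g]) (simp add: field_simps)
          moreover have "(x - real n) / 2 - (- real n) = (x + real n) / 2" by (simp add: field_simps)
          ultimately show ?case by (simp only:) (simp add: field_simps)
        qed
        show "(\<lambda>n. 2 * (g ((x - real n) / 2) - g (- real n))) \<longlonglongrightarrow> 0"
          using tendsto_mult[OF tendsto_const[of 2] tendsto_diff[OF d c]] by simp
      qed simp
      from tendsto_diff[OF tendsto_diff[OF tendsto_const[of "g x"] c] this]
      show "(\<lambda>n. ennreal (g x - g (- real n) - ?F (- real n) * (x + real n))) \<longlonglongrightarrow> ennreal (g x)"
        by (intro tendsto_ennrealI) simp
      show "eventually (\<lambda>n. ennreal (g x - g (- real n) - ?F (- real n) * (x + real n)) = (\<integral>\<^sup>+t. f n t \<partial>\<rho>)) sequentially"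
        using ev
      proof eventually_elim
        case (elim n)
        show ?case using convex_hinge_representation[OF g elim] by (simp add: f_def \<rho>_def)
      qed
    qed
    ultimately show ?thesis by (rule LIMSEQ_unique)
  qed
  have hint: "integrable \<rho> (\<lambda>t. max (x - t) 0)" for x
    using nn[of x] by (intro integrableI_nonneg) auto
  have hval: "integral\<^sup>L \<rho> (\<lambda>t. max (x - t) 0) = g x" for x
    using integral_eq_nn_integral[of "\<lambda>t. max (x - t) 0" \<rho>] nn[of x] g0 by simp
  \<comment> \<open>A truncated positive part is a constant minus a difference of two hinges, so its
    integral is known from \<open>g\<close>.\<close>
  have min_eq: "min (max t 0) (real n) = real n - (max (real n - t) 0 - max (0 - t) 0)" for t n
    by (auto simp: max_def min_def)
  have pos: "(\<integral>\<^sup>+t. ennreal (max t 0) \<partial>\<rho>) = ennreal (b + g 0)"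
  proof -
    have "(\<lambda>n. \<integral>\<^sup>+t. ennreal (min (max t 0) (real n)) \<partial>\<rho>) \<longlonglongrightarrow> (\<integral>\<^sup>+t. ennreal (max t 0) \<partial>\<rho>)"
    proof (rule nn_integral_LIMSEQ)
      show "incseq (\<lambda>n t. ennreal (min (max t 0) (real n)))"
        unfolding incseq_def le_fun_def by (intro allI impI ennreal_leI min.mono) auto
      show "(\<lambda>n. ennreal (min (max t 0) (real n))) \<longlonglongrightarrow> ennreal (max t 0)" for t :: real
      proof (rule tendsto_eventually)
        show "eventually (\<lambda>n. ennreal (min (max t 0) (real n)) = ennreal (max t 0)) sequentially"
          using eventually_le_of_nat[of t] by eventually_elim (auto simp: min_def max_def)
      qed
    qed measurable
    moreover have "(\<lambda>n. \<integral>\<^sup>+t. ennreal (min (max t 0) (real n)) \<partial>\<rho>) \<longlonglongrightarrow> ennreal (b + g 0)"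
    proof -
      \<comment> \<open>The right side is \<open>n - (g n - g 0)\<close>, arranged so that the
        quantity with known limit appears.\<close>
      have "(\<integral>\<^sup>+t. ennreal (min (max t 0) (real n)) \<partial>\<rho>) = ennreal (b - (g (real n) - (real n - b)) + b + g 0 - b)" for n
      proof -
        have "integrable \<rho> (\<lambda>t. min (max t 0) (real n))" unfolding min_eq by (intro Bochner_Integration.integrable_diff hint) simp
        then have "(\<integral>\<^sup>+t. ennreal (min (max t 0) (real n)) \<partial>\<rho>) = ennreal (integral\<^sup>L \<rho> (\<lambda>t. min (max t 0) (real n)))"
          by (intro nn_integral_eq_integral) auto
        also have "integral\<^sup>L \<rho> (\<lambda>t. min (max t 0) (real n)) = real n - (g (real n) - g 0)"
          unfolding min_eq Bochner_Integration.integral_diff[OF \<rho>.integrable_const Bochner_Integration.integrable_diff[OF hint hint]]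
            Bochner_Integration.integral_diff[OF hint hint] hval
          using \<rho>.prob_space by simp
        finally show ?thesis by (simp add: algebra_simps)
      qed
      moreover have "(\<lambda>n. g (real n) - (real n - b)) \<longlonglongrightarrow> 0"
        by (rule filterlim_compose[OF top filterlim_real_sequentially])
      then have "(\<lambda>n. ennreal (b - (g (real n) - (real n - b)) + b + g 0 - b)) \<longlonglongrightarrow> ennreal (b - 0 + b + g 0 - b)"
        by (intro tendsto_intros tendsto_ennrealI)
      ultimately show ?thesis by simp
    qed
    ultimately show ?thesis by (rule LIMSEQ_unique)
  qed
  have posint: "integrable \<rho> (\<lambda>t. max t 0)" using pos by (intro integrableI_nonneg) auto
  \<comment> \<open>Needed to read a real value off \<open>ennreal\<close>, which truncates negative
    numbers: all slopes are at most 1, so \<open>g\<close> stays below the line of slope 1 through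
    \<open>g 0\<close>.\<close>
  have bg: "b + g 0 \<ge> 0"
  proof -
    have "eventually (\<lambda>x. - (g 0) \<le> b - (g x - (x - b))) at_top"
      using eventually_ge_at_top[of 0]
    proof eventually_elim
      case (elim x)
      have "?F y \<le> 1" for y
        by (rule tendsto_lowerbound[OF F_top])
          (auto simp: eventually_at_top_linorder intro!: exI[of _ y] rderiv_mono[OF g])
      then have "g x - g 0 \<le> 1 * (x - 0)"
        using rderiv_upper[OF g elim] elim by (intro order_trans[OF rderiv_upper[OF g elim]] mult_right_mono) auto
      then show ?case by simp
    qed
    from tendsto_lowerbound[OF tendsto_diff[OF tendsto_const[of b] top] this] show ?thesis by simp
  qed
  have posval: "integral\<^sup>L \<rho> (\<lambda>t. max t 0) = b + g 0"
    using integral_eq_nn_integral[of "\<lambda>t. max t 0" \<rho>] pos bg by simp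
  have id: "(\<lambda>t. t) = (\<lambda>t. max t 0 - max (0 - t) (0::real))" by (auto simp: max_def)
  have idint: "integrable \<rho> (\<lambda>t. t)" by (subst id) (intro Bochner_Integration.integrable_diff posint hint)
  have "P1 \<rho>" unfolding P1_def using idint \<rho>.prob_space_axioms \<rho>.events_eq_borel by simp
  moreover have "integral\<^sup>L \<rho> (\<lambda>t. t) = b"
    by (subst id, subst Bochner_Integration.integral_diff[OF posint hint]) (unfold hval posval, simp)
  moreover have "G \<rho> = g" unfolding G_def using hval by auto
  ultimately show ?thesis by blast
qed

section \<open>Asymptotics of \<open>G\<close>, recovery of the measure, and the distributional
  second derivative\<close>

lemma G_convex:
  assumes "P1 \<alpha>"
  shows "convex_on UNIV (G \<alpha>)"
proof (rule convex_onI)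
  fix t x y :: real assume t: "0 < t" "t < 1"
  note i = P1_integrable_hinge(1)[OF assms]
  have "G \<alpha> ((1 - t) *\<^sub>R x + t *\<^sub>R y) \<le> integral\<^sup>L \<alpha> (\<lambda>\<xi>. (1 - t) * max (x - \<xi>) 0 + t * max (y - \<xi>) 0)"
    unfolding G_def
  proof (intro integral_mono Bochner_Integration.integrable_add integrable_mult_right i)
    fix \<xi>
    have "(1 - t) * x + t * y - \<xi> = (1 - t) * (x - \<xi>) + t * (y - \<xi>)" by (simp add: algebra_simps)
    moreover have "(1 - t) * (x - \<xi>) \<le> (1 - t) * max (x - \<xi>) 0" "t * (y - \<xi>) \<le> t * max (y - \<xi>) 0"
      using t by (auto intro: mult_left_mono)
    moreover have "0 \<le> (1 - t) * max (x - \<xi>) 0" "0 \<le> t * max (y - \<xi>) 0" using t by auto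
    ultimately show "max ((1 - t) *\<^sub>R x + t *\<^sub>R y - \<xi>) 0 \<le> (1 - t) * max (x - \<xi>) 0 + t * max (y - \<xi>) 0"
      by simp
  qed
  also have "\<dots> = (1 - t) * G \<alpha> x + t * G \<alpha> y" unfolding G_def using i by simp
  finally show "G \<alpha> ((1 - t) *\<^sub>R x + t *\<^sub>R y) \<le> (1 - t) * G \<alpha> x + t * G \<alpha> y" .
qed simp

lemma G_at_bot:
  assumes P: "P1 \<alpha>"
  shows "(G \<alpha> \<longlongrightarrow> 0) at_bot"
proof -
  have "((\<lambda>y. integral\<^sup>L \<alpha> (\<lambda>\<xi>. max (- y - \<xi>) 0)) \<longlongrightarrow> integral\<^sup>L \<alpha> (\<lambda>_. 0)) at_top"
  proof (rule integral_dominated_convergence_at_top[where w="\<lambda>\<xi>. \<bar>\<xi>\<bar>"])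
    show "(\<lambda>\<xi>. max (- y - \<xi>) 0) \<in> borel_measurable \<alpha>" for y by (rule P1_measurable[OF P]) measurable
    show "integrable \<alpha> (\<lambda>\<xi>. \<bar>\<xi>\<bar>)" using P1D(4)[OF P] by simp
    show "\<forall>\<^sub>F y in at_top. AE \<xi> in \<alpha>. norm (max (- y - \<xi>) 0) \<le> \<bar>\<xi>\<bar>"
      using eventually_ge_at_top[of 0] by eventually_elim (auto simp: max_def)
    have "\<forall>\<^sub>F y in at_top. max (- y - \<xi>) 0 = 0" for \<xi> :: real
      using eventually_ge_at_top[of "- \<xi>"] by eventually_elim (auto simp: max_def)
    then show "AE \<xi> in \<alpha>. ((\<lambda>y. max (- y - \<xi>) 0) \<longlongrightarrow> 0) at_top" by (intro AE_I2 tendsto_eventually)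
  qed simp
  then show ?thesis unfolding filterlim_at_bot_mirror by (simp add: G_def)
qed

lemma G_at_top:
  assumes P: "P1 \<alpha>"
  shows "((\<lambda>x. G \<alpha> x - (x - integral\<^sup>L \<alpha> (\<lambda>x. x))) \<longlongrightarrow> 0) at_top"
proof -
  interpret prob_space \<alpha> using P1D(1)[OF P] .
  have eq: "integral\<^sup>L \<alpha> (\<lambda>\<xi>. max (\<xi> - x) 0) = G \<alpha> x - (x - integral\<^sup>L \<alpha> (\<lambda>x. x))" for x
  proof -
    have "integral\<^sup>L \<alpha> (\<lambda>\<xi>. max (\<xi> - x) 0) = integral\<^sup>L \<alpha> (\<lambda>\<xi>. max (x - \<xi>) 0 + (\<xi> - x))"
      by (intro Bochner_Integration.integral_cong) (auto simp: max_def)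
    then show ?thesis using P1_integrable_hinge[OF P] P1D(4)[OF P] by (simp add: G_def prob_space)
  qed
  have "((\<lambda>x. integral\<^sup>L \<alpha> (\<lambda>\<xi>. max (\<xi> - x) 0)) \<longlongrightarrow> integral\<^sup>L \<alpha> (\<lambda>_. 0)) at_top"
  proof (rule integral_dominated_convergence_at_top[where w="\<lambda>\<xi>. \<bar>\<xi>\<bar>"])
    show "(\<lambda>\<xi>. max (\<xi> - x) 0) \<in> borel_measurable \<alpha>" for x by (rule P1_measurable[OF P]) measurable
    show "integrable \<alpha> (\<lambda>\<xi>. \<bar>\<xi>\<bar>)" using P1D(4)[OF P] by simp
    show "\<forall>\<^sub>F x in at_top. AE \<xi> in \<alpha>. norm (max (\<xi> - x) 0) \<le> \<bar>\<xi>\<bar>"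
      using eventually_ge_at_top[of 0] by eventually_elim (auto simp: max_def)
    have "\<forall>\<^sub>F x in at_top. max (\<xi> - x) 0 = 0" for \<xi> :: real
      using eventually_ge_at_top[of \<xi>] by eventually_elim (auto simp: max_def)
    then show "AE \<xi> in \<alpha>. ((\<lambda>x. max (\<xi> - x) 0) \<longlongrightarrow> 0) at_top" by (intro AE_I2 tendsto_eventually)
  qed simp
  then show ?thesis by (simp add: eq)
qed

lemma G_increment_cdf:
  assumes P: "P1 \<alpha>" and xy: "x \<le> y"
  shows "cdf \<alpha> x * (y - x) \<le> G \<alpha> y - G \<alpha> x" "G \<alpha> y - G \<alpha> x \<le> cdf \<alpha> y * (y - x)"
proof -
  interpret prob_space \<alpha> using P1D(1)[OF P] .
  note i = P1_integrable_hinge(1)[OF P]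
  have ind: "integrable \<alpha> (\<lambda>\<xi>. indicator {..s} \<xi> * (y - x))" for s
  proof (rule integrable_const_bound)
    show "AE \<xi> in \<alpha>. norm (indicator {..s} \<xi> * (y - x)) \<le> y - x" using xy by (intro AE_I2) (auto simp: indicator_def)
    show "(\<lambda>\<xi>. indicator {..s} \<xi> * (y - x)) \<in> borel_measurable \<alpha>" by (rule P1_measurable[OF P]) measurable
  qed
  have val: "integral\<^sup>L \<alpha> (\<lambda>\<xi>. indicator {..s} \<xi> * (y - x)) = cdf \<alpha> s * (y - x)" for s
    using P1D(3)[OF P] by (simp add: cdf_def)
  have Gd: "G \<alpha> y - G \<alpha> x = integral\<^sup>L \<alpha> (\<lambda>\<xi>. max (y - \<xi>) 0 - max (x - \<xi>) 0)"
    unfolding G_def using i by simp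
  show "cdf \<alpha> x * (y - x) \<le> G \<alpha> y - G \<alpha> x"
    unfolding Gd val[symmetric] using xy
    by (intro integral_mono ind Bochner_Integration.integrable_diff i) (auto simp: indicator_def max_def)
  show "G \<alpha> y - G \<alpha> x \<le> cdf \<alpha> y * (y - x)"
    unfolding Gd val[symmetric] using xy
    by (intro integral_mono ind Bochner_Integration.integrable_diff i) (auto simp: indicator_def max_def)
qed

lemma P1_real_distribution: "P1 \<alpha> \<Longrightarrow> real_distribution \<alpha>"
  using P1D(1,2)[of \<alpha>] by (simp add: real_distribution_def real_distribution_axioms_def)

text \<open>For \<open>x < y\<close> the chord slope of the common function lies between one
  distribution function at \<open>x\<close> and the other at \<open>y\<close>; right continuity
  closes the gap.\<close>

lemma G_injective:
  assumes P: "P1 \<alpha>" "P1 \<beta>" and G: "G \<alpha> = G \<beta>"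
  shows "\<alpha> = \<beta>"
proof -
  have le: "cdf \<alpha> x \<le> cdf \<beta> x" if P: "P1 \<alpha>" "P1 \<beta>" and G: "G \<alpha> = G \<beta>" for \<alpha> \<beta> x
  proof -
    interpret B: real_distribution \<beta> by (rule P1_real_distribution[OF P(2)])
    have "(cdf \<beta> \<longlongrightarrow> cdf \<beta> x) (at_right x)" using B.cdf_is_right_cont[of x] by (simp add: continuous_within)
    moreover have "eventually (\<lambda>y. cdf \<alpha> x \<le> cdf \<beta> y) (at_right x)"
      unfolding eventually_at_right_field
    proof (intro exI[of _ "x + 1"] conjI allI impI)
      fix y assume y: "x < y"
      have "cdf \<alpha> x * (y - x) \<le> cdf \<beta> y * (y - x)"
        using G_increment_cdf(1)[OF P(1), of x y] G_increment_cdf(2)[OF P(2), of x y] y unfolding G by linarith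
      then show "cdf \<alpha> x \<le> cdf \<beta> y" using y by simp
    qed simp
    ultimately show ?thesis by (rule tendsto_lowerbound) simp
  qed
  have "cdf \<alpha> = cdf \<beta>" using le[OF P G] le[OF P(2,1) G[symmetric]] by (intro ext antisym)
  then show ?thesis by (intro cdf_unique P1_real_distribution P)
qed

lemma deriv_zero_outside:
  fixes f :: "real \<Rightarrow> real"
  assumes f: "\<And>x. R < \<bar>x\<bar> \<Longrightarrow> f x = 0" and x: "R < \<bar>x\<bar>"
  shows "deriv f x = 0"
proof -
  have "open {x::real. R < \<bar>x\<bar>}" by (intro open_Collect_less continuous_intros)
  moreover have "((\<lambda>_. 0) has_field_derivative 0) (at x)" by simp
  ultimately have "(f has_field_derivative 0) (at x)"
    using f x by (rule_tac has_field_derivative_transform_within_open[of "\<lambda>_. 0" 0 x "{x. R < \<bar>x\<bar>}"]) auto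
  then show ?thesis by (rule DERIV_imp_deriv)
qed

text \<open>By Fubini it suffices to treat a single hinge, where two integrations by parts give
  \<open>\<phi> t\<close>. Compact support makes the double integral absolutely convergent.\<close>

lemma G_dist_2nd_deriv:
  assumes P: "P1 \<rho>"
  shows "is_dist_2nd_deriv (G \<rho>) \<rho>"
  unfolding is_dist_2nd_deriv_def
proof (intro conjI allI impI)
  show "sets \<rho> = sets borel" by (rule P1D(2)[OF P])
  fix \<phi> assume t: "test_fun \<phi>"
  then obtain R where R: "\<And>x. R < \<bar>x\<bar> \<Longrightarrow> \<phi> x = 0" by (auto simp: test_fun_def)
  have diff: "((deriv ^^ k) \<phi>) differentiable (at x)" for k x using t by (auto simp: test_fun_def)
  define h where "h = deriv (deriv \<phi>)"
  have d0: "(\<phi> has_real_derivative deriv \<phi> x) (at x)" for x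
    using diff[of 0 x] by (simp add: DERIV_deriv_iff_real_differentiable)
  have d1: "(deriv \<phi> has_real_derivative h x) (at x)" for x
    using diff[of 1 x] by (simp add: DERIV_deriv_iff_real_differentiable h_def)
  have "h differentiable (at x)" for x using diff[of 2 x] by (simp add: h_def numeral_2_eq_2)
  then have hc: "continuous_on UNIV h"
    by (metis differentiable_imp_continuous_within continuous_at_imp_continuous_on)
  have R1: "deriv \<phi> x = 0" if "R < \<bar>x\<bar>" for x by (rule deriv_zero_outside[OF R that])
  have R2: "h x = 0" if "R < \<bar>x\<bar>" for x unfolding h_def by (rule deriv_zero_outside[OF R1 that])
  have hm[measurable]: "h \<in> borel_measurable borel" by (rule borel_measurable_continuous_onI[OF hc])
  interpret \<rho>: prob_space \<rho> using P1D(1)[OF P] .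
  interpret pair_sigma_finite lborel \<rho> ..
  note [measurable_cong] = P1D(2)[OF P]
  note i = P1_integrable_hinge(1)[OF P]
  have Gc: "continuous_on UNIV (G \<rho>)" by (rule convex_on_continuous[OF open_UNIV G_convex[OF P]])
  have "integrable (lborel \<Otimes>\<^sub>M \<rho>) (\<lambda>(x, t). max (x - t) 0 * h x)"
  proof (rule Fubini_integrable)
    show "(\<lambda>(x, t). max (x - t) 0 * h x) \<in> borel_measurable (lborel \<Otimes>\<^sub>M \<rho>)" by measurable
    show "AE x in lborel. integrable \<rho> (\<lambda>t. case (x, t) of (x, t) \<Rightarrow> max (x - t) 0 * h x)"
      using i by (intro AE_I2) simp
    have "(\<integral>t. norm (case (x, t) of (x, t) \<Rightarrow> max (x - t) 0 * h x) \<partial>\<rho>) = indicator {- R..R} x *\<^sub>R (G \<rho> x * \<bar>h x\<bar>)" for x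
    proof (cases "R < \<bar>x\<bar>")
      case True
      then show ?thesis using R2[OF True] by simp
    next
      case False
      then have "x \<in> {- R..R}" by auto
      then show ?thesis by (simp add: abs_mult G_def)
    qed
    moreover have "integrable lborel (\<lambda>x. indicator {- R..R} x *\<^sub>R (G \<rho> x * \<bar>h x\<bar>))"
      by (rule borel_integrable_compact) (auto intro!: continuous_intros continuous_on_subset[OF Gc] continuous_on_subset[OF hc])
    ultimately show "integrable lborel (\<lambda>x. \<integral>t. norm (case (x, t) of (x, t) \<Rightarrow> max (x - t) 0 * h x) \<partial>\<rho>)" by simp
  qed
  from Fubini_integral[OF this]
  have "(\<integral>t. (\<integral>x. max (x - t) 0 * h x \<partial>lborel) \<partial>\<rho>) = (\<integral>x. (\<integral>t. max (x - t) 0 * h x \<partial>\<rho>) \<partial>lborel)" .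
  moreover have "(\<integral>t. max (x - t) 0 * h x \<partial>\<rho>) = G \<rho> x * h x" for x by (simp add: G_def)
  moreover have "(\<integral>x. max (x - t) 0 * h x \<partial>lborel) = \<phi> t" for t
  proof -
    \<comment> \<open>A right end beyond both \<open>t\<close> and the support, so that the
      antiderivative \<open>(x - t) \<phi>' - \<phi>\<close> vanishes there.\<close>
    define c where "c = max t R + 1"
    have c: "t \<le> c" "R < \<bar>c\<bar>" by (auto simp: c_def)
    have "(\<integral>x. max (x - t) 0 * h x \<partial>lborel) = (\<integral>x. indicator {t..c} x *\<^sub>R ((x - t) * h x) \<partial>lborel)"
    proof (rule Bochner_Integration.integral_cong)
      fix x
      consider "x < t" | "t \<le> x" "x \<le> c" | "c < x" by linarith
      then show "max (x - t) 0 * h x = indicator {t..c} x *\<^sub>R ((x - t) * h x)"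
      proof cases
        case 3
        then have "R < \<bar>x\<bar>" by (auto simp: c_def)
        then show ?thesis using R2 by simp
      qed (auto simp: indicator_def max_def)
    qed simp
    also have "\<dots> = ((c - t) * deriv \<phi> c - \<phi> c) - ((t - t) * deriv \<phi> t - \<phi> t)"
    proof (rule integral_FTC_atLeastAtMost[OF c(1)])
      show "continuous_on {t..c} (\<lambda>x. (x - t) * h x)"
        by (intro continuous_intros continuous_on_subset[OF hc]) auto
      fix x
      have "((\<lambda>x. (x - t) * deriv \<phi> x - \<phi> x) has_real_derivative (x - t) * h x) (at x)"
        by (auto intro!: derivative_eq_intros d0 d1)
      then show "((\<lambda>x. (x - t) * deriv \<phi> x - \<phi> x) has_vector_derivative (x - t) * h x) (at x within {t..c})"
        by (simp add: has_real_derivative_iff_has_vector_derivative has_vector_derivative_at_within)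
    qed
    also have "\<dots> = \<phi> t" using R[OF c(2)] R1[OF c(2)] by simp
    finally show ?thesis .
  qed
  ultimately show "(LBINT x. G \<rho> x * deriv (deriv \<phi>) x) = integral\<^sup>L \<rho> \<phi>" by (simp only: h_def)
qed

lemma G_le_if_cx_le:
  assumes "P2 \<alpha>" "P2 \<beta>" "cx_le \<alpha> \<beta>"
  shows "G \<alpha> x \<le> G \<beta> x"
  unfolding G_def using assms by (intro cx_leD convex_on_hinge P1_integrable_hinge P2_imp_P1)

text \<open>The extended-valued integral in \<open>cx_le\<close> is essential here:
  \<open>|x|^2\<close> can be tested before its integral under \<alpha> is known to be
  finite.\<close>

lemma P2_if_cx_le:
  fixes \<alpha> \<beta> :: "'a::euclidean_space measure"
  assumes \<alpha>: "P1 \<alpha>" and \<beta>: "P2 \<beta>" and le: "cx_le \<alpha> \<beta>"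
  shows "P2 \<alpha>"
proof -
  have "ext_integral \<alpha> (\<lambda>x. (norm x)\<^sup>2) \<le> ext_integral \<beta> (\<lambda>x. (norm x)\<^sup>2)"
    by (rule le[unfolded cx_le_def, rule_format, OF convex_on_norm_sq])
  also have "\<dots> = ereal (m2 \<beta>)" unfolding m2_def by (rule ext_integral_integrable[OF P2D(4)[OF \<beta>]])
  finally have "enn2ereal (\<integral>\<^sup>+x. ennreal ((norm x)\<^sup>2) \<partial>\<alpha>) \<le> ereal (m2 \<beta>)"
    by (simp add: ext_integral_def ennreal_neg zero_ennreal.rep_eq)
  then have "(\<integral>\<^sup>+x. ennreal ((norm x)\<^sup>2) \<partial>\<alpha>) < \<infinity>" by (auto simp: top.not_eq_extremum[symmetric])
  moreover have "(\<lambda>x. (norm x)\<^sup>2) \<in> borel_measurable \<alpha>" by (rule P1_measurable[OF \<alpha>]) measurable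
  ultimately show ?thesis using P1D(1,2)[OF \<alpha>] by (simp add: P2_def integrable_iff_bounded)
qed

lemma cx_join_real:
  fixes \<mu> \<nu> :: "real measure"
  assumes b: "P2b b \<mu>" "P2b b \<nu>"
  shows "\<exists>\<rho>. cx_max1 \<mu> \<nu> \<rho> \<and> cx_join \<mu> \<nu> = {\<rho>}"
proof -
  have P: "P2 \<mu>" "P2 \<nu>" and bar: "integral\<^sup>L \<mu> (\<lambda>x. x) = b" "integral\<^sup>L \<nu> (\<lambda>x. x) = b"
    using b by (auto simp: P2b_def)
  note Q = P2_imp_P1[OF P(1)] P2_imp_P1[OF P(2)]
  define g where "g x = max (G \<mu> x) (G \<nu> x)" for x
  have "\<exists>\<rho>. P1 \<rho> \<and> integral\<^sup>L \<rho> (\<lambda>x. x) = b \<and> G \<rho> = g"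
  proof (rule exists_measure_with_G)
    show "convex_on UNIV g" unfolding g_def[abs_def] by (intro convex_on_max G_convex Q)
    show "(g \<longlongrightarrow> 0) at_bot"
      unfolding g_def[abs_def] using tendsto_max[OF G_at_bot[OF Q(1)] G_at_bot[OF Q(2)]] by simp
    have "(\<lambda>x. g x - (x - b)) = (\<lambda>x. max (G \<mu> x - (x - b)) (G \<nu> x - (x - b)))" by (auto simp: g_def max_def)
    then show "((\<lambda>x. g x - (x - b)) \<longlongrightarrow> 0) at_top"
      using tendsto_max[OF G_at_top[OF Q(1)] G_at_top[OF Q(2)]] bar by simp
  qed
  then obtain \<rho> where \<rho>: "P1 \<rho>" "integral\<^sup>L \<rho> (\<lambda>x. x) = b" "G \<rho> = g" by blast
  have le: "cx_le \<rho> \<sigma>" if \<sigma>: "P2 \<sigma>" "cx_le \<mu> \<sigma>" "cx_le \<nu> \<sigma>" for \<sigma>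
  proof (rule cx_le_if_G_le[OF \<rho>(1) P2_imp_P1[OF \<sigma>(1)]])
    show "integral\<^sup>L \<rho> (\<lambda>x. x) = integral\<^sup>L \<sigma> (\<lambda>x. x)" using cx_le_barycentre[OF P(1) \<sigma>(1,2)] \<rho>(2) bar by simp
    show "G \<rho> x \<le> G \<sigma> x" for x
      using G_le_if_cx_le[OF P(1) \<sigma>(1,2)] G_le_if_cx_le[OF P(2) \<sigma>(1,3)] by (simp add: \<rho>(3) g_def)
  qed
  \<comment> \<open>A join element is already known to exist, and it dominates \<rho>; this supplies
    the second moment of \<rho>.\<close>
  obtain \<sigma>0 where \<sigma>0: "\<sigma>0 \<in> cx_join \<mu> \<nu>" using cx_join_nonempty[OF b] .
  then have P2\<rho>: "P2 \<rho>" using P2_if_cx_le[OF \<rho>(1)] le[of \<sigma>0] by (auto simp: cx_join_iff[OF b])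
  have "G \<mu> x \<le> G \<rho> x" "G \<nu> x \<le> G \<rho> x" for x unfolding \<rho>(3) g_def by simp_all
  then have f: "cx_le \<mu> \<rho>" "cx_le \<nu> \<rho>"
    using \<rho>(1,2) bar Q by (simp_all add: cx_le_if_G_le)
  have low: "m2 \<rho> \<le> m2 \<sigma>" if "P2 \<sigma>" "cx_le \<mu> \<sigma>" "cx_le \<nu> \<sigma>" for \<sigma>
    using m2_mono[OF P2\<rho> that(1) le[OF that]] .
  have "\<rho> \<in> cx_join \<mu> \<nu>"
    unfolding cx_join_def is_arg_min_def using P2\<rho> f low by (auto simp: not_less)
  moreover have "\<sigma> = \<rho>" if \<sigma>: "\<sigma> \<in> cx_join \<mu> \<nu>" for \<sigma>
  proof -
    have \<sigma>f: "P2 \<sigma>" "cx_le \<mu> \<sigma>" "cx_le \<nu> \<sigma>" and m: "m2 \<sigma> \<le> m2 \<rho>"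
      using \<sigma> \<open>\<rho> \<in> cx_join \<mu> \<nu>\<close> by (auto simp: cx_join_iff[OF b])
    \<comment> \<open>Both second moments are minimal and \<rho> lies below \<sigma>, so rigidity
      applies to every hinge.\<close>
    have "G \<rho> x = G \<sigma> x" for x
      unfolding G_def by (rule cx_le_equal_m2_rigid[OF P2\<rho> \<sigma>f(1) le[OF \<sigma>f] m convex_on_hinge hinge_Lipschitz(1)])
    then show ?thesis by (intro G_injective[OF P2_imp_P1[OF \<sigma>f(1)] \<rho>(1)]) auto
  qed
  moreover have "cx_max1 \<mu> \<nu> \<rho>"
    using G_dist_2nd_deriv[OF \<rho>(1)] unfolding cx_max1_def \<rho>(3) g_def[abs_def] .
  ultimately show ?thesis by blast
qed

theorem theorem5p7:
  fixes b :: "'a::euclidean_space" and \<mu> \<nu> :: "'a measure"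
  assumes "P2b b \<mu>" and "P2b b \<nu>"
  shows "zproj \<mu> \<nu> = cx_join \<mu> \<nu> \<and> zproj \<nu> \<mu> = cx_join \<mu> \<nu>
    \<and> cx_join \<mu> \<nu> \<noteq> {} \<and> mix_convex (cx_join \<mu> \<nu>)
    \<and> (\<forall>\<rho>b \<in> cx_join \<mu> \<nu>.
          (\<exists>\<rho>. P2 \<rho> \<and> cx_le \<mu> \<rho> \<and> Z2 \<nu> \<rho> = (m2 \<rho>b - m2 \<nu>) / 2)
        \<and> (\<forall>\<rho>. P2 \<rho> \<and> cx_le \<mu> \<rho> \<longrightarrow> (m2 \<rho>b - m2 \<nu>) / 2 \<le> Z2 \<nu> \<rho>)
        \<and> (m2 \<rho>b - m2 \<nu>) / 2 = (Z2 \<mu> \<nu> - (m2 \<nu> - m2 \<mu>) / 2) / 2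
        \<and> (\<exists>\<rho>. P2 \<rho> \<and> cx_le \<nu> \<rho> \<and> Z2 \<mu> \<rho> = (m2 \<rho>b - m2 \<mu>) / 2)
        \<and> (\<forall>\<rho>. P2 \<rho> \<and> cx_le \<nu> \<rho> \<longrightarrow> (m2 \<rho>b - m2 \<mu>) / 2 \<le> Z2 \<mu> \<rho>)
        \<and> (m2 \<rho>b - m2 \<mu>) / 2 = (Z2 \<mu> \<nu> - (m2 \<mu> - m2 \<nu>) / 2) / 2)
    \<and> (\<forall>(b1::real) (\<mu>1::real measure) \<nu>1. P2b b1 \<mu>1 \<and> P2b b1 \<nu>1 \<longrightarrow>
          (\<exists>\<rho>. cx_max1 \<mu>1 \<nu>1 \<rho> \<and> zproj \<mu>1 \<nu>1 = {\<rho>} \<and> zproj \<nu>1 \<mu>1 = {\<rho>}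
               \<and> cx_join \<mu>1 \<nu>1 = {\<rho>}))
    \<and> (DIM('a) > 1 \<longrightarrow> (\<exists>(b'::'a) \<mu>' \<nu>'. P2b b' \<mu>' \<and> P2b b' \<nu>' \<and>
          (\<exists>\<rho>1 \<rho>2. \<rho>1 \<in> cx_join \<mu>' \<nu>' \<and> \<rho>2 \<in> cx_join \<mu>' \<nu>' \<and> \<rho>1 \<noteq> \<rho>2)))"
proof (intro conjI ballI allI impI)
  note b = assms and b' = assms(2,1)
  show "zproj \<mu> \<nu> = cx_join \<mu> \<nu>" by (rule zproj_eq_cx_join[OF b])
  show "zproj \<nu> \<mu> = cx_join \<mu> \<nu>" using zproj_eq_cx_join[OF b'] cx_join_commute by metis
  show "cx_join \<mu> \<nu> \<noteq> {}" using cx_join_nonempty[OF b] by blast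
  show "mix_convex (cx_join \<mu> \<nu>)" by (rule cx_join_mix_convex[OF b])
next
  fix \<rho>b assume \<rho>: "\<rho>b \<in> cx_join \<mu> \<nu>"
  then have \<rho>': "\<rho>b \<in> cx_join \<nu> \<mu>" using cx_join_commute by metis
  have f: "P2 \<rho>b" "cx_le \<mu> \<rho>b" "cx_le \<nu> \<rho>b" and m: "m2 \<rho>b = Z2 \<mu> \<nu> + (m2 \<mu> + m2 \<nu>) / 2"
    using \<rho> by (auto simp: cx_join_iff[OF assms])
  show "\<exists>\<rho>. P2 \<rho> \<and> cx_le \<mu> \<rho> \<and> Z2 \<nu> \<rho> = (m2 \<rho>b - m2 \<nu>) / 2"
    using f Z2_cx_join(1)[OF assms \<rho>] by blast
  show "\<exists>\<rho>. P2 \<rho> \<and> cx_le \<nu> \<rho> \<and> Z2 \<mu> \<rho> = (m2 \<rho>b - m2 \<mu>) / 2"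
    using f Z2_cx_join(1)[OF assms(2,1) \<rho>'] by blast
  show "(m2 \<rho>b - m2 \<nu>) / 2 \<le> Z2 \<nu> \<rho>" if "P2 \<rho> \<and> cx_le \<mu> \<rho>" for \<rho>
    using Z2_cx_join(2)[OF assms \<rho>] that by blast
  show "(m2 \<rho>b - m2 \<mu>) / 2 \<le> Z2 \<mu> \<rho>" if "P2 \<rho> \<and> cx_le \<nu> \<rho>" for \<rho>
    using Z2_cx_join(2)[OF assms(2,1) \<rho>'] that by blast
  show "(m2 \<rho>b - m2 \<nu>) / 2 = (Z2 \<mu> \<nu> - (m2 \<nu> - m2 \<mu>) / 2) / 2" unfolding m by argo
  show "(m2 \<rho>b - m2 \<mu>) / 2 = (Z2 \<mu> \<nu> - (m2 \<mu> - m2 \<nu>) / 2) / 2" unfolding m by argo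
next
  fix b1 and \<mu>1 \<nu>1 :: "real measure" assume b: "P2b b1 \<mu>1 \<and> P2b b1 \<nu>1"
  obtain \<rho> where \<rho>: "cx_max1 \<mu>1 \<nu>1 \<rho>" "cx_join \<mu>1 \<nu>1 = {\<rho>}" using cx_join_real b by blast
  moreover have "zproj \<mu>1 \<nu>1 = {\<rho>}" using zproj_eq_cx_join b \<rho>(2) by metis
  moreover have "zproj \<nu>1 \<mu>1 = {\<rho>}" using zproj_eq_cx_join b \<rho>(2) cx_join_commute by metis
  ultimately show "\<exists>\<rho>. cx_max1 \<mu>1 \<nu>1 \<rho> \<and> zproj \<mu>1 \<nu>1 = {\<rho>} \<and> zproj \<nu>1 \<mu>1 = {\<rho>} \<and> cx_join \<mu>1 \<nu>1 = {\<rho>}" by blast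
next
  assume "DIM('a) > 1"
  then show "\<exists>(b'::'a) \<mu>' \<nu>'. P2b b' \<mu>' \<and> P2b b' \<nu>' \<and>
          (\<exists>\<rho>1 \<rho>2. \<rho>1 \<in> cx_join \<mu>' \<nu>' \<and> \<rho>2 \<in> cx_join \<mu>' \<nu>' \<and> \<rho>1 \<noteq> \<rho>2)"
    by (rule cx_join_not_unique)
qed

end
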